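(* Let $s_{\mathrm{SRT}}$ be a sparse residual tree prediction of a function $f$ with respect to the data $(X,f_X)$, based on arbitrary basis functions belonging to $W_p^k(\Omega)$. If $f\in W_p^k(\Omega)$ and $r_L=f-s_{\mathrm{SRT}}$ is the residual on an arbitrary leaf node $\Omega_{L-1}$, then for any $1\leqslant q\leqslant\infty$, $\gamma\in\mathbb{N}_0^d$, and $1\leqslant p<\infty$ with $k>|\gamma|+d/p$ if $p>1$, or with $k\geqslant|\gamma|+d$ if $p=1$, it holds, for all sufficiently small fill distance $h$, that $$\|D^\gamma r_L\|_{L_q(\Omega_{L-1})}\leqslant C\left[h^{k-|\gamma|-\left(\frac dp-\frac dq\right)_+}\left(|f|_{W_p^k(\Omega)}+C_W\tau^{-1}\|f_X\|_2\right)+h^{-|\gamma|}\,\big\|r_L|X_{L-1}\big\|_\infty\right],$$ where $(t)_+=\max(t,0)$, the constant $C$ does not depend on $f$, $r_L$ or $h$, and $C_W$ is a constant, determined by the basis functions together with $d,p,k$, for which $|s_{\mathrm{SRT}}|_{W_p^k(\Omega_{L-1})}\leqslant C_W\tau^{-1}\|f_X\|_2$.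
   Context: Let $d\in\mathbb{N}$, let $\Omega\subset\mathbb{R}^d$ be a convex domain, $f:\Omega\to\mathbb{R}$ or $\mathbb{C}$, $X=\{x_1,\dots,x_N\}\subset\Omega$ a set of pairwise distinct points with fill distance $h=h_{X,\Omega}=\sup_{x\in\Omega}\min_{x_i\in X}\|x-x_i\|_2$, and $f_X=(f(x_1),\dots,f(x_N))^{\mathrm T}$. A sparse residual tree (SRT) is a binary tree; each node carries a convex subdomain of $\Omega$ and the data points lying in it, and the two children of a node are obtained by cutting its subdomain with a hyperplane. Consider the path from the root to a leaf (lowest-level) node $\Omega_{L-1}$, with $L$ levels: domains $\Omega=\Omega_0\supset\Omega_1\supset\cdots\supset\Omega_{L-1}$ and datasets $X=X_0\supset X_1\supset\cdots\supset X_{L-1}$ with $X_i=X\cap\Omega_i$ and strictly decreasing sizes. At each level $0\leqslant i\leqslant L-1$ there are finitely many basis functions $\varphi_i^{(1)},\dots,\varphi_i^{(N_i')}$. Put $r_0=f$ and, recursively, let $s_i=\sum_{j=1}^{N_i'}\alpha_i^{(j)}\varphi_i^{(j)}$ be the least squares approximation of $r_i$ on $X_i$ (i.e. $\alpha_i$ minimizes $\|\Phi_i\alpha-r_i(X_i)\|_2$, where $\Phi_i=\big(\varphi_i^{(j)}(x)\big)_{x\in X_i,\,1\leqslant j\leqslant N_i'}$), and $r_{i+1}=r_i-s_i$. Let $\Phi_i=Q_iR_i$ be the QR decomposition ($Q_i$ with orthonormal columns, $R_i$ upper triangular and invertible), let $\tau_i$ be the smallest singular value of $R_i$, and $\tau=\min_{0\leqslant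 i\leqslant L-1}\tau_i$. The SRT prediction on the leaf is $s_{\mathrm{SRT}}(x)=\sum_{i=0}^{L-1}s_i(x)$, $x\in\Omega_{L-1}$. $W_p^k(\Omega)$ is the Sobolev space of functions with distributional derivatives $D^\gamma f\in L_p(\Omega)$ for $|\gamma|\leqslant k$, with seminorm $|f|_{W_p^k(\Omega)}=\big(\sum_{|\gamma|=k}\|D^\gamma f\|_{L_p(\Omega)}^p\big)^{1/p}$. $\|r_L|X_{L-1}\|_\infty$ denotes $\max_{x\in X_{L-1}}|r_L(x)|$. *)

theory Defs
  imports
    "HOL-Analysis.Analysis"
    "HOL-Probability.Essential_Supremum"
    "Jordan_Normal_Form.Schur_Decomposition"
begin

text \<open>The symbols \<open>$\<close> and \<open>\<bullet>\<close> keep their \<open>Jordan_Normal_Form\<close> meaning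
  (vector entries, scalar product); the types \<open>real ^ 'n\<close> are only used for points of the domain.\<close>

unbundle no vec_syntax
unbundle no inner_syntax


section \<open>Scalars\<close>

text \<open>Functions are real- or complex-valued. This class has exactly these two models: a
  finite-dimensional real normed field is \<open>\<real>\<close> or \<open>\<complex>\<close>, and the axiom
  forces \<open>conjugate\<close> to be the usual conjugation.\<close>

class real_or_complex = real_normed_field + euclidean_space + conjugatable_field +
  assumes conjugate_mult_self: "conjugate x * x = (norm x)\<^sup>2 *\<^sub>R 1"

instance real :: real_or_complex
  by standard (simp add: power2_eq_square)

instance complex :: real_or_complex
  by standard (simp add: scaleR_conv_of_real mult.commute[of "cnj _"] complex_norm_square[symmetric] del: of_real_power)


section \<open>Lebesgue norms\<close>

definition eLp_norm :: "ennreal \<Rightarrow> (real^'n) set \<Rightarrow> (real^'n \<Rightarrow> 'b::real_normed_vector) \<Rightarrow> ennreal" where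
  "eLp_norm q S g =
     (if q = \<infinity> then esssup (lebesgue_on S) (\<lambda>x. ennreal (norm (g x)))
      else (let I = (\<integral>\<^sup>+ x. ennreal (norm (g x) powr enn2real q) \<partial>lebesgue_on S)
            in if I = \<infinity> then \<infinity> else ennreal (enn2real I powr (1 / enn2real q))))"

definition Lp_space :: "ennreal \<Rightarrow> (real^'n) set \<Rightarrow> (real^'n \<Rightarrow> 'b::real_normed_vector) set" where
  "Lp_space q S = {g \<in> borel_measurable (lebesgue_on S). eLp_norm q S g < \<infinity>}"


section \<open>Weak derivatives and Sobolev spaces\<close>

definition partial_deriv :: "'n \<Rightarrow> (real^'n \<Rightarrow> real) \<Rightarrow> (real^'n \<Rightarrow> real)" where
  "partial_deriv i \<psi> = (\<lambda>x. frechet_derivative \<psi> (at x) (axis i 1))"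

definition partial_derivs :: "'n list \<Rightarrow> (real^'n \<Rightarrow> real) \<Rightarrow> (real^'n \<Rightarrow> real)" where
  "partial_derivs is \<psi> = foldr partial_deriv is \<psi>"

definition smooth :: "(real^'n \<Rightarrow> real) \<Rightarrow> bool" where
  "smooth \<psi> \<longleftrightarrow> (\<forall>is. partial_derivs is \<psi> differentiable_on UNIV)"

text \<open>The notions below are meant for open sets, but the cells of a tree may contain a part of
  their cutting hyperplanes; hence \<open>interior S\<close>, which is \<open>S\<close> itself if \<open>S\<close> is open.\<close>

definition test_function :: "(real^'n) set \<Rightarrow> (real^'n \<Rightarrow> real) \<Rightarrow> bool" where
  "test_function S \<psi> \<longleftrightarrow>
     smooth \<psi> \<and> (\<exists>K. compact K \<and> K \<subseteq> interior S \<and> (\<forall>x. x \<notin> K \<longrightarrow> \<psi> x = 0))"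

definition locally_integrable :: "(real^'n) set \<Rightarrow> (real^'n \<Rightarrow> 'b::euclidean_space) \<Rightarrow> bool" where
  "locally_integrable S f \<longleftrightarrow>
     (\<forall>K. compact K \<and> K \<subseteq> interior S \<longrightarrow> f absolutely_integrable_on K)"

definition mi_order :: "('n::finite \<Rightarrow> nat) \<Rightarrow> nat" where
  "mi_order \<gamma> = (\<Sum>i\<in>UNIV. \<gamma> i)"

text \<open>The classical derivative with multi-index \<open>\<gamma>\<close> of a test function is \<open>partial_derivs is \<psi>\<close>
  for any list \<open>is\<close> in which every direction \<open>i\<close> occurs \<open>\<gamma> i\<close> times; the order of
  differentiation is immaterial since \<open>\<psi>\<close> is smooth.\<close>

definition has_weak_deriv ::
    "(real^'n) set \<Rightarrow> ('n::finite \<Rightarrow> nat) \<Rightarrow> (real^'n \<Rightarrow> 'b::euclidean_space) \<Rightarrow> (real^'n \<Rightarrow> 'b) \<Rightarrow> bool" where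
  "has_weak_deriv S \<gamma> f g \<longleftrightarrow>
     locally_integrable S f \<and> locally_integrable S g \<and>
     (\<forall>\<psi> is. test_function S \<psi> \<and> (\<forall>i. count_list is i = \<gamma> i) \<longrightarrow>
        (LINT x:S|lebesgue. partial_derivs is \<psi> x *\<^sub>R f x) =
        (-1) ^ mi_order \<gamma> *\<^sub>R (LINT x:S|lebesgue. \<psi> x *\<^sub>R g x))"

text \<open>A weak derivative is determined only almost everywhere, which suffices for its norms.\<close>

definition weak_deriv ::
    "(real^'n) set \<Rightarrow> ('n::finite \<Rightarrow> nat) \<Rightarrow> (real^'n \<Rightarrow> 'b::euclidean_space) \<Rightarrow> (real^'n \<Rightarrow> 'b)" where
  "weak_deriv S \<gamma> f = (SOME g. has_weak_deriv S \<gamma> f g)"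

definition sobolev_space :: "nat \<Rightarrow> real \<Rightarrow> (real^'n::finite) set \<Rightarrow> (real^'n \<Rightarrow> 'b::euclidean_space) set" where
  "sobolev_space k p S =
     {f. \<forall>\<gamma>. mi_order \<gamma> \<le> k \<longrightarrow> (\<exists>g. has_weak_deriv S \<gamma> f g \<and> g \<in> Lp_space (ennreal p) S)}"

text \<open>Only used for elements of \<open>sobolev_space k p S\<close>, where all the norms are finite.\<close>

definition sobolev_seminorm :: "nat \<Rightarrow> real \<Rightarrow> (real^'n::finite) set \<Rightarrow> (real^'n \<Rightarrow> 'b::euclidean_space) \<Rightarrow> real" where
  "sobolev_seminorm k p S f =
     (\<Sum>\<gamma> | mi_order \<gamma> = k. enn2real (eLp_norm (ennreal p) S (weak_deriv S \<gamma> f)) powr p) powr (1 / p)"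

text \<open>Point evaluations refer to the continuous representative of a Sobolev function.\<close>

definition cont_sobolev_space :: "nat \<Rightarrow> real \<Rightarrow> (real^'n::finite) set \<Rightarrow> (real^'n \<Rightarrow> 'b::euclidean_space) set" where
  "cont_sobolev_space k p S = {f \<in> sobolev_space k p S. continuous_on S f}"


section \<open>Fill distance\<close>

text \<open>Extended-real-valued, so that it is \<open>\<infinity>\<close> (and not a junk value) for unbounded \<open>S\<close> or empty \<open>X\<close>.\<close>

definition fill_distance :: "(real^'n) set \<Rightarrow> (real^'n) set \<Rightarrow> ereal" where
  "fill_distance X S = (SUP x\<in>S. INF y\<in>X. ereal (dist x y))"


section \<open>Least squares, QR decomposition, singular values\<close>

definition vec_norm2 :: "'b::real_normed_vector vec \<Rightarrow> real" where
  "vec_norm2 v = L2_set (\<lambda>i. norm (v $ i)) {..<dim_vec v}"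

definition eval_vec :: "('a \<Rightarrow> 'b) \<Rightarrow> 'a list \<Rightarrow> 'b vec" where
  "eval_vec f xs = vec_of_list (map f xs)"

definition basis_mat :: "nat \<Rightarrow> (nat \<Rightarrow> 'a \<Rightarrow> 'b) \<Rightarrow> 'a list \<Rightarrow> 'b mat" where
  "basis_mat n \<phi> xs = mat (length xs) n (\<lambda>(r, j). \<phi> j (xs ! r))"

definition is_least_squares :: "'b::real_or_complex mat \<Rightarrow> 'b vec \<Rightarrow> 'b vec \<Rightarrow> bool" where
  "is_least_squares A b a \<longleftrightarrow>
     a \<in> carrier_vec (dim_col A) \<and>
     (\<forall>c \<in> carrier_vec (dim_col A). vec_norm2 (A *\<^sub>v a - b) \<le> vec_norm2 (A *\<^sub>v c - b))"

definition is_QR :: "'b::real_or_complex mat \<Rightarrow> 'b mat \<Rightarrow> 'b mat \<Rightarrow> bool" where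
  "is_QR A Q R \<longleftrightarrow>
     Q \<in> carrier_mat (dim_row A) (dim_col A) \<and> mat_adjoint Q * Q = 1\<^sub>m (dim_col A) \<and>
     R \<in> carrier_mat (dim_col A) (dim_col A) \<and> upper_triangular R \<and> invertible_mat R \<and>
     A = Q * R"

definition singular_values :: "'b::real_or_complex mat \<Rightarrow> real set" where
  "singular_values A = {\<sigma>. 0 \<le> \<sigma> \<and> eigenvalue (mat_adjoint A * A) (of_real (\<sigma>\<^sup>2))}"

definition min_singular_value :: "'b::real_or_complex mat \<Rightarrow> real" where
  "min_singular_value A = Min (singular_values A)"


section \<open>Sparse residual trees along a path\<close>

text \<open>One of the two parts of \<open>S\<close> cut by a hyperplane; points on the hyperplane may be assigned to
  either part, or to none. The opposite side is obtained by changing the signs of \<open>a\<close> and \<open>b\<close>.\<close>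

definition hyperplane_cut :: "(real^'n::finite) set \<Rightarrow> (real^'n) set \<Rightarrow> bool" where
  "hyperplane_cut S T \<longleftrightarrow>
     (\<exists>a b. a \<noteq> 0 \<and> (T = S \<inter> {x. inner a x < b} \<or> T = S \<inter> {x. inner a x \<le> b}))"

definition level_points :: "(nat \<Rightarrow> 'a set) \<Rightarrow> 'a list \<Rightarrow> nat \<Rightarrow> 'a list" where
  "level_points D xs i = filter (\<lambda>x. x \<in> D i) xs"

text \<open>\<open>D 0, \<dots>, D (L - 1)\<close> are the domains from the root to the leaf and \<open>xs\<close> enumerates the data
  points. The leaf and the other nodes carry interior points, i.e. no node is degenerate.\<close>

definition srt_path :: "(real^'n::finite) set \<Rightarrow> (real^'n) list \<Rightarrow> nat \<Rightarrow> (nat \<Rightarrow> (real^'n) set) \<Rightarrow> bool" where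
  "srt_path \<Omega> xs L D \<longleftrightarrow>
     distinct xs \<and> set xs \<subseteq> \<Omega> \<and> 1 \<le> L \<and> D 0 = \<Omega> \<and>
     (\<forall>i<L. interior (D i) \<noteq> {}) \<and>
     (\<forall>i. Suc i < L \<longrightarrow> hyperplane_cut (D i) (D (Suc i)) \<and>
        length (level_points D xs (Suc i)) < length (level_points D xs i))"

text \<open>\<open>N i\<close> is the number of basis functions of level \<open>i\<close>, \<open>\<phi> i j\<close> with \<open>j < N i\<close> are the basis
  functions and \<open>\<alpha> i\<close> is the coefficient vector of level \<open>i\<close>.\<close>

definition srt_approx ::
    "(nat \<Rightarrow> nat) \<Rightarrow> (nat \<Rightarrow> nat \<Rightarrow> 'a \<Rightarrow> 'b) \<Rightarrow> (nat \<Rightarrow> 'b::comm_ring_1 vec) \<Rightarrow> nat \<Rightarrow> 'a \<Rightarrow> 'b" where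
  "srt_approx N \<phi> \<alpha> i = (\<lambda>x. \<Sum>j<N i. \<alpha> i $ j * \<phi> i j x)"

primrec srt_residual ::
    "('a \<Rightarrow> 'b) \<Rightarrow> (nat \<Rightarrow> nat) \<Rightarrow> (nat \<Rightarrow> nat \<Rightarrow> 'a \<Rightarrow> 'b) \<Rightarrow> (nat \<Rightarrow> 'b::comm_ring_1 vec) \<Rightarrow> nat \<Rightarrow> 'a \<Rightarrow> 'b" where
  "srt_residual f N \<phi> \<alpha> 0 = f"
| "srt_residual f N \<phi> \<alpha> (Suc i) = (\<lambda>x. srt_residual f N \<phi> \<alpha> i x - srt_approx N \<phi> \<alpha> i x)"

definition srt_prediction ::
    "nat \<Rightarrow> (nat \<Rightarrow> nat) \<Rightarrow> (nat \<Rightarrow> nat \<Rightarrow> 'a \<Rightarrow> 'b) \<Rightarrow> (nat \<Rightarrow> 'b::comm_ring_1 vec) \<Rightarrow> 'a \<Rightarrow> 'b" where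
  "srt_prediction L N \<phi> \<alpha> = (\<lambda>x. \<Sum>i<L. srt_approx N \<phi> \<alpha> i x)"

definition srt_fit ::
    "(real^'n::finite) list \<Rightarrow> nat \<Rightarrow> (nat \<Rightarrow> (real^'n) set) \<Rightarrow> (nat \<Rightarrow> nat) \<Rightarrow>
     (nat \<Rightarrow> nat \<Rightarrow> real^'n \<Rightarrow> 'b::real_or_complex) \<Rightarrow> (real^'n \<Rightarrow> 'b) \<Rightarrow>
     (nat \<Rightarrow> 'b vec) \<Rightarrow> (nat \<Rightarrow> 'b mat) \<Rightarrow> (nat \<Rightarrow> 'b mat) \<Rightarrow> bool" where
  "srt_fit xs L D N \<phi> f \<alpha> Q R \<longleftrightarrow>
     (\<forall>i<L. let xi = level_points D xs i; \<Phi> = basis_mat (N i) (\<phi> i) xi in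
        is_QR \<Phi> (Q i) (R i) \<and>
        is_least_squares \<Phi> (eval_vec (srt_residual f N \<phi> \<alpha> i) xi) (\<alpha> i))"

definition srt_tau :: "nat \<Rightarrow> (nat \<Rightarrow> 'b::real_or_complex mat) \<Rightarrow> real" where
  "srt_tau L R = Min ((\<lambda>i. min_singular_value (R i)) ` {..<L})"

definition srt_basis ::
    "nat \<Rightarrow> real \<Rightarrow> (real^'n::finite) set \<Rightarrow> nat \<Rightarrow> (nat \<Rightarrow> nat) \<Rightarrow>
     (nat \<Rightarrow> nat \<Rightarrow> real^'n \<Rightarrow> 'b::real_or_complex) \<Rightarrow> bool" where
  "srt_basis k p \<Omega> L N \<phi> \<longleftrightarrow>
     (\<forall>i<L. 1 \<le> N i \<and> (\<forall>j<N i. \<phi> i j \<in> cont_sobolev_space k p \<Omega>))"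

end

theory Submission
  imports Defs
begin

text \<open>Near a point \<open>x\<close> of the leaf, a function of \<open>W_p^k\<close> is compared with its Taylor polynomial of
degree \<open>k - 1\<close> averaged over a ball whose radius and distance from \<open>x\<close> are comparable to \<open>h\<close>.
Within distance \<open>h\<close> of every point of a grid of mesh a large multiple of \<open>h\<close> there is a data
point; these perturbed grids are norming for polynomials, since tensor Vandermonde functionals
recover the coefficients. Taylor's formula is transferred from smooth functions by mollification and
evaluated at Lebesgue points. This bounds the weak derivative of order \<open>\<gamma>\<close> at almost every
\<open>x\<close> by the data values and the \<open>L_p\<close> norm of the derivatives of order \<open>k\<close> on a ball around \<open>x\<close> of
radius comparable to \<open>h\<close>; integrating the bound with Fubini's theorem replaces the usual covering
argument. For the residual tree, comparing each least squares fit with the zero fit shows that the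
residuals do not grow and that \<open>\<parallel>\<alpha>\<parallel> \<le> 2 \<tau>\<^sup>-\<^sup>1 \<parallel>f\<parallel>\<close> on the data, so the prediction is bounded in
the Sobolev seminorm by linearity.\<close>

section \<open>Smooth families of partial derivatives\<close>

text \<open>The data are dense in the root domain, so a data point close to a point of the leaf may
  lie outside the leaf, and near the boundary a ball around x may leave it as well. Hence x is moved
  toward a fixed ball inside the leaf by a step proportional to h; by convexity a ball of radius
  comparable to h around the new center c lies in the leaf, and it holds the averaging ball, the
  grid and all data points close to its nodes. Keeping the averaging ball away from x and from the
  nodes also settles the critical case p = 1, k = |gamma| + d. Mollification has to converge at two
  kinds of points: at almost every x for the derivative of order gamma, and at the single data
  points, a null set, where continuity is used. The exponent (d/p - d/q)_+ comes from two bounds for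
  the local integrals of the derivatives of order k: each is at most the full integral, and their
  integral over x is smaller by a factor of order h^d. The constants \<open>C\<close> and
  \<open>h\<^sub>0\<close> see the tree only through its leaf; the basis functions enter only via
  \<open>C\<^sub>W\<close>.\<close>

definition jet :: "('n::finite list \<Rightarrow> real^'n \<Rightarrow> 'b::real_normed_vector) \<Rightarrow> bool" where
  "jet U \<longleftrightarrow>
     (\<forall>is x. (U is has_derivative (\<lambda>w. \<Sum>i\<in>UNIV. vec_nth w i *\<^sub>R U (i # is) x)) (at x)) \<and>
     (\<forall>is js. mset is = mset js \<longrightarrow> U is = U js)"

lemma jet_has_derivative:
  "jet U \<Longrightarrow> (U is has_derivative (\<lambda>w. \<Sum>i\<in>UNIV. vec_nth w i *\<^sub>R U (i # is) x)) (at x)"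
  unfolding jet_def by blast

text \<open>Independence of the order of differentiation is put into \<open>jet\<close> itself: the
  jets built below, tensor products of bumps and convolutions with them, have it by construction,
  and it yields the permutation invariance of Taylor coefficients.\<close>

lemma jet_mset: "jet U \<Longrightarrow> mset is = mset js \<Longrightarrow> U is = U js"
  unfolding jet_def by blast

lemma jet_continuous: "jet U \<Longrightarrow> continuous_on S (U is)"
  by (meson continuous_at_imp_continuous_on has_derivative_continuous jet_has_derivative)

lemma jet_measurable: "jet U \<Longrightarrow> U is \<in> borel_measurable borel"
  by (intro borel_measurable_continuous_onI jet_continuous)

text \<open>New directions enter at the head of a list, so a fixed tail turns the jet of a function
  into the jet of its derivative \<open>U is\<close>. Taylor's formula for \<open>U is\<close> is
  then an instance of the one for \<open>U []\<close>.\<close>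

lemma jet_append:
  fixes U :: "'n::finite list \<Rightarrow> real^'n \<Rightarrow> 'b::real_normed_vector"
  assumes "jet U" shows "jet (\<lambda>js. U (js @ is))"
  unfolding jet_def
proof (intro conjI allI impI)
  fix js x
  show "(U (js @ is) has_derivative (\<lambda>w. \<Sum>i\<in>UNIV. vec_nth w i *\<^sub>R U ((i # js) @ is) x)) (at x)"
    using jet_has_derivative[OF assms] by simp
next
  fix js js' :: "'n list" assume "mset js = mset js'"
  then have "mset (js @ is) = mset (js' @ is)" by simp
  then show "U (js @ is) = U (js' @ is)" by (rule jet_mset[OF assms])
qed

text \<open>Chain rule: one factor \<open>\<delta>\<close> per direction. The factor
  \<open>a\<close> normalizes mollifiers; with \<open>a = 1\<close> this is the passage to unit
  scale.\<close>

lemma jet_affine: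
  fixes U :: "'n::finite list \<Rightarrow> real^'n \<Rightarrow> 'b::real_normed_vector"
  assumes "jet U"
  shows "jet (\<lambda>is x. (a * \<delta> ^ length is) *\<^sub>R U is (c + \<delta> *\<^sub>R x))"
  unfolding jet_def
proof (intro conjI allI impI)
  fix "is" x
  show "((\<lambda>x. (a * \<delta> ^ length is) *\<^sub>R U is (c + \<delta> *\<^sub>R x)) has_derivative
     (\<lambda>w. \<Sum>i\<in>UNIV. vec_nth w i *\<^sub>R (a * \<delta> ^ length (i # is)) *\<^sub>R U (i # is) (c + \<delta> *\<^sub>R x))) (at x)"
  proof -
    have "((\<lambda>x. c + \<delta> *\<^sub>R x) has_derivative (\<lambda>w. \<delta> *\<^sub>R w)) (at x)"
      by (auto intro!: derivative_eq_intros)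
    from has_derivative_scaleR_right[OF has_derivative_compose[OF this jet_has_derivative[OF assms]]]
    show ?thesis
      by (rule has_derivative_eq_rhs) (auto simp: scaleR_sum_right algebra_simps)
  qed
next
  fix "is" js :: "'n list" assume "mset is = mset js"
  then show "(\<lambda>x. (a * \<delta> ^ length is) *\<^sub>R U is (c + \<delta> *\<^sub>R x)) =
     (\<lambda>x. (a * \<delta> ^ length js) *\<^sub>R U js (c + \<delta> *\<^sub>R x))"
    using jet_mset[OF assms] mset_eq_length by metis
qed

lemma jet_reflect_has_derivative:
  fixes Z :: "'n::finite list \<Rightarrow> real^'n \<Rightarrow> real"
  assumes "jet Z"
  shows "((\<lambda>y. (-1) ^ length is * Z is (x - y)) has_derivative
      (\<lambda>w. (-1) ^ length is * (\<Sum>j\<in>UNIV. vec_nth (- w) j *\<^sub>R Z (j # is) (x - y)))) (at y)"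
proof (rule has_derivative_mult_right)
  have "((\<lambda>y. x - y) has_derivative (\<lambda>w. - w)) (at y)"
    by (auto intro!: derivative_eq_intros)
  from has_derivative_compose[OF this jet_has_derivative[OF assms]]
  show "((\<lambda>y. Z is (x - y)) has_derivative
      (\<lambda>w. (\<Sum>j\<in>UNIV. vec_nth (- w) j *\<^sub>R Z (j # is) (x - y)))) (at y)" .
qed

text \<open>The link to test functions: the convolution kernel, as a function of y, is inserted into
  the definition of weak derivatives, and the reflection costs one sign per direction.\<close>

lemma partial_derivs_jet:
  fixes Z :: "'n::finite list \<Rightarrow> real^'n \<Rightarrow> real"
  assumes "jet Z"
  shows "partial_derivs is (\<lambda>y. Z [] (x - y)) = (\<lambda>y. (-1) ^ length is * Z is (x - y))"
proof (induction "is")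
  case Nil
  then show ?case by (simp add: partial_derivs_def)
next
  case (Cons i "is")
  have "frechet_derivative (\<lambda>y. (-1) ^ length is * Z is (x - y)) (at y) =
      (\<lambda>w. (-1) ^ length is * (\<Sum>j\<in>UNIV. vec_nth (- w) j *\<^sub>R Z (j # is) (x - y)))" for y
    by (rule frechet_derivative_at[symmetric, OF jet_reflect_has_derivative[OF assms]])
  moreover have "(\<Sum>j\<in>UNIV. vec_nth (axis i 1) j * Z (j # is) (x - y)) = Z (i # is) (x - y)" for y
    by (subst sum.cong[OF refl, where h = "\<lambda>j. if j = i then Z (i # is) (x - y) else 0"])
      (auto simp: axis_def)
  moreover have "foldr partial_deriv is (\<lambda>y. Z [] (x - y)) = (\<lambda>y. (-1) ^ length is * Z is (x - y))"
    using Cons.IH by (simp add: partial_derivs_def)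
  ultimately show ?case
    by (simp add: partial_derivs_def partial_deriv_def sum_negf)
qed

lemma smooth_jet:
  fixes Z :: "'n::finite list \<Rightarrow> real^'n \<Rightarrow> real"
  assumes "jet Z"
  shows "smooth (\<lambda>y. Z [] (x - y))"
  unfolding smooth_def partial_derivs_jet[OF assms]
proof (intro allI differentiable_at_imp_differentiable_on)
  fix "is" y
  show "(\<lambda>y. (-1) ^ length is * Z is (x - y)) differentiable at y"
    unfolding differentiable_def using jet_reflect_has_derivative[OF assms] by blast
qed

section \<open>Mollifiers\<close>

text \<open>The derivative is hidden behind an existential quantifier, so closure under products and
  affine substitutions is a plain induction; the explicit sequence of iterated derivatives is
  recovered once, in \<open>deriv_iterate_has_derivative\<close>.\<close>

primrec times_differentiable :: "nat \<Rightarrow> (real \<Rightarrow> real) \<Rightarrow> bool" where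
  "times_differentiable 0 g = True"
| "times_differentiable (Suc n) g =
     (\<exists>g'. (\<forall>t. (g has_real_derivative g' t) (at t)) \<and> times_differentiable n g')"

lemma times_differentiable_Suc_imp: "times_differentiable (Suc n) g \<Longrightarrow> times_differentiable n g"
  by (induction n arbitrary: g) auto

lemma times_differentiable_add:
  "times_differentiable n f \<Longrightarrow> times_differentiable n g \<Longrightarrow> times_differentiable n (\<lambda>t. f t + g t)"
proof (induction n arbitrary: f g)
  case (Suc n)
  then obtain f' g' where
    "\<forall>t. (f has_real_derivative f' t) (at t)" "times_differentiable n f'"
    "\<forall>t. (g has_real_derivative g' t) (at t)" "times_differentiable n g'" by auto
  then show ?case
    using Suc.IH by (auto intro!: exI[of _ "\<lambda>t. f' t + g' t"] derivative_eq_intros)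
qed simp

lemma times_differentiable_mult:
  "times_differentiable n f \<Longrightarrow> times_differentiable n g \<Longrightarrow> times_differentiable n (\<lambda>t. f t * g t)"
proof (induction n arbitrary: f g)
  case (Suc n)
  then obtain f' g' where *:
    "\<forall>t. (f has_real_derivative f' t) (at t)" "times_differentiable n f'"
    "\<forall>t. (g has_real_derivative g' t) (at t)" "times_differentiable n g'" by auto
  have "times_differentiable n f" "times_differentiable n g"
    using Suc.prems times_differentiable_Suc_imp by auto
  then have "times_differentiable n (\<lambda>t. f' t * g t + f t * g' t)"
    using * Suc.IH by (intro times_differentiable_add) auto
  then show ?case
    using * by (auto intro!: exI[of _ "\<lambda>t. f' t * g t + f t * g' t"] derivative_eq_intros)
qed simp

lemma times_differentiable_const: "times_differentiable n (\<lambda>t. c)"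
  by (induction n arbitrary: c) (auto intro!: derivative_eq_intros)

lemma times_differentiable_affine:
  "times_differentiable n g \<Longrightarrow> times_differentiable n (\<lambda>t. g (a + c * t))"
proof (induction n arbitrary: g)
  case (Suc n)
  then obtain g' where *: "\<forall>t. (g has_real_derivative g' t) (at t)" "times_differentiable n g'" by auto
  then have "((\<lambda>t. g (a + c * t)) has_real_derivative g' (a + c * t) * c) (at t)" for t
    by (auto intro!: derivative_eq_intros DERIV_chain2[where f = g])
  moreover have "times_differentiable n (\<lambda>t. g' (a + c * t) * c)"
    using Suc.IH[OF *(2)] by (intro times_differentiable_mult times_differentiable_const)
  ultimately show ?case
    unfolding times_differentiable.simps by (intro exI[of _ "\<lambda>t. g' (a + c * t) * c"]) auto
qed simp

lemma deriv_iterate_has_derivative: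
  assumes "\<And>n. times_differentiable n g"
  shows "((deriv ^^ j) g has_real_derivative (deriv ^^ Suc j) g t) (at t)"
proof -
  have step: "times_differentiable n (deriv g)" if "times_differentiable (Suc n) g" for n g
  proof -
    from that obtain g' where *: "\<forall>t. (g has_real_derivative g' t) (at t)" "times_differentiable n g'"
      by auto
    then have "deriv g = g'" by (auto simp: DERIV_imp_deriv)
    with * show ?thesis by simp
  qed
  have "times_differentiable n ((deriv ^^ j) g)" for n
    by (induction j arbitrary: n) (auto intro: step assms)
  from this[of "Suc 0"] obtain g' where "\<forall>t. ((deriv ^^ j) g has_real_derivative g' t) (at t)"
    by auto
  moreover from this have "deriv ((deriv ^^ j) g) = g'" by (auto simp: DERIV_imp_deriv)
  ultimately show ?thesis by simp
qed

text \<open>The flat function exp(-1/t), extended by zero. The polynomial in 1/t makes the family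
  closed under differentiation, with P replaced by X^2 (P - P').\<close>

definition exp_inverse :: "real poly \<Rightarrow> real \<Rightarrow> real" where
  "exp_inverse P t = (if t \<le> 0 then 0 else poly P (1 / t) * exp (- (1 / t)))"

lemma poly_times_exp_minus_tendsto_0:
  "((\<lambda>x::real. poly P x * exp (- x)) \<longlongrightarrow> 0) at_top"
proof -
  have "((\<lambda>x::real. \<Sum>i\<le>degree P. coeff P i * (x ^ i / exp x)) \<longlongrightarrow> (\<Sum>i\<le>degree P. coeff P i * 0)) at_top"
    by (intro tendsto_intros tendsto_power_div_exp_0)
  then show ?thesis
    by (simp add: poly_altdef sum_divide_distrib exp_minus divide_inverse[symmetric])
qed

lemma exp_inverse_has_derivative:
  "(exp_inverse P has_real_derivative exp_inverse ([:0, 0, 1:] * (P - pderiv P)) t) (at t)"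
proof -
  consider "t < 0" | "t > 0" | "t = 0" by linarith
  then show ?thesis
  proof cases
    case 1
    have "(exp_inverse P has_real_derivative 0) (at t)"
      by (rule has_field_derivative_transform_within_open[of "\<lambda>_. 0" _ _ "{..<0}"])
        (use 1 in \<open>auto simp: exp_inverse_def\<close>)
    with 1 show ?thesis by (simp add: exp_inverse_def)
  next
    case 2
    have "((\<lambda>t. poly P (1 / t) * exp (- (1 / t))) has_real_derivative
        exp_inverse ([:0, 0, 1:] * (P - pderiv P)) t) (at t)"
      using 2 by (auto intro!: derivative_eq_intros DERIV_chain2[OF poly_DERIV]
          simp: exp_inverse_def field_simps power2_eq_square)
    then show ?thesis
      by (rule has_field_derivative_transform_within_open[of _ _ _ "{0<..}"])
        (use 2 in \<open>auto simp: exp_inverse_def\<close>)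
  next
    case 3
    \<comment> \<open>At zero the difference quotient has a further factor 1/h, which is absorbed
      into the polynomial; in the variable 1/h the exponential decay wins.\<close>
    have "((\<lambda>h. exp_inverse P h / h) \<longlongrightarrow> 0) (at_right 0)"
    proof -
      have "((\<lambda>h::real. poly ([:0, 1:] * P) (inverse h) * exp (- inverse h)) \<longlongrightarrow> 0) (at_right 0)"
        by (rule filterlim_compose[OF poly_times_exp_minus_tendsto_0 filterlim_inverse_at_top_right])
      then show ?thesis
        by (rule Lim_transform_eventually)
          (auto simp: eventually_at_right_field exp_inverse_def field_simps intro!: exI[of _ 1])
    qed
    moreover have "((\<lambda>h. exp_inverse P h / h) \<longlongrightarrow> 0) (at_left 0)"
      by (rule Lim_transform_eventually[OF tendsto_const])
        (auto simp: eventually_at_left_field exp_inverse_def intro!: exI[of _ "-1"])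
    ultimately have "((\<lambda>h. exp_inverse P h / h) \<longlongrightarrow> 0) (at 0)"
      by (simp add: filterlim_split_at)
    then show ?thesis using 3 by (simp add: DERIV_def exp_inverse_def)
  qed
qed

lemma times_differentiable_exp_inverse: "times_differentiable n (exp_inverse P)"
  by (induction n arbitrary: P) (use exp_inverse_has_derivative in auto)

text \<open>The support [-1, 0] is one-sided on purpose: in the kernel \<open>Z [] (x - y)\<close>
  the variable y then runs over cubes with lower corner x, the cubes of
  \<open>lebesgue_point\<close>.\<close>

lemma bump_exists:
  "\<exists>b :: nat \<Rightarrow> real \<Rightarrow> real. (\<forall>j t. (b j has_real_derivative b (Suc j) t) (at t)) \<and>
     (\<forall>j t. t \<notin> {-1..0} \<longrightarrow> b j t = 0) \<and> (\<forall>t. 0 \<le> b 0 t) \<and> (\<forall>t\<in>{-1<..<0}. 0 < b 0 t)"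
proof -
  define g where "g = (\<lambda>t. exp_inverse 1 (0 + (-1) * t) * exp_inverse 1 (1 + 1 * t))"
  have "times_differentiable n g" for n
    unfolding g_def
    by (intro times_differentiable_mult times_differentiable_affine times_differentiable_exp_inverse)
  then have D: "((deriv ^^ j) g has_real_derivative (deriv ^^ Suc j) g t) (at t)" for j t
    by (rule deriv_iterate_has_derivative)
  have "(deriv ^^ j) g t = 0" if "t \<notin> {-1..0}" for j t
    using that
  proof (induction j arbitrary: t)
    case (Suc j)
    have "((deriv ^^ j) g has_real_derivative 0) (at t)"
      by (rule has_field_derivative_transform_within_open[of "\<lambda>_. 0" _ _ "- {-1..0}"])
        (use Suc in auto)
    then show ?case using D[of j t] DERIV_unique by blast
  qed (auto simp: g_def exp_inverse_def)
  then show ?thesis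
    using D by (intro exI[of _ "\<lambda>j. (deriv ^^ j) g"]) (auto simp: g_def exp_inverse_def)
qed

lemma nn_integral_lborel_affine:
  fixes f :: "'a::euclidean_space \<Rightarrow> ennreal"
  assumes [measurable]: "f \<in> borel_measurable borel" and "c \<noteq> 0"
  shows "(\<integral>\<^sup>+x. f x \<partial>lborel) = ennreal (\<bar>c\<bar> ^ DIM('a)) * (\<integral>\<^sup>+x. f (t + c *\<^sub>R x) \<partial>lborel)"
  by (subst lborel_affine[OF \<open>c \<noteq> 0\<close>, of t])
    (simp add: nn_integral_density nn_integral_distr nn_integral_cmult)

lemma nn_integral_pos:
  fixes f :: "'a::euclidean_space \<Rightarrow> real"
  assumes [measurable]: "f \<in> borel_measurable borel" and "open S" "S \<noteq> {}" and pos: "\<And>x. x \<in> S \<Longrightarrow> 0 < f x"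
  shows "0 < (\<integral>\<^sup>+x. ennreal (f x) \<partial>lborel)"
proof (rule ccontr)
  assume "\<not> ?thesis"
  then have "AE x in lborel. ennreal (f x) = 0"
    by (simp add: nn_integral_0_iff_AE)
  then have "AE x in lborel. x \<notin> S"
    by eventually_elim (use pos in force)
  then have "AE x in lborel. x \<in> - S" by simp
  then have "S \<in> null_sets lborel"
    using \<open>open S\<close> by (subst AE_iff_null_sets) auto
  then show False
    using open_not_negligible[OF \<open>open S\<close> \<open>S \<noteq> {}\<close>]
    by (simp add: negligible_iff_null_sets null_sets_completionI)
qed

text \<open>The upper bound for \<open>Z []\<close>, used with one \<open>C\<close> for all
  \<epsilon>, compares the kernel with the uniform average over a cube of side \<epsilon>. This
  gives convergence at Lebesgue points and not only at points of continuity.\<close>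

definition mollifier :: "real \<Rightarrow> real \<Rightarrow> ('n::finite list \<Rightarrow> real^'n \<Rightarrow> real) \<Rightarrow> bool" where
  "mollifier C \<epsilon> Z \<longleftrightarrow> jet Z \<and> (\<forall>is z. z \<notin> cbox (- (\<epsilon> *\<^sub>R One)) 0 \<longrightarrow> Z is z = 0) \<and>
     (\<forall>z. 0 \<le> Z [] z \<and> Z [] z \<le> C / \<epsilon> ^ CARD('n)) \<and> (\<integral>\<^sup>+z. ennreal (Z [] z) \<partial>lborel) = 1"

lemma One_vec_nth [simp]: "(\<Sum>b\<in>Basis. vec_nth (b :: real^'n) i) = 1"
proof -
  have "(\<Sum>b\<in>Basis. vec_nth (b :: real^'n) i) = inner One (axis i 1 :: real^'n)"
    by (simp add: cart_eq_inner_axis inner_sum_left)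
  also have "\<dots> = (\<Sum>b\<in>(Basis :: (real^'n) set). if b = axis i 1 then 1 else 0)"
    unfolding inner_sum_left by (intro sum.cong) (auto simp: inner_Basis)
  finally show ?thesis by simp
qed

lemma continuous_compact_support_bounded:
  fixes f :: "'a::euclidean_space \<Rightarrow> 'b::real_normed_vector"
  assumes "continuous_on UNIV f" and "compact K" and "\<And>z. z \<notin> K \<Longrightarrow> f z = 0"
  shows "bounded (range f)"
proof -
  have "bounded (f ` K)"
    using assms(2) continuous_on_subset[OF assms(1)]
    by (intro compact_imp_bounded compact_continuous_image) auto
  moreover have "range f \<subseteq> insert 0 (f ` K)" using assms(3) by auto
  ultimately show ?thesis by (meson bounded_insert bounded_subset)
qed

lemma unit_mollifier_exists:
  "\<exists>C\<ge>0. \<exists>Z :: 'n::finite list \<Rightarrow> real^'n \<Rightarrow> real. mollifier C 1 Z"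
proof -
  obtain b :: "nat \<Rightarrow> real \<Rightarrow> real" where
    b: "\<And>j t. (b j has_real_derivative b (Suc j) t) (at t)" "\<And>j t. t \<notin> {-1..0} \<Longrightarrow> b j t = 0"
      "\<And>t. 0 \<le> b 0 t" "\<And>t. t \<in> {-1<..<0} \<Longrightarrow> 0 < b 0 t"
    using bump_exists by blast
  \<comment> \<open>A derivative of a tensor product depends only on how often each direction
    occurs, so the symmetry of the jet is immediate.\<close>
  define T where "T is x = (\<Prod>i\<in>UNIV. b (count_list is i) (vec_nth x i))"
    for "is" :: "'n list" and x :: "real^'n"
  have "jet T"
    unfolding jet_def
  proof (intro conjI allI impI)
    fix "is" :: "'n list" and x :: "real^'n"
    have D: "((\<lambda>x. b (count_list is i) (vec_nth x i)) has_derivative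
        (\<lambda>w. b (Suc (count_list is i)) (vec_nth x i) * vec_nth w i)) (at x)" for i
      by (rule has_derivative_compose[OF _ b(1)[unfolded has_field_derivative_def], of "\<lambda>x. vec_nth x i"])
        (rule bounded_linear_imp_has_derivative[OF bounded_linear_vec_nth])
    have "(\<Prod>j\<in>UNIV. b (count_list (i # is) j) (vec_nth x j)) =
        b (Suc (count_list is i)) (vec_nth x i) * (\<Prod>j\<in>UNIV - {i}. b (count_list is j) (vec_nth x j))" for i
      by (subst prod.remove[of _ i]) (auto intro!: prod.cong)
    then show "(T is has_derivative (\<lambda>w. \<Sum>i\<in>UNIV. vec_nth w i *\<^sub>R T (i # is) x)) (at x)"
      unfolding T_def
      by (intro has_derivative_eq_rhs[OF has_derivative_prod[OF D]]) (simp add: fun_eq_iff algebra_simps)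
  next
    fix "is" js :: "'n list" assume "mset is = mset js"
    then have "count_list is = count_list js" by (metis count_mset ext)
    then show "T is = T js" by (simp add: T_def fun_eq_iff)
  qed
  have T0: "T is z = 0" if "z \<notin> cbox (- One) 0" for "is" z
  proof -
    from that obtain i where "vec_nth z i \<notin> {-1..0}"
      by (auto simp: mem_box_cart)
    then show ?thesis unfolding T_def by (intro prod_zero bexI[of _ i]) (auto simp: b(2))
  qed
  have nonneg: "0 \<le> T [] z" for z
    unfolding T_def by (intro prod_nonneg) (auto simp: b(3))
  obtain M where M: "\<And>z. norm (T [] z) \<le> M"
    using continuous_compact_support_bounded[OF jet_continuous[OF \<open>jet T\<close>], of "cbox (- One) 0" "[]"] T0
    by (auto simp: bounded_iff)
  \<comment> \<open>The mass is positive because \<open>T []\<close> is positive on the open cube,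
    and finite because \<open>T []\<close> is bounded with compact support.\<close>
  define I where "I = (\<integral>\<^sup>+z. ennreal (T [] z) \<partial>lborel)"
  have "I > 0"
    unfolding I_def
  proof (rule nn_integral_pos[where S = "box (- One) 0"])
    show "box (- One) 0 \<noteq> ({} :: (real^'n) set)" by (simp add: box_ne_empty)
    show "0 < T [] x" if "x \<in> box (- One) 0" for x
      using that unfolding T_def by (intro prod_pos) (auto simp: mem_box_cart intro!: b(4))
  qed (auto intro: jet_measurable \<open>jet T\<close>)
  have "I \<le> (\<integral>\<^sup>+z. ennreal M * indicator (cbox (- One) (0 :: real^'n)) z \<partial>lborel)"
    unfolding I_def
  proof (rule nn_integral_mono)
    fix z
    have "T [] z \<le> M" using M[of z] by simp
    then show "ennreal (T [] z) \<le> ennreal M * indicator (cbox (- One) 0) z"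
      using T0[of z "[]"] by (cases "z \<in> cbox (- One) 0") (auto intro: ennreal_leI)
  qed
  also have "\<dots> < \<infinity>"
    by (simp add: nn_integral_cmult_indicator ennreal_mult_less_top emeasure_lborel_cbox_finite)
  finally have "I < \<infinity>" .
  with \<open>I > 0\<close> obtain J where J: "I = ennreal J" "J > 0" by (cases I) auto
  have "jet (\<lambda>is x. inverse J *\<^sub>R T is x)"
    using jet_affine[OF \<open>jet T\<close>, of "inverse J" 1 0] by simp
  moreover have "(\<integral>\<^sup>+z. ennreal (inverse J * T [] z) \<partial>lborel) = 1"
  proof -
    have "(\<integral>\<^sup>+z. ennreal (inverse J * T [] z) \<partial>lborel) = ennreal (inverse J) * I"
      unfolding I_def using J nonneg jet_measurable[OF \<open>jet T\<close>]
      by (subst nn_integral_cmult[symmetric]) (auto simp: ennreal_mult)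
    then show ?thesis using J by (simp add: ennreal_mult[symmetric])
  qed
  moreover have "inverse J * T [] z \<le> inverse J * M" for z
    using M[of z] J by (intro mult_left_mono) auto
  moreover have "0 \<le> M" using M[of 0] norm_ge_zero order_trans by blast
  ultimately show ?thesis
    using J nonneg T0 by (intro exI[of _ "inverse J * M"] conjI exI[of _ "\<lambda>is x. inverse J *\<^sub>R T is x"])
      (auto simp: mollifier_def)
qed

lemma mollifier_exists:
  "\<exists>C\<ge>0. \<forall>\<epsilon>>0. \<exists>Z :: 'n::finite list \<Rightarrow> real^'n \<Rightarrow> real. mollifier C \<epsilon> Z"
proof -
  obtain C and T :: "'n list \<Rightarrow> real^'n \<Rightarrow> real" where "C \<ge> 0" and T: "mollifier C 1 T"
    using unit_mollifier_exists by blast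
  \<comment> \<open>The factor \<open>inverse \<epsilon> ^ length is\<close> is the chain rule;
    \<open>inverse (\<epsilon> ^ CARD('n))\<close> restores total mass one.\<close>
  have "mollifier C \<epsilon> (\<lambda>is x. (inverse (\<epsilon> ^ CARD('n)) * inverse \<epsilon> ^ length is) *\<^sub>R T is (0 + inverse \<epsilon> *\<^sub>R x))"
    if "\<epsilon> > 0" for \<epsilon>
    unfolding mollifier_def
  proof (intro conjI allI impI)
    show "jet (\<lambda>is x. (inverse (\<epsilon> ^ CARD('n)) * inverse \<epsilon> ^ length is) *\<^sub>R T is (0 + inverse \<epsilon> *\<^sub>R x))"
      using T by (intro jet_affine) (simp add: mollifier_def)
  next
    fix "is" and z :: "real^'n" assume "z \<notin> cbox (- (\<epsilon> *\<^sub>R One)) 0"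
    then have "inverse \<epsilon> *\<^sub>R z \<notin> cbox (- (1 *\<^sub>R One)) 0"
      using \<open>\<epsilon> > 0\<close> by (auto simp: mem_box_cart field_simps)
    then show "(inverse (\<epsilon> ^ CARD('n)) * inverse \<epsilon> ^ length is) *\<^sub>R T is (0 + inverse \<epsilon> *\<^sub>R z) = 0"
      using T by (simp add: mollifier_def)
  next
    fix z
    show "0 \<le> (inverse (\<epsilon> ^ CARD('n)) * inverse \<epsilon> ^ length []) *\<^sub>R T [] (0 + inverse \<epsilon> *\<^sub>R z)"
      "(inverse (\<epsilon> ^ CARD('n)) * inverse \<epsilon> ^ length []) *\<^sub>R T [] (0 + inverse \<epsilon> *\<^sub>R z) \<le> C / \<epsilon> ^ CARD('n)"
      using T \<open>\<epsilon> > 0\<close> by (auto simp: mollifier_def field_simps)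
  next
    have [measurable]: "T [] \<in> borel_measurable borel" using T by (simp add: mollifier_def jet_measurable)
    have T0: "0 \<le> T [] z" for z using T by (simp add: mollifier_def)
    have "1 = ennreal (inverse \<epsilon> ^ CARD('n)) * (\<integral>\<^sup>+z. ennreal (T [] (0 + inverse \<epsilon> *\<^sub>R z)) \<partial>lborel)"
      using T \<open>\<epsilon> > 0\<close> nn_integral_lborel_affine[of "\<lambda>z. ennreal (T [] z)" "inverse \<epsilon>" 0]
      by (simp add: mollifier_def)
    then show "(\<integral>\<^sup>+z. ennreal ((inverse (\<epsilon> ^ CARD('n)) * inverse \<epsilon> ^ length []) *\<^sub>R T [] (0 + inverse \<epsilon> *\<^sub>R z)) \<partial>lborel) = 1"
      using \<open>\<epsilon> > 0\<close> T0 by (subst (asm) nn_integral_cmult[symmetric])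
        (auto simp: ennreal_mult[symmetric] power_inverse)
  qed
  with \<open>C \<ge> 0\<close> show ?thesis by blast
qed

text \<open>The remainder of the first-order expansion of the kernel is quadratic, uniformly in the
  integration variable, so no differentiation theorem under the integral sign is needed.\<close>

lemma jet_convolution:
  fixes Z :: "'n::finite list \<Rightarrow> real^'n \<Rightarrow> real" and v :: "real^'n \<Rightarrow> 'b::euclidean_space"
  assumes Z: "jet Z" "\<And>is. bounded (range (Z is))" and v: "integrable lebesgue v"
  shows "jet (\<lambda>is x. LINT y|lebesgue. Z is (x - y) *\<^sub>R v y)"
proof -
  have "\<forall>is. \<exists>B. \<forall>z. \<bar>Z is z\<bar> \<le> B" using Z(2) by (auto simp: bounded_iff)
  then obtain B where B: "\<And>is z. \<bar>Z is z\<bar> \<le> B is" by metis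
  have [measurable]: "Z is \<in> borel_measurable borel" for "is" by (rule jet_measurable[OF Z(1)])
  have meas: "(\<lambda>y. Z is (x - y)) \<in> borel_measurable lebesgue" for "is" x
    by (rule measurable_completion) simp
  have int: "integrable lebesgue (\<lambda>y. Z is (x - y) *\<^sub>R v y)" for "is" x
  proof (rule Bochner_Integration.integrable_bound)
    show "integrable lebesgue (\<lambda>y. B is *\<^sub>R v y)" using v by simp
    show "(\<lambda>y. Z is (x - y) *\<^sub>R v y) \<in> borel_measurable lebesgue"
      using meas v by (intro borel_measurable_scaleR) auto
    show "AE y in lebesgue. norm (Z is (x - y) *\<^sub>R v y) \<le> norm (B is *\<^sub>R v y)"
    proof (intro AE_I2)
      fix y
      have "\<bar>Z is (x - y)\<bar> \<le> \<bar>B is\<bar>" using B[of "is" "x - y"] by linarith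
      then show "norm (Z is (x - y) *\<^sub>R v y) \<le> norm (B is *\<^sub>R v y)"
        by (simp add: mult_right_mono)
    qed
  qed
  have onorm_le: "onorm (\<lambda>w::real^'n. \<Sum>i\<in>UNIV. vec_nth w i *\<^sub>R (a i::real)) \<le> (\<Sum>i\<in>UNIV. \<bar>a i\<bar>)" for a
  proof (rule onorm_le)
    fix w :: "real^'n"
    have "norm (\<Sum>i\<in>UNIV. vec_nth w i *\<^sub>R a i) \<le> (\<Sum>i\<in>UNIV. norm w * \<bar>a i\<bar>)"
      by (rule sum_norm_le) (auto simp: abs_mult intro!: mult_right_mono component_le_norm_cart)
    then show "norm (\<Sum>i\<in>UNIV. vec_nth w i *\<^sub>R a i) \<le> (\<Sum>i\<in>UNIV. \<bar>a i\<bar>) * norm w"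
      by (simp add: sum_distrib_left mult.commute)
  qed
  \<comment> \<open>\<open>L is\<close> bounds the gradient of \<open>Z is\<close> and is therefore
    a Lipschitz constant; \<open>Q is\<close> below plays this role for the second
    derivatives.\<close>
  define L where "L is = (\<Sum>i\<in>UNIV. B (i # is))" for "is"
  have lip: "\<bar>Z is a - Z is b\<bar> \<le> L is * norm (a - b)" for "is" a b
  proof -
    have "norm (Z is a - Z is b) \<le> L is * norm (a - b)"
    proof (rule differentiable_bound[where S = UNIV])
      fix x :: "real^'n"
      show "(Z is has_derivative (\<lambda>w. \<Sum>i\<in>UNIV. vec_nth w i *\<^sub>R Z (i # is) x)) (at x within UNIV)"
        using jet_has_derivative[OF Z(1)] .
      show "onorm (\<lambda>w. \<Sum>i\<in>UNIV. vec_nth w i *\<^sub>R Z (i # is) x) \<le> L is"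
        unfolding L_def by (rule order_trans[OF onorm_le]) (intro sum_mono B)
    qed auto
    then show ?thesis by simp
  qed
  define Q where "Q is = (\<Sum>i\<in>UNIV. L (i # is))" for "is"
  have quad: "\<bar>Z is (a + w) - Z is a - (\<Sum>i\<in>UNIV. vec_nth w i * Z (i # is) a)\<bar> \<le> Q is * norm w * norm w"
    for "is" a w
  proof -
    have "norm (Z is (a + w) - Z is a - (\<Sum>i\<in>UNIV. vec_nth ((a + w) - a) i *\<^sub>R Z (i # is) a))
        \<le> norm ((a + w) - a) * (Q is * norm w)"
    proof (rule differentiable_bound_linearization[where S = "cball a (norm w)"])
      fix x assume x: "x \<in> cball a (norm w)"
      show "(Z is has_derivative (\<lambda>w. \<Sum>i\<in>UNIV. vec_nth w i *\<^sub>R Z (i # is) x)) (at x within cball a (norm w))"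
        using jet_has_derivative[OF Z(1)] has_derivative_at_withinI by blast
      have eq: "(\<lambda>w. (\<Sum>i\<in>UNIV. vec_nth w i *\<^sub>R Z (i # is) x)) - (\<lambda>w. \<Sum>i\<in>UNIV. vec_nth w i *\<^sub>R Z (i # is) a)
          = (\<lambda>w. \<Sum>i\<in>UNIV. vec_nth w i *\<^sub>R (Z (i # is) x - Z (i # is) a))"
        by (simp add: fun_eq_iff sum_subtractf algebra_simps)
      have le: "(\<Sum>i\<in>UNIV. \<bar>Z (i # is) x - Z (i # is) a\<bar>) \<le> Q is * norm w"
        unfolding Q_def sum_distrib_right
      proof (rule sum_mono)
        fix i
        have "0 \<le> B js" for js using B[of js 0] by linarith
        then have "0 \<le> L (i # is)" by (auto simp: L_def intro: sum_nonneg)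
        then have "L (i # is) * norm (x - a) \<le> L (i # is) * norm w"
          using x by (intro mult_left_mono) (auto simp: dist_norm norm_minus_commute)
        then show "\<bar>Z (i # is) x - Z (i # is) a\<bar> \<le> L (i # is) * norm w"
          using lip[of "i # is" x a] by linarith
      qed
      show "onorm ((\<lambda>w. (\<Sum>i\<in>UNIV. vec_nth w i *\<^sub>R Z (i # is) x)) -
          (\<lambda>w. \<Sum>i\<in>UNIV. vec_nth w i *\<^sub>R Z (i # is) a)) \<le> Q is * norm w"
        unfolding eq by (rule order_trans[OF onorm_le le])
    qed (auto simp: dist_norm mult_left_le_one_le)
    then show ?thesis by (simp add: algebra_simps)
  qed
  define V where "V = (LINT y|lebesgue. norm (v y))"
  have "V \<ge> 0" by (simp add: V_def)
  have B0: "0 \<le> B js" for js using B[of js 0] by linarith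
  then have "0 \<le> L is" for "is" by (auto simp: L_def intro: sum_nonneg)
  then have Q0: "0 \<le> Q is" for "is" by (auto simp: Q_def intro: sum_nonneg)
  let ?U = "\<lambda>is x. LINT y|lebesgue. Z is (x - y) *\<^sub>R v y"
  have est: "norm (?U is (x + w) - ?U is x - (\<Sum>i\<in>UNIV. vec_nth w i *\<^sub>R ?U (i # is) x)) \<le> Q is * V * norm w * norm w"
    for "is" x w
  proof -
    have "?U is (x + w) - ?U is x - (\<Sum>i\<in>UNIV. vec_nth w i *\<^sub>R ?U (i # is) x) =
        (LINT y|lebesgue. Z is (x + w - y) *\<^sub>R v y - Z is (x - y) *\<^sub>R v y -
           (\<Sum>i\<in>UNIV. vec_nth w i *\<^sub>R (Z (i # is) (x - y) *\<^sub>R v y)))"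
      using int by (simp del: scaleR_scaleR)
    also have "norm \<dots> \<le> (LINT y|lebesgue. (Q is * norm w * norm w) * norm (v y))"
    proof (rule Bochner_Integration.integral_norm_bound_integral)
      fix y
      have "Z is (x + w - y) *\<^sub>R v y - Z is (x - y) *\<^sub>R v y - (\<Sum>i\<in>UNIV. vec_nth w i *\<^sub>R (Z (i # is) (x - y) *\<^sub>R v y))
        = (Z is ((x - y) + w) - Z is (x - y) - (\<Sum>i\<in>UNIV. vec_nth w i * Z (i # is) (x - y))) *\<^sub>R v y"
        by (simp add: algebra_simps scaleR_sum_left)
      then show "norm (Z is (x + w - y) *\<^sub>R v y - Z is (x - y) *\<^sub>R v y - (\<Sum>i\<in>UNIV. vec_nth w i *\<^sub>R (Z (i # is) (x - y) *\<^sub>R v y)))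
          \<le> (Q is * norm w * norm w) * norm (v y)"
        using quad[of "is" "x - y" w] by (simp add: mult_right_mono)
    qed (use int v in \<open>auto simp del: scaleR_scaleR\<close>)
    also have "\<dots> = Q is * V * norm w * norm w" by (simp add: V_def algebra_simps)
    finally show ?thesis .
  qed
  show ?thesis
    unfolding jet_def
  proof (intro conjI allI impI)
    fix "is" x
    show "(?U is has_derivative (\<lambda>w. \<Sum>i\<in>UNIV. vec_nth w i *\<^sub>R ?U (i # is) x)) (at x)"
      unfolding has_derivative_at_alt
    proof (intro conjI allI impI)
      show "bounded_linear (\<lambda>w. \<Sum>i\<in>UNIV. vec_nth w i *\<^sub>R ?U (i # is) x)"
        by (intro bounded_linear_sum bounded_linear_compose[OF bounded_linear_scaleR_left] bounded_linear_vec_nth)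
      fix e :: real assume "e > 0"
      show "\<exists>d>0. \<forall>z. norm (z - x) < d \<longrightarrow>
          norm (?U is z - ?U is x - (\<Sum>i\<in>UNIV. vec_nth (z - x) i *\<^sub>R ?U (i # is) x)) \<le> e * norm (z - x)"
      proof (intro exI[of _ "e / (Q is * V + 1)"] conjI allI impI)
        show "0 < e / (Q is * V + 1)" using \<open>e > 0\<close> Q0 \<open>V \<ge> 0\<close> by (simp add: add_nonneg_pos)
        fix z assume z: "norm (z - x) < e / (Q is * V + 1)"
        have "Q is * V * norm (z - x) \<le> (Q is * V + 1) * norm (z - x)" by (simp add: algebra_simps)
        also have "\<dots> \<le> e"
          using z Q0[of "is"] \<open>V \<ge> 0\<close>
          by (subst (asm) pos_less_divide_eq) (auto simp: add_nonneg_pos mult.commute)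
        finally have "Q is * V * norm (z - x) * norm (z - x) \<le> e * norm (z - x)"
          by (intro mult_right_mono) auto
        then show "norm (?U is z - ?U is x - (\<Sum>i\<in>UNIV. vec_nth (z - x) i *\<^sub>R ?U (i # is) x)) \<le> e * norm (z - x)"
          using est[of "is" x "z - x"] by simp
      qed
    qed
  next
    fix "is" js :: "'n list" assume "mset is = mset js"
    then have "Z is = Z js" by (rule jet_mset[OF Z(1)])
    then show "(\<lambda>x. ?U is x) = (\<lambda>x. ?U js x)" by simp
  qed
qed

section \<open>Taylor polynomials indexed by lists of directions\<close>

lemma finite_lists_length_less [simp]: "finite {js :: 'n::finite list. length js < k}"
  by (rule finite_subset[OF _ finite_lists_length_le[OF finite, of UNIV k]]) auto

lemma finite_lists_length_eq' [simp]: "finite {js :: 'n::finite list. length js = k}"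
  by (rule finite_subset[OF _ finite_lists_length_le[OF finite, of UNIV k]]) auto

definition lmon :: "'n::finite list \<Rightarrow> real^'n \<Rightarrow> real" where
  "lmon js w = prod_list (map (vec_nth w) js)"

definition perm_invariant :: "('n list \<Rightarrow> 'b) \<Rightarrow> bool" where
  "perm_invariant c \<longleftrightarrow> (\<forall>is js. mset is = mset js \<longrightarrow> c is = c js)"

lemma perm_invariantD: "perm_invariant c \<Longrightarrow> mset is = mset js \<Longrightarrow> c is = c js"
  unfolding perm_invariant_def by blast

text \<open>Lists instead of multi-indices: a multi-index \<gamma> of order l is the count function
  of l! / \<gamma>! lists, so for permutation invariant coefficients the factor 1 / l! amounts to
  the usual 1 / \<gamma>!, and derivatives of a jet need no reindexing.\<close>

definition tpoly :: "nat \<Rightarrow> ('n::finite list \<Rightarrow> 'b::real_normed_vector) \<Rightarrow> real^'n \<Rightarrow> 'b" where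
  "tpoly k c w = (\<Sum>js | length js < k. (lmon js w / fact (length js)) *\<^sub>R c js)"

lemma lmon_simps [simp]: "lmon [] w = 1" "lmon (i # js) w = vec_nth w i * lmon js w"
  by (simp_all add: lmon_def)

lemma lmon_eq_prod_power: "lmon js w = (\<Prod>i\<in>UNIV. vec_nth w i ^ count_list js i)"
proof (induction js)
  case (Cons j js)
  have "(\<Prod>i\<in>UNIV. vec_nth w i ^ count_list (j # js) i) =
      (\<Prod>i\<in>UNIV. (if i = j then vec_nth w j else 1) * vec_nth w i ^ count_list js i)"
    by (intro prod.cong) auto
  then show ?case using Cons by (simp add: prod.distrib)
qed simp

lemma abs_lmon_le: "\<bar>lmon js w\<bar> \<le> norm w ^ length js"
  by (induction js) (auto simp: abs_mult intro!: mult_mono component_le_norm_cart)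

text \<open>Telescoping over the factors; with \<open>1 \<le> R\<close> all partial products are
  covered by one power of R.\<close>

lemma lmon_diff_le:
  assumes "norm w \<le> R" "norm w' \<le> R" "1 \<le> R"
  shows "\<bar>lmon js w - lmon js w'\<bar> \<le> real (length js) * R ^ length js * norm (w - w')"
proof (induction js)
  case (Cons j js)
  have "lmon (j # js) w - lmon (j # js) w' =
      vec_nth w j * (lmon js w - lmon js w') + vec_nth (w - w') j * lmon js w'"
    by (simp add: algebra_simps)
  also have "\<bar>\<dots>\<bar> \<le> R * (real (length js) * R ^ length js * norm (w - w')) + norm (w - w') * R ^ length js"
  proof -
    have "\<bar>vec_nth w j\<bar> \<le> R" using component_le_norm_cart[of w j] assms by linarith
    then have 1: "\<bar>vec_nth w j * (lmon js w - lmon js w')\<bar> \<le> R * (real (length js) * R ^ length js * norm (w - w'))"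
      using Cons assms unfolding abs_mult by (intro mult_mono) auto
    have "\<bar>lmon js w'\<bar> \<le> R ^ length js"
      using abs_lmon_le[of js w'] power_mono[OF assms(2), of "length js"] by simp
    then have 2: "\<bar>vec_nth (w - w') j * lmon js w'\<bar> \<le> norm (w - w') * R ^ length js"
      unfolding abs_mult by (intro mult_mono component_le_norm_cart) auto
    show ?thesis using 1 2 by linarith
  qed
  also have "\<dots> \<le> R * (real (length js) * R ^ length js * norm (w - w')) + norm (w - w') * (R * R ^ length js)"
    using assms by (intro add_left_mono mult_left_mono) (auto simp: mult_le_cancel_right1)
  finally show ?case by (simp add: algebra_simps)
qed simp

lemma norm_tpoly_le:
  fixes c :: "'n::finite list \<Rightarrow> 'b::real_normed_vector"
  assumes c: "\<And>js. length js < k \<Longrightarrow> norm (c js) \<le> M" and w: "norm w \<le> R" "1 \<le> R"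
  shows "norm (tpoly k c w) \<le> real (card {js :: 'n list. length js < k}) * R ^ k * M"
proof -
  have "norm ((lmon js w / fact (length js)) *\<^sub>R c js) \<le> R ^ k * M" if "length js < k" for js
  proof -
    have "\<bar>lmon js w\<bar> \<le> R ^ length js"
      using abs_lmon_le[of js w] power_mono[OF w(1), of "length js"] by simp
    also have "\<dots> \<le> R ^ k" using w that by (intro power_increasing) auto
    also have "R ^ k \<le> R ^ k * fact (length js)"
      using w by (simp add: mult_le_cancel_left1 fact_ge_1)
    finally have "\<bar>lmon js w\<bar> / fact (length js) \<le> R ^ k" by (simp add: field_simps)
    moreover have "norm (c js) \<le> M" using c that by simp
    ultimately have "\<bar>lmon js w\<bar> / fact (length js) * norm (c js) \<le> R ^ k * M"
      using w by (intro mult_mono) auto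
    then show ?thesis by simp
  qed
  then have "norm (tpoly k c w) \<le> (\<Sum>js | length (js :: 'n list) < k. R ^ k * M)"
    unfolding tpoly_def by (intro sum_norm_le) auto
  then show ?thesis by simp
qed

lemma norm_tpoly_diff_le:
  fixes c :: "'n::finite list \<Rightarrow> 'b::real_normed_vector"
  assumes c: "\<And>js. length js < k \<Longrightarrow> norm (c js) \<le> M"
    and w: "norm w \<le> R" "norm w' \<le> R" "1 \<le> R"
  shows "norm (tpoly k c w - tpoly k c w') \<le>
    real (card {js :: 'n list. length js < k}) * (real k * R ^ k * norm (w - w') * M)"
proof -
  have "norm (((lmon js w - lmon js w') / fact (length js)) *\<^sub>R c js) \<le> real k * R ^ k * norm (w - w') * M"
    if "length js < k" for js
  proof -
    have "\<bar>lmon js w - lmon js w'\<bar> \<le> real (length js) * R ^ length js * norm (w - w')"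
      by (rule lmon_diff_le[OF w])
    also have "\<dots> \<le> real k * R ^ k * norm (w - w')"
      using w that by (intro mult_right_mono mult_mono power_increasing) auto
    also have "\<dots> \<le> real k * R ^ k * norm (w - w') * fact (length js)"
      using w fact_ge_1[of "length js", where 'a = real]
        mult_left_mono[of 1 "fact (length js)" "real k * R ^ k * norm (w - w')"] by simp
    finally have "\<bar>lmon js w - lmon js w'\<bar> / fact (length js) \<le> real k * R ^ k * norm (w - w')"
      by (simp add: field_simps)
    moreover have "norm (c js) \<le> M" using c that by simp
    ultimately have "\<bar>lmon js w - lmon js w'\<bar> / fact (length js) * norm (c js) \<le>
        real k * R ^ k * norm (w - w') * M"
      using w by (intro mult_mono) auto
    then show ?thesis by simp
  qed
  then have "norm (\<Sum>js | length (js :: 'n list) < k. ((lmon js w - lmon js w') / fact (length js)) *\<^sub>R c js)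
      \<le> (\<Sum>js | length (js :: 'n list) < k. real k * R ^ k * norm (w - w') * M)"
    by (intro sum_norm_le) auto
  moreover have "tpoly k c w - tpoly k c w' =
      (\<Sum>js | length js < k. ((lmon js w - lmon js w') / fact (length js)) *\<^sub>R c js)"
    unfolding tpoly_def by (simp add: sum_subtractf[symmetric] diff_divide_distrib scaleR_diff_left)
  ultimately show ?thesis by simp
qed

section \<open>A perturbed grid is a norming set\<close>

text \<open>The weights are the coefficients of the Lagrange polynomials for the nodes 1, ..., k.
  Interpolation reproduces the monomials of degree below k, so the coefficient of X^b in the
  interpolant of X^a is 1 or 0.\<close>

lemma vandermonde_weights:
  "\<exists>\<omega> :: nat \<Rightarrow> nat \<Rightarrow> real. \<forall>b<k. \<forall>a<k. (\<Sum>s<k. \<omega> b s * (1 + real s) ^ a) = (if a = b then 1 else 0)"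
proof -
  define L where "L s = (\<Prod>r\<in>{..<k} - {s}. Polynomial.smult (1 / (real s - real r)) [:- (1 + real r), 1:])" for s
  have deg: "degree (L s) < k" if "s < k" for s
  proof -
    have "degree (L s) \<le> (\<Sum>r\<in>{..<k} - {s}. degree (Polynomial.smult (1 / (real s - real r)) [:- (1 + real r), 1:]))"
      unfolding L_def by (rule order_trans[OF degree_prod_sum_le]) (simp_all only: comp_def finite_Diff finite_lessThan order_refl)
    also have "\<dots> \<le> (\<Sum>r\<in>{..<k} - {s}. 1)"
      by (intro sum_mono order_trans[OF degree_smult_le]) simp
    also have "\<dots> < k" using that by simp
    finally show ?thesis .
  qed
  have val: "poly (L s) (1 + real r) = (if r = s then 1 else 0)" if "s < k" "r < k" for r s
  proof (cases "r = s")
    case True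
    have "poly (Polynomial.smult (1 / (real s - real r')) [:- (1 + real r'), 1:]) (1 + real s) = 1"
      if "r' \<noteq> s" for r'
      using that by (simp add: add_divide_distrib[symmetric])
    with True show ?thesis unfolding L_def poly_prod by (intro trans[OF prod.neutral]) auto
  next
    case False
    then show ?thesis using that unfolding L_def poly_prod
      by (simp add: prod_zero_iff add_divide_distrib[symmetric])
  qed
  have "(\<Sum>s<k. Polynomial.smult ((1 + real s) ^ a) (L s)) = monom 1 a" if "a < k" for a
  proof (rule poly_eqI_degree[where A = "(\<lambda>r. 1 + real r) ` {..<k}"])
    have c: "card ((\<lambda>r. 1 + real r) ` {..<k}) = k"
      by (subst card_image) (auto simp: inj_on_def)
    show "degree (monom (1 :: real) a) < card ((\<lambda>r. 1 + real r) ` {..<k})"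
      using that by (simp add: c degree_monom_eq)
    show "degree (\<Sum>s<k. Polynomial.smult ((1 + real s) ^ a) (L s)) < card ((\<lambda>r. 1 + real r) ` {..<k})"
      unfolding c using that deg by (intro degree_sum_less) (auto intro: le_less_trans[OF degree_smult_le])
    fix x assume "x \<in> (\<lambda>r. 1 + real r) ` {..<k}"
    then obtain r where r: "r < k" "x = 1 + real r" by auto
    have "poly (\<Sum>s<k. Polynomial.smult ((1 + real s) ^ a) (L s)) x = (\<Sum>s<k. if s = r then (1 + real s) ^ a else 0)"
      unfolding poly_sum poly_smult r(2) by (intro sum.cong) (auto simp: val r(1))
    also have "\<dots> = poly (monom 1 a) x" using r by (simp add: poly_monom)
    finally show "poly (\<Sum>s<k. Polynomial.smult ((1 + real s) ^ a) (L s)) x = poly (monom 1 a) x" .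
  qed
  then have "coeff (\<Sum>s<k. Polynomial.smult ((1 + real s) ^ a) (L s)) b = coeff (monom 1 a) b" if "a < k" for a b
    using that by simp
  then have "(\<Sum>s<k. coeff (L s) b * (1 + real s) ^ a) = (if a = b then 1 else 0)" if "a < k" for a b
    using that by (simp add: coeff_sum mult.commute)
  then show ?thesis by (intro exI[of _ "\<lambda>b s. coeff (L s) b"]) auto
qed

text \<open>Coordinates start at 1, so that every node has norm at least 1 and stays away from the
  averaging ball around the origin.\<close>

definition grid :: "nat \<Rightarrow> (real^'n::finite) set" where
  "grid k = (\<lambda>\<sigma>. vec_lambda (\<lambda>i. 1 + real (\<sigma> i))) ` (UNIV \<rightarrow>\<^sub>E {..<k})"

lemma finite_grid [simp]: "finite (grid k)"
  by (auto simp: grid_def intro!: finite_imageI finite_PiE)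

lemma norm_grid_le: "z \<in> grid k \<Longrightarrow> norm (z :: real^'n::finite) \<le> real (CARD('n) * k)"
proof -
  assume "z \<in> grid k"
  then obtain \<sigma> where s: "\<And>i. \<sigma> i < k" "z = vec_lambda (\<lambda>i. 1 + real (\<sigma> i))" by (auto simp: grid_def PiE_def Pi_def)
  have "norm z \<le> (\<Sum>i\<in>UNIV. \<bar>vec_nth z i\<bar>)" by (rule norm_le_l1_cart)
  also have "\<dots> \<le> (\<Sum>i\<in>(UNIV :: 'n set). real k)"
    by (rule sum_mono) (use s in \<open>auto simp: Suc_le_eq[symmetric] simp flip: of_nat_Suc\<close>)
  finally show ?thesis by simp
qed

lemma norm_grid_ge: "z \<in> grid k \<Longrightarrow> 1 \<le> norm (z :: real^'n::finite)"
proof -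
  assume "z \<in> grid k"
  then obtain \<sigma> where s: "z = vec_lambda (\<lambda>i. 1 + real (\<sigma> i))" by (auto simp: grid_def)
  then have "1 \<le> \<bar>vec_nth z undefined\<bar>" by simp
  then show ?thesis using component_le_norm_cart order_trans by blast
qed

text \<open>The tensor product of the Vandermonde functionals isolates the coefficients whose index
  list is a permutation of a given list; a coefficient family invariant under permutations is
  therefore recovered without counting these permutations.\<close>

lemma coefficients_le_grid_values:
  "\<exists>W\<ge>0. \<forall>(c :: 'n::finite list \<Rightarrow> 'b::real_normed_vector) M.
     perm_invariant c \<longrightarrow> (\<forall>z\<in>grid k. norm (tpoly k c z) \<le> M) \<longrightarrow>
     (\<forall>is. length is < k \<longrightarrow> norm (c is) \<le> W * M)"
proof -
  obtain \<omega> :: "nat \<Rightarrow> nat \<Rightarrow> real" where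
    \<omega>: "\<And>a b. b < k \<Longrightarrow> a < k \<Longrightarrow> (\<Sum>s<k. \<omega> b s * (1 + real s) ^ a) = (if a = b then 1 else 0)"
    using vandermonde_weights[of k] by blast
  let ?S = "UNIV \<rightarrow>\<^sub>E {..<k} :: ('n \<Rightarrow> nat) set"
  define t where "t \<sigma> = vec_lambda (\<lambda>i. 1 + real (\<sigma> i))" for \<sigma> :: "'n \<Rightarrow> nat"
  define w where "w is \<sigma> = (\<Prod>i\<in>UNIV. \<omega> (count_list is i) (\<sigma> i))" for "is" and \<sigma> :: "'n \<Rightarrow> nat"
  have count_less: "count_list is i < k" if "length is < k" for "is" :: "'n list" and i
    using that count_le_length[of "is" i] by simp
  have dual: "(\<Sum>\<sigma>\<in>?S. w is \<sigma> * lmon js (t \<sigma>)) = (if mset js = mset is then 1 else 0)"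
    if "length is < k" "length js < k" for "is" js
  proof -
    have "(\<Sum>\<sigma>\<in>?S. w is \<sigma> * lmon js (t \<sigma>)) =
        (\<Sum>\<sigma>\<in>?S. \<Prod>i\<in>UNIV. \<omega> (count_list is i) (\<sigma> i) * (1 + real (\<sigma> i)) ^ count_list js i)"
      by (simp add: w_def lmon_eq_prod_power t_def prod.distrib)
    also have "\<dots> = (\<Prod>i\<in>UNIV. \<Sum>s<k. \<omega> (count_list is i) s * (1 + real s) ^ count_list js i)"
      by (subst prod_sum_PiE) auto
    also have "\<dots> = (\<Prod>i\<in>UNIV. if count_list js i = count_list is i then 1 else 0)"
      using count_less that by (simp add: \<omega>)
    also have "\<dots> = (if mset js = mset is then 1 else 0)"
      by (auto simp: multiset_eq_iff count_mset)
    finally show ?thesis .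
  qed
  define W where "W = (\<Sum>is | length is < k. fact (length is) * (\<Sum>\<sigma>\<in>?S. \<bar>w is \<sigma>\<bar>))"
  have "norm (c is) \<le> W * M"
    if sym: "perm_invariant c" and M: "\<forall>z\<in>grid k. norm (tpoly k c z) \<le> M"
      and len: "length is < k" for c :: "'n list \<Rightarrow> 'b" and M "is"
  proof -
    let ?P = "{js. length js < k \<and> mset js = mset is}"
    have "(\<Sum>\<sigma>\<in>?S. w is \<sigma> *\<^sub>R tpoly k c (t \<sigma>)) =
        (\<Sum>js | length js < k. (\<Sum>\<sigma>\<in>?S. w is \<sigma> * lmon js (t \<sigma>)) *\<^sub>R ((1 / fact (length js)) *\<^sub>R c js))"
      unfolding tpoly_def scaleR_sum_right by (subst sum.swap) (simp add: scaleR_sum_left sum_divide_distrib)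
    also have "\<dots> = (\<Sum>js | length js < k. if mset js = mset is then (1 / fact (length js)) *\<^sub>R c js else 0)"
      using dual len by (intro sum.cong) auto
    also have "\<dots> = (\<Sum>js\<in>?P. (1 / fact (length js)) *\<^sub>R c js)"
      by (simp add: sum.If_cases Int_def conj_commute)
    also have "\<dots> = (\<Sum>js\<in>?P. (1 / fact (length is)) *\<^sub>R c is)"
    proof (rule sum.cong)
      fix js assume "js \<in> ?P"
      then have "mset js = mset is" by simp
      then show "(1 / fact (length js)) *\<^sub>R c js = (1 / fact (length is)) *\<^sub>R c is"
        using perm_invariantD[OF sym] mset_eq_length by metis
    qed simp
    finally have eq: "(\<Sum>\<sigma>\<in>?S. w is \<sigma> *\<^sub>R tpoly k c (t \<sigma>)) = (real (card ?P) / fact (length is)) *\<^sub>R c is"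
      by (simp add: scaleR_sum_left[symmetric] sum_constant_scaleR)
    have "finite ?P" by (rule finite_subset[OF _ finite_lists_length_less[of k]]) auto
    then have "1 \<le> card ?P" using len by (auto simp: Suc_le_eq card_gt_0_iff)
    then have "norm (c is) \<le> real (card ?P) * norm (c is)"
      by (simp add: mult_le_cancel_right1)
    also have "\<dots> = fact (length is) * norm (\<Sum>\<sigma>\<in>?S. w is \<sigma> *\<^sub>R tpoly k c (t \<sigma>))"
      unfolding eq by simp
    also have "\<dots> \<le> fact (length is) * (\<Sum>\<sigma>\<in>?S. \<bar>w is \<sigma>\<bar> * M)"
      using M by (intro mult_left_mono sum_norm_le) (auto simp: grid_def t_def intro!: mult_left_mono)
    also have "\<dots> = (fact (length is) * (\<Sum>\<sigma>\<in>?S. \<bar>w is \<sigma>\<bar>)) * M"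
      by (simp add: sum_distrib_right)
    also have "\<dots> \<le> W * M"
    proof (rule mult_right_mono)
      show "fact (length is) * (\<Sum>\<sigma>\<in>?S. \<bar>w is \<sigma>\<bar>) \<le> W"
        unfolding W_def using len
        by (intro member_le_sum[where f = "\<lambda>is. fact (length is) * (\<Sum>\<sigma>\<in>?S. \<bar>w is \<sigma>\<bar>)"])
          (auto intro!: mult_nonneg_nonneg sum_nonneg)
      \<comment> \<open>A bound for the values at the nodes is nonnegative because there is at least
        one node.\<close>
      have "k > 0" using len by simp
      then have "(\<lambda>_. 0) \<in> ?S" by auto
      then have "t (\<lambda>_. 0) \<in> grid k" unfolding grid_def t_def by (rule image_eqI[rotated]) simp
      then show "0 \<le> M" using M norm_ge_zero order_trans by blast
    qed
    finally show ?thesis .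
  qed
  moreover have "0 \<le> W" unfolding W_def by (intro sum_nonneg mult_nonneg_nonneg) auto
  ultimately show ?thesis by blast
qed

text \<open>An absorption argument: moving the nodes by 2 \<epsilon> changes the values by at most
  \<open>N * (2 * \<epsilon>) * A\<close>, where \<open>A\<close> is the largest coefficient, and
  \<epsilon> is so small that \<open>W\<close> times this is at most A / 2. Twice \<epsilon> is
  allowed because the data points deviate from the nodes, and the base point of the expansion from
  the origin, by up to \<epsilon> each.\<close>

lemma coefficients_le_perturbed_grid_values:
  "\<exists>\<epsilon>>0. \<epsilon> \<le> 1 / 4 \<and> (\<exists>W\<ge>0. \<forall>(c :: 'n::finite list \<Rightarrow> 'b::real_normed_vector) M \<zeta>.
     perm_invariant c \<longrightarrow>
     (\<forall>z\<in>grid k. norm (\<zeta> z - z) \<le> 2 * \<epsilon> \<and> norm (tpoly k c (\<zeta> z)) \<le> M) \<longrightarrow>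
     (\<forall>is. length is < k \<longrightarrow> norm (c is) \<le> W * M))"
proof -
  obtain W where "W \<ge> 0" and W: "\<And>(c :: 'n list \<Rightarrow> 'b) M is.
     perm_invariant c \<Longrightarrow> (\<forall>z\<in>grid k. norm (tpoly k c z) \<le> M) \<Longrightarrow>
     length is < k \<Longrightarrow> norm (c is) \<le> W * M"
    using coefficients_le_grid_values[of k] by blast
  define R where "R = real (CARD('n) * k) + 1"
  define N where "N = real (card {js :: 'n list. length js < k}) * (real k * R ^ k)"
  have "R \<ge> 1" "N \<ge> 0" by (auto simp: R_def N_def)
  define \<epsilon> where "\<epsilon> = min (1 / 4) (1 / (4 * (W * N + 1)))"
  have "\<epsilon> > 0" "\<epsilon> \<le> 1 / 4" using \<open>W \<ge> 0\<close> \<open>N \<ge> 0\<close> by (auto simp: \<epsilon>_def add_nonneg_pos)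
  have "\<epsilon> * (4 * (W * N + 1)) \<le> 1"
  proof -
    have "0 < 4 * (W * N + 1)" using \<open>W \<ge> 0\<close> \<open>N \<ge> 0\<close> by (simp add: add_nonneg_pos)
    moreover have "\<epsilon> \<le> 1 / (4 * (W * N + 1))" by (simp add: \<epsilon>_def)
    ultimately show ?thesis by (simp add: pos_le_divide_eq)
  qed
  then have small: "W * N * (2 * \<epsilon>) \<le> 1 / 2" using \<open>\<epsilon> > 0\<close> by (simp add: algebra_simps)
  have "norm (c is) \<le> (2 * W) * M"
    if sym: "perm_invariant c"
      and M: "\<forall>z\<in>grid k. norm (\<zeta> z - z) \<le> 2 * \<epsilon> \<and> norm (tpoly k c (\<zeta> z)) \<le> M"
      and len: "length is < k" for c :: "'n list \<Rightarrow> 'b" and M \<zeta> "is"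
  proof -
    define A where "A = Max ((\<lambda>js. norm (c js)) ` {js. length js < k})"
    have A: "norm (c js) \<le> A" if "length js < k" for js
      unfolding A_def using that by (intro Max_ge) auto
    have "norm (tpoly k c z) \<le> M + N * (2 * \<epsilon>) * A" if "z \<in> grid k" for z
    proof -
      have z: "norm z \<le> R" using norm_grid_le[OF that] by (simp add: R_def)
      have \<zeta>: "norm (\<zeta> z - z) \<le> 2 * \<epsilon>" using M that by blast
      then have "norm (\<zeta> z) \<le> R"
        using norm_grid_le[OF that] \<open>\<epsilon> \<le> 1 / 4\<close> norm_triangle_sub[of "\<zeta> z" z] by (simp add: R_def)
      then have "norm (tpoly k c (\<zeta> z) - tpoly k c z)
          \<le> real (card {js :: 'n list. length js < k}) * (real k * R ^ k * norm (\<zeta> z - z) * A)"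
        using z \<open>R \<ge> 1\<close> A by (intro norm_tpoly_diff_le) auto
      also have "\<dots> = N * norm (\<zeta> z - z) * A" by (simp add: N_def)
      also have "\<dots> \<le> N * (2 * \<epsilon>) * A"
        using \<zeta> \<open>N \<ge> 0\<close> order_trans[OF norm_ge_zero A[OF len]] by (intro mult_right_mono mult_left_mono) auto
      finally have "norm (tpoly k c z) \<le> norm (tpoly k c (\<zeta> z)) + N * (2 * \<epsilon>) * A"
        using norm_triangle_sub[of "tpoly k c z" "tpoly k c (\<zeta> z)"] by (simp add: norm_minus_commute)
      moreover have "norm (tpoly k c (\<zeta> z)) \<le> M" using M that by blast
      ultimately show ?thesis by linarith
    qed
    then have "norm (c js) \<le> W * (M + N * (2 * \<epsilon>) * A)" if "length js < k" for js
      using W[OF sym] that by blast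
    then have "A \<le> W * (M + N * (2 * \<epsilon>) * A)"
      unfolding A_def using len by (subst Max_le_iff) auto
    also have "\<dots> = W * M + W * N * (2 * \<epsilon>) * A" by (simp add: algebra_simps)
    also have "\<dots> \<le> W * M + 1 / 2 * A"
      using small order_trans[OF norm_ge_zero A[OF len]] by (intro add_left_mono mult_right_mono) auto
    finally show ?thesis using A[OF len] by simp
  qed
  then show ?thesis
    using \<open>\<epsilon> > 0\<close> \<open>\<epsilon> \<le> 1 / 4\<close> \<open>W \<ge> 0\<close> by (intro exI[of _ \<epsilon>] conjI exI[of _ "2 * W"]) auto
qed

section \<open>The remainder of Taylor's formula\<close>

lemma sum_lists_Suc:
  "(\<Sum>js | length (js :: 'n::finite list) = Suc l. g js) = (\<Sum>js | length (js :: 'n list) = l. \<Sum>i\<in>UNIV. g (i # js))"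
proof -
  have "{js :: 'n list. length js = Suc l} = (\<lambda>(js, i). i # js) ` ({js. length js = l} \<times> UNIV)"
    by (auto simp: length_Suc_conv image_iff)
  moreover have "inj_on (\<lambda>(js, i). i # js) ({js :: 'n list. length js = l} \<times> UNIV)"
    by (auto simp: inj_on_def)
  ultimately show ?thesis
    by (simp add: sum.reindex sum.cartesian_product case_prod_beta' comp_def)
qed

lemma sum_lists_less:
  "(\<Sum>js | length (js :: 'n::finite list) < n. g js) = (\<Sum>l<n. \<Sum>js | length (js :: 'n list) = l. g js)"
proof -
  have "{js :: 'n list. length js < n} = (\<Union>l\<in>{..<n}. {js. length js = l})" by auto
  then show ?thesis by (simp only:) (subst sum.UNION_disjoint, auto)
qed

text \<open>The segment is parametrized from x, so the kernel is \<open>s ^ (n - 1)\<close> and for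
  fixed s the evaluation point is a dilation of y about x; this suits the later integration over y.
  The bound is in terms of nonnegative integrals, so that no integrability has to be carried
  along.\<close>

lemma jet_taylor_remainder:
  fixes U :: "'n::finite list \<Rightarrow> real^'n \<Rightarrow> 'b::euclidean_space"
  assumes U: "jet U" and "n > 0"
  shows "ennreal (norm (U [] x - tpoly n (\<lambda>js. U js y) (x - y))) \<le>
    ennreal (norm (x - y) ^ n) *
      (\<integral>\<^sup>+s. ennreal (s ^ (n - 1) * (\<Sum>js | length js = n. norm (U js (x + s *\<^sub>R (y - x))))) * indicator {0..1} s \<partial>lborel)"
proof -
  have [measurable]: "U js \<in> borel_measurable borel" for js by (rule jet_measurable[OF U])
  define w where "w = x - y"
  \<comment> \<open>\<open>D l\<close> is the derivative of order l of \<open>U []\<close> along the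
    segment that starts in y at t = 0 and ends in x at t = 1.\<close>
  define D where "D l t = (\<Sum>js | length js = l. lmon js w *\<^sub>R U js (y + t *\<^sub>R w))" for l and t :: real
  have UD: "((\<lambda>t. U js (y + t *\<^sub>R w)) has_vector_derivative (\<Sum>i\<in>UNIV. vec_nth w i *\<^sub>R U (i # js) (y + t *\<^sub>R w)))
      (at t within S)" for js t S
  proof -
    have "((\<lambda>t. y + t *\<^sub>R w) has_derivative (\<lambda>h. h *\<^sub>R w)) (at t within S)"
      by (auto intro!: derivative_eq_intros)
    from has_derivative_compose[OF this jet_has_derivative[OF U]]
    show ?thesis
      by (simp add: has_vector_derivative_def scaleR_sum_right)
  qed
  have DD: "(D l has_vector_derivative D (Suc l) t) (at t within S)" for l t S
    unfolding D_def sum_lists_Suc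
    by (rule has_vector_derivative_eq_rhs, rule has_vector_derivative_sum,
        rule bounded_linear.has_vector_derivative[OF bounded_linear_scaleR_right UD])
      (simp add: scaleR_sum_right mult.commute)
  define g where "g t = ((1 - t) ^ (n - 1) / fact (n - 1)) *\<^sub>R D n t" for t
  have "(g has_integral D 0 1 - (\<Sum>i<n. ((1 - 0) ^ i / fact i) *\<^sub>R D i 0)) {0..1}"
    unfolding g_def by (rule Taylor_has_integral) (use DD \<open>n > 0\<close> in auto)
  moreover have "D 0 1 = U [] x" by (simp add: D_def w_def)
  moreover have "(\<Sum>i<n. ((1 - 0) ^ i / fact i) *\<^sub>R D i 0) = tpoly n (\<lambda>js. U js y) (x - y)"
    unfolding tpoly_def sum_lists_less D_def w_def by (simp add: scaleR_sum_right)
  ultimately have I: "(g has_integral U [] x - tpoly n (\<lambda>js. U js y) (x - y)) {0..1}" by simp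
  have cont: "continuous_on S (D n)" for S
    by (meson DD continuous_on_eq_continuous_within has_vector_derivative_continuous)
  then have "continuous_on {0..1} g"
    unfolding g_def by (intro continuous_intros) auto
  then have int: "set_integrable lborel {0..1} g" by (rule borel_integrable_atLeastAtMost')
  then have "U [] x - tpoly n (\<lambda>js. U js y) (x - y) = (LINT t:{0..1}|lborel. g t)"
    using I by (simp add: set_borel_integral_eq_integral integral_unique)
  then have "ennreal (norm (U [] x - tpoly n (\<lambda>js. U js y) (x - y))) \<le>
      (\<integral>\<^sup>+t. ennreal (norm (indicator {0..1} t *\<^sub>R g t)) \<partial>lborel)"
    using integral_norm_bound_ennreal[of lborel "\<lambda>t. indicator {0..1} t *\<^sub>R g t"] int
    unfolding set_lebesgue_integral_def set_integrable_def by (simp only:)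
  also have "\<dots> \<le> (\<integral>\<^sup>+t. ennreal (norm w ^ n) *
      (ennreal ((1 - t) ^ (n - 1) * (\<Sum>js | length js = n. norm (U js (y + t *\<^sub>R w)))) * indicator {0..1} t) \<partial>lborel)"
  proof (rule nn_integral_mono)
    fix t :: real
    have "norm (g t) \<le> norm w ^ n * ((1 - t) ^ (n - 1) * (\<Sum>js | length js = n. norm (U js (y + t *\<^sub>R w))))"
      if "0 \<le> t" "t \<le> 1"
    proof -
      have "norm (D n t) \<le> (\<Sum>js | length (js :: 'n list) = n. norm w ^ n * norm (U js (y + t *\<^sub>R w)))"
        unfolding D_def by (rule sum_norm_le) (use abs_lmon_le in \<open>auto intro!: mult_right_mono\<close>)
      moreover have "(1 - t) ^ (n - 1) / fact (n - 1) \<le> (1 - t) ^ (n - 1)"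
      proof -
        have "0 \<le> (1 - t) ^ (n - 1)" using that by simp
        then have "(1 - t) ^ (n - 1) * 1 \<le> (1 - t) ^ (n - 1) * fact (n - 1)"
          by (intro mult_left_mono fact_ge_1)
        then show ?thesis by (simp add: field_simps)
      qed
      ultimately have "norm (g t) \<le> (1 - t) ^ (n - 1) * (\<Sum>js | length (js :: 'n list) = n. norm w ^ n * norm (U js (y + t *\<^sub>R w)))"
        using that unfolding g_def norm_scaleR by (intro mult_mono) auto
      then show ?thesis by (simp add: sum_distrib_left algebra_simps)
    qed
    then show "ennreal (norm (indicator {0..1} t *\<^sub>R g t)) \<le> ennreal (norm w ^ n) *
      (ennreal ((1 - t) ^ (n - 1) * (\<Sum>js | length js = n. norm (U js (y + t *\<^sub>R w)))) * indicator {0..1} t)"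
      by (cases "t \<in> {0..1}") (auto simp: ennreal_mult[symmetric] sum_nonneg intro!: ennreal_leI)
  qed
  also have "\<dots> = ennreal (norm w ^ n) * (\<integral>\<^sup>+t. ennreal ((1 - t) ^ (n - 1) *
      (\<Sum>js | length js = n. norm (U js (y + t *\<^sub>R w)))) * indicator {0..1} t \<partial>lborel)"
    by (intro nn_integral_cmult) measurable
  also have "(\<integral>\<^sup>+t. ennreal ((1 - t) ^ (n - 1) *
      (\<Sum>js | length js = n. norm (U js (y + t *\<^sub>R w)))) * indicator {0..1} t \<partial>lborel) =
    (\<integral>\<^sup>+s. ennreal (s ^ (n - 1) * (\<Sum>js | length js = n. norm (U js (x + s *\<^sub>R (y - x))))) * indicator {0..1} s \<partial>lborel)"
  proof -
    have "y + (1 - s) *\<^sub>R w = x + s *\<^sub>R (y - x)" for s by (simp add: w_def algebra_simps)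
    moreover have "indicator {0..1} (1 - s) = (indicator {0..1} s :: ennreal)" for s :: real
      by (auto simp: indicator_def)
    ultimately show ?thesis
      by (subst nn_integral_lborel_affine[where c = "-1" and t = 1]) simp_all
  qed
  finally show ?thesis by (simp add: w_def)
qed

section \<open>The estimate at unit scale\<close>

text \<open>Hoelder's inequality against the constant 1, up to a factor 2. It is integrated from f
  \<le> l^(1-p) f^p + l, which is clear from the cases f \<le> l and f > l, with the level l that
  balances the two terms.\<close>

lemma nn_integral_Holder_one:
  fixes f :: "'a \<Rightarrow> real"
  assumes [measurable]: "f \<in> borel_measurable M" and f0: "\<And>x. 0 \<le> f x" and p: "1 \<le> p"
    and m: "emeasure M (space M) \<le> ennreal m" "0 < m"
    and I: "(\<integral>\<^sup>+x. ennreal (f x powr p) \<partial>M) \<le> ennreal I" "0 \<le> I"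
  shows "(\<integral>\<^sup>+x. ennreal (f x) \<partial>M) \<le> ennreal (2 * m powr (1 - 1 / p) * I powr (1 / p))"
proof -
  have young: "(\<integral>\<^sup>+x. ennreal (f x) \<partial>M) \<le> ennreal (l powr (1 - p) * I + l * m)" if "l > 0" for l
  proof -
    have pt: "f x \<le> l powr (1 - p) * f x powr p + l" for x
    proof (cases "f x \<le> l")
      case True
      then show ?thesis by (simp add: add_increasing)
    next
      case False
      then have "f x = f x powr (1 - p) * f x powr p"
        using \<open>l > 0\<close> by (simp add: powr_add[symmetric])
      also have "\<dots> \<le> l powr (1 - p) * f x powr p"
        using False \<open>l > 0\<close> p by (intro mult_right_mono powr_mono2') auto
      finally show ?thesis using \<open>l > 0\<close> by linarith
    qed
    have "(\<integral>\<^sup>+x. ennreal (f x) \<partial>M) \<le>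
        (\<integral>\<^sup>+x. ennreal (l powr (1 - p)) * ennreal (f x powr p) + ennreal l \<partial>M)"
      using pt \<open>l > 0\<close>
      by (intro nn_integral_mono) (auto simp: ennreal_mult[symmetric] ennreal_plus[symmetric] intro!: ennreal_leI simp del: ennreal_plus)
    also have "\<dots> = ennreal (l powr (1 - p)) * (\<integral>\<^sup>+x. ennreal (f x powr p) \<partial>M) + ennreal l * emeasure M (space M)"
      by (subst nn_integral_add) (auto simp: nn_integral_cmult)
    also have "\<dots> \<le> ennreal (l powr (1 - p)) * ennreal I + ennreal l * ennreal m"
      using I m by (intro add_mono mult_left_mono) auto
    also have "\<dots> = ennreal (l powr (1 - p) * I + l * m)"
      using \<open>l > 0\<close> I m by (simp add: ennreal_mult ennreal_plus)
    finally show ?thesis .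
  qed
  show ?thesis
  proof (cases "I = 0")
    \<comment> \<open>Nothing can be balanced for I = 0; the level l is sent to zero
      instead.\<close>
    case True
    have "(\<integral>\<^sup>+x. ennreal (f x) \<partial>M) \<le> 0 + ennreal e" if "e > 0" for e
      using young[of "e / m"] True that m by simp
    then have "(\<integral>\<^sup>+x. ennreal (f x) \<partial>M) \<le> 0"
      by (rule ennreal_le_epsilon)
    then show ?thesis by simp
  next
    case False
    with I have "I > 0" by simp
    define l where "l = (I / m) powr (1 / p)"
    have "l > 0" using \<open>I > 0\<close> m by (simp add: l_def)
    have "l powr (1 - p) * I = m powr (1 - 1 / p) * I powr (1 / p)"
    proof -
      have "1 / p * (1 - p) = 1 / p - 1" using p by (simp add: field_simps)
      then have "l powr (1 - p) = (I / m) powr (1 / p - 1)"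
        by (simp add: l_def powr_powr)
      also have "\<dots> = I powr (1 / p - 1) / m powr (1 / p - 1)"
        using \<open>I > 0\<close> m by (simp add: powr_divide)
      also have "\<dots> = I powr (1 / p - 1) * m powr (1 - 1 / p)"
        using powr_minus_divide[of m "1 / p - 1"] by simp
      also have "I powr (1 / p - 1) = I powr (1 / p) / I"
        using \<open>I > 0\<close> powr_diff[of I "1 / p" 1] by simp
      finally show ?thesis using \<open>I > 0\<close> by simp
    qed
    moreover have "l * m = m powr (1 - 1 / p) * I powr (1 / p)"
      using \<open>I > 0\<close> m powr_diff[of m 1 "1 / p"] by (simp add: l_def powr_divide)
    ultimately show ?thesis using young[OF \<open>l > 0\<close>] by (simp add: ac_simps)
  qed
qed

lemma nn_integral_powr_01:
  fixes b :: real
  assumes "b > - 1"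
  shows "(\<integral>\<^sup>+s. ennreal (s powr b) * indicator {0..1} s \<partial>lborel) = ennreal (1 / (b + 1))"
proof -
  have "((\<lambda>s. s powr b) has_integral 1 / (b + 1)) {0..1}"
    using has_integral_powr_from_0[OF assms, of 1] by simp
  from nn_integral_has_integral_lebesgue[OF _ this] show ?thesis
    by (simp add: mult.commute ennreal_mult ennreal_indicator)
qed

lemma nn_integral_dilation:
  fixes g :: "'a::euclidean_space \<Rightarrow> ennreal"
  assumes [measurable]: "g \<in> borel_measurable borel" "B \<in> sets borel" and "0 < s"
  shows "(\<integral>\<^sup>+y. g (a + s *\<^sub>R (y - a)) * indicator B y \<partial>lborel) =
    ennreal (1 / s ^ DIM('a)) * (\<integral>\<^sup>+z. g z * indicator B (a + (1 / s) *\<^sub>R (z - a)) \<partial>lborel)"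
proof -
  have e: "(a - (1 / s) *\<^sub>R a) + (1 / s) *\<^sub>R z = a + (1 / s) *\<^sub>R (z - a)"
    "a + s *\<^sub>R (a + (1 / s) *\<^sub>R (z - a) - a) = z" for z
    using \<open>0 < s\<close> by (simp_all add: algebra_simps)
  have "(\<integral>\<^sup>+y. g (a + s *\<^sub>R (y - a)) * indicator B y \<partial>lborel) = ennreal (\<bar>1 / s\<bar> ^ DIM('a)) *
    (\<integral>\<^sup>+z. g (a + s *\<^sub>R ((a - (1 / s) *\<^sub>R a) + (1 / s) *\<^sub>R z - a)) * indicator B ((a - (1 / s) *\<^sub>R a) + (1 / s) *\<^sub>R z) \<partial>lborel)"
    using \<open>0 < s\<close> by (intro nn_integral_lborel_affine) auto
  then show ?thesis
    unfolding e using \<open>0 < s\<close> by (simp add: power_divide)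
qed

text \<open>For \<open>p > 1\<close> the Hoelder inequality on each slice of constant \<open>s\<close> leaves the integrable
  factor \<open>s powr (n - 1 - d / p)\<close>. For \<open>p = 1\<close> this factor may be \<open>1 / s\<close>; as the ball stays
  away from \<open>a\<close>, a point \<open>z\<close> is only met for \<open>s\<close> comparable to \<open>norm (z - a)\<close>.\<close>

lemma averaged_remainder_le:
  fixes p R \<epsilon> :: real
  assumes "0 < \<epsilon>" "0 < R" "1 \<le> p" "0 < n"
    and "p > 1 \<Longrightarrow> real n > real CARD('n::finite) / p" and "p = 1 \<Longrightarrow> n \<ge> CARD('n)"
  shows "\<exists>C\<ge>0. \<forall>(H :: real^'n \<Rightarrow> real) V a I.
    H \<in> borel_measurable borel \<longrightarrow> (\<forall>z. 0 \<le> H z) \<longrightarrow> convex V \<longrightarrow> V \<in> sets borel \<longrightarrow> ball 0 \<epsilon> \<subseteq> V \<longrightarrow> a \<in> V \<longrightarrow>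
    (\<forall>y\<in>ball 0 \<epsilon>. 1 / 2 \<le> norm (y - a) \<and> norm (y - a) \<le> R) \<longrightarrow>
    (\<integral>\<^sup>+z. ennreal (H z powr p) * indicator V z \<partial>lborel) \<le> ennreal I \<longrightarrow> 0 \<le> I \<longrightarrow>
    (\<integral>\<^sup>+y. (\<integral>\<^sup>+s. ennreal (s ^ (n - 1) * H (a + s *\<^sub>R (y - a))) * indicator {0..1} s \<partial>lborel) * indicator (ball 0 \<epsilon>) y \<partial>lborel)
      \<le> ennreal (C * I powr (1 / p))"
proof -
  let ?B = "ball 0 \<epsilon> :: (real^'n) set"
  let ?d = "CARD('n)"
  have [measurable]: "?B \<in> sets borel" by simp
  define m where "m = measure lborel ?B"
  have "m > 0" using content_ball_pos[OF \<open>0 < \<epsilon>\<close>, of "0 :: real^'n"] by (simp add: m_def)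
  have em: "emeasure lborel ?B = ennreal m"
    unfolding m_def by (rule emeasure_eq_ennreal_measure) (use emeasure_lborel_ball_finite[of "0 :: real^'n" \<epsilon>] in \<open>simp add: less_top\<close>)
  \<comment> \<open>The hypothesis for p > 1 says exactly that b > -1.\<close>
  define b where "b = real n - 1 - real ?d / p"
  define C where "C = (if p > 1 then 2 * m powr (1 - 1 / p) * (1 / (b + 1)) else 2 * R)"
  have "(\<integral>\<^sup>+y. (\<integral>\<^sup>+s. ennreal (s ^ (n - 1) * H (a + s *\<^sub>R (y - a))) * indicator {0..1} s \<partial>lborel) * indicator ?B y \<partial>lborel)
      \<le> ennreal (C * I powr (1 / p))"
    if [measurable]: "H \<in> borel_measurable borel" "V \<in> sets borel" and H0: "\<forall>z. 0 \<le> H z" and V: "convex V" "?B \<subseteq> V" "a \<in> V"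
      and sep: "\<forall>y\<in>?B. 1 / 2 \<le> norm (y - a) \<and> norm (y - a) \<le> R"
      and I: "(\<integral>\<^sup>+z. ennreal (H z powr p) * indicator V z \<partial>lborel) \<le> ennreal I" "0 \<le> I"
    for H :: "real^'n \<Rightarrow> real" and V a I
  proof -
    \<comment> \<open>Undoing the dilation: such a z lies between a and a point of the ball, hence
      in the convex set \<open>V\<close>.\<close>
    have seg: "z \<in> V" if "0 < s" "s \<le> 1" "a + (1 / s) *\<^sub>R (z - a) \<in> ?B" for z s
    proof -
      have "(1 - s) *\<^sub>R a + s *\<^sub>R (a + (1 / s) *\<^sub>R (z - a)) \<in> V"
        using V that by (intro convexD_alt) auto
      moreover have "(1 - s) *\<^sub>R a + s *\<^sub>R (a + (1 / s) *\<^sub>R (z - a)) = z"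
        using that by (simp add: algebra_simps)
      ultimately show ?thesis by simp
    qed
    have "(\<integral>\<^sup>+y. (\<integral>\<^sup>+s. ennreal (s ^ (n - 1) * H (a + s *\<^sub>R (y - a))) * indicator {0..1} s \<partial>lborel) * indicator ?B y \<partial>lborel)
      = (\<integral>\<^sup>+y. (\<integral>\<^sup>+s. ennreal (s ^ (n - 1) * H (a + s *\<^sub>R (y - a))) * indicator {0..1} s * indicator ?B y \<partial>lborel) \<partial>lborel)"
      by (simp add: nn_integral_multc)
    also have "\<dots> = (\<integral>\<^sup>+s. (\<integral>\<^sup>+y. ennreal (s ^ (n - 1) * H (a + s *\<^sub>R (y - a))) * indicator {0..1} s * indicator ?B y \<partial>lborel) \<partial>lborel)"
      by (rule lborel_pair.Fubini') measurable
    also have "\<dots> = (\<integral>\<^sup>+s. ennreal (s ^ (n - 1)) * indicator {0..1} s *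
        (\<integral>\<^sup>+y. ennreal (H (a + s *\<^sub>R (y - a))) * indicator ?B y \<partial>lborel) \<partial>lborel)"
    proof (rule nn_integral_cong)
      fix s :: real
      have "(\<integral>\<^sup>+y. ennreal (s ^ (n - 1) * H (a + s *\<^sub>R (y - a))) * indicator {0..1} s * indicator ?B y \<partial>lborel)
        = (\<integral>\<^sup>+y. (ennreal (s ^ (n - 1)) * indicator {0..1} s) * (ennreal (H (a + s *\<^sub>R (y - a))) * indicator ?B y) \<partial>lborel)"
        using H0 by (intro nn_integral_cong) (auto simp: ennreal_mult' indicator_def ac_simps)
      then show "(\<integral>\<^sup>+y. ennreal (s ^ (n - 1) * H (a + s *\<^sub>R (y - a))) * indicator {0..1} s * indicator ?B y \<partial>lborel)
        = ennreal (s ^ (n - 1)) * indicator {0..1} s * (\<integral>\<^sup>+y. ennreal (H (a + s *\<^sub>R (y - a))) * indicator ?B y \<partial>lborel)"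
        by (simp add: nn_integral_cmult)
    qed
    also have "\<dots> \<le> ennreal (C * I powr (1 / p))"
    proof (cases "p > 1")
      case True
      have "(\<integral>\<^sup>+s. ennreal (s ^ (n - 1)) * indicator {0..1} s *
          (\<integral>\<^sup>+y. ennreal (H (a + s *\<^sub>R (y - a))) * indicator ?B y \<partial>lborel) \<partial>lborel)
        \<le> (\<integral>\<^sup>+s. ennreal (2 * m powr (1 - 1 / p) * I powr (1 / p)) * (ennreal (s powr b) * indicator {0..1} s) \<partial>lborel)"
      proof (rule nn_integral_mono_AE)
        show "AE s in lborel. ennreal (s ^ (n - 1)) * indicator {0..1} s *
          (\<integral>\<^sup>+y. ennreal (H (a + s *\<^sub>R (y - a))) * indicator ?B y \<partial>lborel)
          \<le> ennreal (2 * m powr (1 - 1 / p) * I powr (1 / p)) * (ennreal (s powr b) * indicator {0..1} s)"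
          using AE_lborel_singleton[of "0 :: real"]
        proof eventually_elim
          case (elim s)
          show ?case
          proof (cases "s \<in> {0..1}")
            case False
            then show ?thesis by simp
          next
            case True
            with elim have s: "0 < s" "s \<le> 1" by auto
            let ?M = "restrict_space lborel ?B"
            have "(\<integral>\<^sup>+y. ennreal (H (a + s *\<^sub>R (y - a)) powr p) \<partial>?M) =
                (\<integral>\<^sup>+y. ennreal (H (a + s *\<^sub>R (y - a)) powr p) * indicator ?B y \<partial>lborel)"
              by (simp add: nn_integral_restrict_space)
            also have "\<dots> = ennreal (1 / s ^ ?d) * (\<integral>\<^sup>+z. ennreal (H z powr p) * indicator ?B (a + (1 / s) *\<^sub>R (z - a)) \<partial>lborel)"
              using nn_integral_dilation[of "\<lambda>z. ennreal (H z powr p)" ?B s a] s by simp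
            also have "\<dots> \<le> ennreal (1 / s ^ ?d) * ennreal I"
              using seg[OF s] by (intro mult_left_mono order_trans[OF nn_integral_mono I(1)]) (auto simp: indicator_def)
            also have "\<dots> = ennreal (I / s ^ ?d)"
              using s I by (simp add: ennreal_mult[symmetric])
            finally have 1: "(\<integral>\<^sup>+y. ennreal (H (a + s *\<^sub>R (y - a)) powr p) \<partial>?M) \<le> ennreal (I / s ^ ?d)" .
            have "(\<integral>\<^sup>+y. ennreal (H (a + s *\<^sub>R (y - a))) * indicator ?B y \<partial>lborel) =
                (\<integral>\<^sup>+y. ennreal (H (a + s *\<^sub>R (y - a))) \<partial>?M)"
              by (simp add: nn_integral_restrict_space)
            also have "\<dots> \<le> ennreal (2 * m powr (1 - 1 / p) * (I / s ^ ?d) powr (1 / p))"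
              using 1 H0 s I(2) \<open>m > 0\<close> \<open>1 \<le> p\<close>
              by (intro nn_integral_Holder_one) (auto simp: emeasure_restrict_space space_restrict_space em intro!: measurable_restrict_space1)
            also have "(I / s ^ ?d) powr (1 / p) = I powr (1 / p) * s powr (- (real ?d / p))"
              using s I by (simp add: powr_divide powr_realpow[symmetric] powr_powr powr_minus_divide)
            finally have 2: "(\<integral>\<^sup>+y. ennreal (H (a + s *\<^sub>R (y - a))) * indicator ?B y \<partial>lborel) \<le>
                ennreal (2 * m powr (1 - 1 / p) * (I powr (1 / p) * s powr (- (real ?d / p))))" .
            have "s ^ (n - 1) * s powr (- (real ?d / p)) = s powr b"
              using s \<open>0 < n\<close> by (simp add: b_def powr_realpow[symmetric] powr_add[symmetric] of_nat_diff)
            then have "ennreal (s ^ (n - 1)) * ennreal (2 * m powr (1 - 1 / p) * (I powr (1 / p) * s powr (- (real ?d / p)))) =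
                ennreal (2 * m powr (1 - 1 / p) * I powr (1 / p)) * ennreal (s powr b)"
              using s by (simp add: ennreal_mult[symmetric] ac_simps)
            then show ?thesis using True mult_left_mono[OF 2, of "ennreal (s ^ (n - 1))"] by simp
          qed
        qed
      qed
      also have "\<dots> = ennreal (2 * m powr (1 - 1 / p) * I powr (1 / p)) * ennreal (1 / (b + 1))"
        using True assms by (subst nn_integral_cmult) (auto simp: nn_integral_powr_01 b_def)
      also have "\<dots> = ennreal (C * I powr (1 / p))"
        using True assms by (simp add: C_def b_def ennreal_mult[symmetric] ac_simps)
      finally show ?thesis .
    next
      case False
      with \<open>1 \<le> p\<close> have "p = 1" by simp
      then have "n \<ge> ?d" using assms by simp
      have [measurable]: "Measurable.pred (borel \<Otimes>\<^sub>M borel) (\<lambda>x. norm (fst x - a) \<in> {snd x / 2 .. R * snd x})"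
        unfolding atLeastAtMost_iff by measurable
      let ?J = "\<lambda>s z. indicator {0<..1} s * (ennreal (H z) * indicator V z) * (ennreal (1 / s) * indicator {s / 2 .. R * s} (norm (z - a)))"
      have "(\<integral>\<^sup>+s. ennreal (s ^ (n - 1)) * indicator {0..1} s *
          (\<integral>\<^sup>+y. ennreal (H (a + s *\<^sub>R (y - a))) * indicator ?B y \<partial>lborel) \<partial>lborel)
        \<le> (\<integral>\<^sup>+s. (\<integral>\<^sup>+z. ?J s z \<partial>lborel) \<partial>lborel)"
      proof (rule nn_integral_mono_AE)
        show "AE s in lborel. ennreal (s ^ (n - 1)) * indicator {0..1} s *
          (\<integral>\<^sup>+y. ennreal (H (a + s *\<^sub>R (y - a))) * indicator ?B y \<partial>lborel) \<le> (\<integral>\<^sup>+z. ?J s z \<partial>lborel)"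
          using AE_lborel_singleton[of "0 :: real"]
        proof eventually_elim
          case (elim s)
          show ?case
          proof (cases "s \<in> {0..1}")
            case False
            then show ?thesis by simp
          next
            case True
            with elim have s: "0 < s" "s \<le> 1" by auto
            \<comment> \<open>For p = 1 this is where n \<ge> d enters.\<close>
            have "s ^ (n - 1) * (1 / s ^ ?d) \<le> 1 / s"
            proof -
              have "s ^ (n - 1) * s = s ^ n" using \<open>0 < n\<close> by (simp add: power_eq_if mult.commute)
              also have "\<dots> \<le> s ^ ?d" using s \<open>n \<ge> ?d\<close> by (intro power_decreasing) auto
              finally show ?thesis using s by (simp add: field_simps)
            qed
            then have le: "ennreal (s ^ (n - 1)) * ennreal (1 / s ^ ?d) \<le> ennreal (1 / s)"
              using s by (simp add: ennreal_mult[symmetric] ennreal_leI)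
            have "ennreal (s ^ (n - 1)) * indicator {0..1} s * (\<integral>\<^sup>+y. ennreal (H (a + s *\<^sub>R (y - a))) * indicator ?B y \<partial>lborel)
              = ennreal (s ^ (n - 1)) * (ennreal (1 / s ^ ?d) * (\<integral>\<^sup>+z. ennreal (H z) * indicator ?B (a + (1 / s) *\<^sub>R (z - a)) \<partial>lborel))"
              using nn_integral_dilation[of "\<lambda>z. ennreal (H z)" ?B s a] s by simp
            also have "\<dots> \<le> ennreal (1 / s) * (\<integral>\<^sup>+z. ennreal (H z) * indicator ?B (a + (1 / s) *\<^sub>R (z - a)) \<partial>lborel)"
              unfolding mult.assoc[symmetric] by (rule mult_right_mono[OF le]) simp
            also have "\<dots> = (\<integral>\<^sup>+z. ennreal (1 / s) * (ennreal (H z) * indicator ?B (a + (1 / s) *\<^sub>R (z - a))) \<partial>lborel)"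
              by (simp add: nn_integral_cmult)
            also have "\<dots> \<le> (\<integral>\<^sup>+z. ?J s z \<partial>lborel)"
            proof (rule nn_integral_mono)
              fix z
              show "ennreal (1 / s) * (ennreal (H z) * indicator ?B (a + (1 / s) *\<^sub>R (z - a))) \<le> ?J s z"
              proof (cases "a + (1 / s) *\<^sub>R (z - a) \<in> ?B")
                case True
                have "norm (a + (1 / s) *\<^sub>R (z - a) - a) = norm (z - a) / s" using s by simp
                then have "1 / 2 \<le> norm (z - a) / s" "norm (z - a) / s \<le> R" using sep True by metis+
                then have "norm (z - a) \<in> {s / 2 .. R * s}" using s by (simp add: field_simps)
                then show ?thesis using seg[OF s True] s by (auto simp: ac_simps indicator_def)
              qed simp
            qed
            finally show ?thesis .
          qed
        qed
      qed
      also have "\<dots> = (\<integral>\<^sup>+z. (\<integral>\<^sup>+s. ?J s z \<partial>lborel) \<partial>lborel)"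
        by (rule lborel_pair.Fubini') measurable
      also have "\<dots> \<le> (\<integral>\<^sup>+z. ennreal (2 * R) * (ennreal (H z powr p) * indicator V z) \<partial>lborel)"
      proof (rule nn_integral_mono)
        fix z
        \<comment> \<open>Only s between r / R and 2 r contribute. There 1 / s \<le> R / r, and the
          interval has length at most 2 r, so the weight of z is at most 2 R whatever its distance
          from a.\<close>
        let ?r = "norm (z - a)"
        have "(\<integral>\<^sup>+s. ?J s z \<partial>lborel) \<le> (\<integral>\<^sup>+s. (ennreal (H z) * indicator V z * ennreal (R / ?r)) * indicator {0 .. 2 * ?r} s \<partial>lborel)"
        proof (rule nn_integral_mono)
          fix s :: real
          show "?J s z \<le> (ennreal (H z) * indicator V z * ennreal (R / ?r)) * indicator {0 .. 2 * ?r} s"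
          proof (cases "0 < s \<and> s \<le> 1 \<and> s / 2 \<le> ?r \<and> ?r \<le> R * s")
            case True
            then have "0 < ?r" by linarith
            with True have "1 / s \<le> R / ?r" by (simp add: field_simps)
            then show ?thesis using True by (auto intro!: mult_left_mono ennreal_leI simp: ac_simps)
          qed (auto simp: indicator_def)
        qed
        also have "\<dots> = (ennreal (H z) * indicator V z * ennreal (R / ?r)) * ennreal (2 * ?r)"
          by (simp add: nn_integral_cmult_indicator)
        also have "ennreal (R / ?r) * ennreal (2 * ?r) \<le> ennreal (2 * R)"
          using \<open>0 < R\<close> by (cases "?r = 0") (auto simp: ennreal_mult[symmetric])
        then have "(ennreal (H z) * indicator V z * ennreal (R / ?r)) * ennreal (2 * ?r) \<le> ennreal (H z) * indicator V z * ennreal (2 * R)"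
          unfolding mult.assoc by (intro mult_left_mono) auto
        finally show "(\<integral>\<^sup>+s. ?J s z \<partial>lborel) \<le> ennreal (2 * R) * (ennreal (H z powr p) * indicator V z)"
          using H0 \<open>p = 1\<close> by (simp add: ac_simps)
      qed
      also have "\<dots> \<le> ennreal (2 * R) * ennreal I"
        using I by (subst nn_integral_cmult) (auto intro!: mult_left_mono)
      also have "\<dots> = ennreal (C * I powr (1 / p))"
        using \<open>p = 1\<close> \<open>0 < R\<close> I by (simp add: C_def ennreal_mult[symmetric])
      finally show ?thesis .
    qed
    finally show ?thesis .
  qed
  moreover have "0 \<le> C" using assms by (auto simp: C_def b_def)
  ultimately show ?thesis by (intro exI[of _ C]) simp
qed

text \<open>The averaging ball is centered at the origin. For a base point y in it, the grid bound
  controls the Taylor coefficients at y by the data values and the remainders at the data points;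
  the coefficients in turn control \<open>U is x\<close> up to one more remainder. Only the
  remainders depend on y, and they are averaged. The number \<epsilon> precedes R because the
  geometry that supplies R is built for a given \<epsilon>.\<close>

lemma jet_unit_scale_estimate:
  fixes p :: real
  assumes "1 \<le> p" "m < k"
    and "p > 1 \<Longrightarrow> real k > real m + real CARD('n::finite) / p" and "p = 1 \<Longrightarrow> k \<ge> m + CARD('n)"
  shows "\<exists>\<epsilon>>0. \<epsilon> \<le> 1 / 4 \<and> (\<forall>R. \<exists>C\<ge>0. \<forall>(U :: 'n list \<Rightarrow> real^'n \<Rightarrow> 'b::euclidean_space) V x \<zeta> M I is.
     jet U \<longrightarrow> convex V \<longrightarrow> V \<in> sets borel \<longrightarrow> ball 0 \<epsilon> \<subseteq> V \<longrightarrow> x \<in> V \<longrightarrow> 1 \<le> norm x \<longrightarrow> norm x \<le> R \<longrightarrow>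
     (\<forall>z\<in>grid k. \<zeta> z \<in> V \<and> norm (\<zeta> z - z) \<le> \<epsilon> \<and> norm (U [] (\<zeta> z)) \<le> M) \<longrightarrow> length is = m \<longrightarrow>
     (\<integral>\<^sup>+z. ennreal ((\<Sum>js | length js = k. norm (U js z)) powr p) * indicator V z \<partial>lborel) \<le> ennreal I \<longrightarrow> 0 \<le> I \<longrightarrow>
     norm (U is x) \<le> C * (M + I powr (1 / p)))"
proof -
  obtain \<epsilon> W where "\<epsilon> > 0" "\<epsilon> \<le> 1 / 4" "W \<ge> 0" and W: "\<And>(c :: 'n list \<Rightarrow> 'b) M \<zeta> is.
     perm_invariant c \<Longrightarrow> (\<forall>z\<in>grid k. norm (\<zeta> z - z) \<le> 2 * \<epsilon> \<and> norm (tpoly k c (\<zeta> z)) \<le> M) \<Longrightarrow>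
     length is < k \<Longrightarrow> norm (c is) \<le> W * M"
    using coefficients_le_perturbed_grid_values[of k] by blast
  have "\<exists>C\<ge>0. \<forall>(U :: 'n list \<Rightarrow> real^'n \<Rightarrow> 'b) V x \<zeta> M I is.
     jet U \<longrightarrow> convex V \<longrightarrow> V \<in> sets borel \<longrightarrow> ball 0 \<epsilon> \<subseteq> V \<longrightarrow> x \<in> V \<longrightarrow> 1 \<le> norm x \<longrightarrow> norm x \<le> R \<longrightarrow>
     (\<forall>z\<in>grid k. \<zeta> z \<in> V \<and> norm (\<zeta> z - z) \<le> \<epsilon> \<and> norm (U [] (\<zeta> z)) \<le> M) \<longrightarrow> length is = m \<longrightarrow>
     (\<integral>\<^sup>+z. ennreal ((\<Sum>js | length js = k. norm (U js z)) powr p) * indicator V z \<partial>lborel) \<le> ennreal I \<longrightarrow> 0 \<le> I \<longrightarrow>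
     norm (U is x) \<le> C * (M + I powr (1 / p))" for R
  proof -
    let ?B = "ball 0 \<epsilon> :: (real^'n) set"
    let ?n = "k - m"
    \<comment> \<open>\<open>S\<close> bounds the distances from the averaging ball to x and to the
      data points, and it is at least 1 as the polynomial estimates demand.\<close>
    define S where "S = max R (real (CARD('n) * k) + 1) + 1"
    have "S \<ge> 1" "R + 1 \<le> S" "real (CARD('n) * k) + 2 \<le> S"
      by (auto simp: S_def le_max_iff_disj)
    define G where "G H l a y = (\<integral>\<^sup>+s. ennreal (s ^ (l - 1) * H (a + s *\<^sub>R (y - a))) * indicator {0..1} s \<partial>lborel)"
      for H :: "real^'n \<Rightarrow> real" and l :: nat and a y :: "real^'n"
    define Q where "Q l C \<longleftrightarrow> (\<forall>(H :: real^'n \<Rightarrow> real) V a I.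
      H \<in> borel_measurable borel \<longrightarrow> (\<forall>z. 0 \<le> H z) \<longrightarrow> convex V \<longrightarrow> V \<in> sets borel \<longrightarrow> ball 0 \<epsilon> \<subseteq> V \<longrightarrow> a \<in> V \<longrightarrow>
      (\<forall>y\<in>ball 0 \<epsilon>. 1 / 2 \<le> norm (y - a) \<and> norm (y - a) \<le> S) \<longrightarrow>
      (\<integral>\<^sup>+z. ennreal (H z powr p) * indicator V z \<partial>lborel) \<le> ennreal I \<longrightarrow> 0 \<le> I \<longrightarrow>
      (\<integral>\<^sup>+y. G H l a y * indicator (ball 0 \<epsilon>) y \<partial>lborel) \<le> ennreal (C * I powr (1 / p)))" for l C
    \<comment> \<open>Two orders occur: l = k - m for the remainder of the derivative at x, and l =
      k for the remainders at the data points. The conditions on l become weaker as l grows.\<close>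
    have "\<exists>C\<ge>0. Q l C" if "?n \<le> l" for l
      unfolding Q_def G_def using assms \<open>0 < \<epsilon>\<close> \<open>S \<ge> 1\<close> that
      by (intro averaged_remainder_le) (auto simp: of_nat_diff)
    then obtain C0 where C0: "\<And>l. ?n \<le> l \<Longrightarrow> 0 \<le> C0 l" and Q: "\<And>l. ?n \<le> l \<Longrightarrow> Q l (C0 l)"
      by metis
    define \<mu> where "\<mu> = measure lborel ?B"
    have "\<mu> > 0" using content_ball_pos[OF \<open>0 < \<epsilon>\<close>, of "0 :: real^'n"] by (simp add: \<mu>_def)
    have em: "emeasure lborel ?B = ennreal \<mu>"
      unfolding \<mu>_def by (rule emeasure_eq_ennreal_measure)
        (use emeasure_lborel_ball_finite[of "0 :: real^'n" \<epsilon>] in \<open>simp add: less_top\<close>)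
    \<comment> \<open>The bound of \<open>norm_tpoly_le\<close> for order k - m, with coefficients
      bounded by \<open>W\<close> times the values on the grid.\<close>
    define K where "K = real (card {js :: 'n list. length js < ?n}) * S ^ ?n * W"
    have "K \<ge> 0" using \<open>S \<ge> 1\<close> \<open>W \<ge> 0\<close> by (simp add: K_def)
    define A where "A = S ^ ?n * C0 ?n + K * (real (card (grid k :: (real^'n) set)) * (S ^ k * C0 k))"
    have "A \<ge> 0" using \<open>S \<ge> 1\<close> \<open>K \<ge> 0\<close> C0[of ?n] C0[of k] by (simp add: A_def)
    define C where "C = max K (A / \<mu>)"
    have "C \<ge> 0" using \<open>K \<ge> 0\<close> by (simp add: C_def)
    have "norm (U is x) \<le> C * (M + I powr (1 / p))"
      if U: "jet U" and V: "convex V" "V \<in> sets borel" "?B \<subseteq> V" "x \<in> V" and x: "1 \<le> norm x" "norm x \<le> R"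
        and \<zeta>: "\<forall>z\<in>grid k. \<zeta> z \<in> V \<and> norm (\<zeta> z - z) \<le> \<epsilon> \<and> norm (U [] (\<zeta> z)) \<le> M" and len: "length is = m"
        and I: "(\<integral>\<^sup>+z. ennreal ((\<Sum>js | length js = k. norm (U js z)) powr p) * indicator V z \<partial>lborel) \<le> ennreal I" "0 \<le> I"
      for U :: "'n list \<Rightarrow> real^'n \<Rightarrow> 'b" and V x \<zeta> M I "is"
    proof -
      have [measurable]: "U js \<in> borel_measurable borel" for js by (rule jet_measurable[OF U])
      have [measurable]: "?B \<in> sets borel" by simp
      define H where "H z = (\<Sum>js | length js = k. norm (U js z))" for z
      have [measurable]: "H \<in> borel_measurable borel" unfolding H_def by measurable
      have H0: "\<forall>z. 0 \<le> H z" by (simp add: H_def sum_nonneg)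
      have [measurable]: "(\<lambda>y. G H l a y) \<in> borel_measurable borel" for l a
        unfolding G_def by measurable
      have dist_x: "1 / 2 \<le> norm (y - x) \<and> norm (y - x) \<le> S" if "y \<in> ?B" for y
        using that x \<open>\<epsilon> \<le> 1 / 4\<close> \<open>R + 1 \<le> S\<close> norm_triangle_ineq4[of y x] norm_triangle_ineq2[of x y]
        by (auto simp: norm_minus_commute)
      have dist_\<zeta>: "1 / 2 \<le> norm (y - \<zeta> z) \<and> norm (y - \<zeta> z) \<le> S" if "y \<in> ?B" "z \<in> grid k" for y z
      proof -
        have "1 \<le> norm z" "norm z \<le> real (CARD('n) * k)"
          using norm_grid_ge[OF that(2)] norm_grid_le[OF that(2)] by auto
        moreover have "norm (\<zeta> z - z) \<le> 1 / 4" using \<zeta> that \<open>\<epsilon> \<le> 1 / 4\<close> by force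
        ultimately have "3 / 4 \<le> norm (\<zeta> z)" "norm (\<zeta> z) \<le> real (CARD('n) * k) + 1 / 4"
          using norm_triangle_ineq2[of z "\<zeta> z"] norm_triangle_ineq2[of "\<zeta> z" z] by (auto simp: norm_minus_commute)
        moreover have "norm y < 1 / 4" using that \<open>\<epsilon> \<le> 1 / 4\<close> by simp
        ultimately show ?thesis
          using \<open>real (CARD('n) * k) + 2 \<le> S\<close> norm_triangle_ineq4[of y "\<zeta> z"] norm_triangle_ineq2[of "\<zeta> z" y]
          by (auto simp: norm_minus_commute)
      qed
      have taylor: "ennreal (norm (U js a - tpoly (k - length js) (\<lambda>is. U (is @ js) y) (a - y))) \<le>
          ennreal (S ^ (k - length js)) * G H (k - length js) a y"
        if "length js < k" "norm (y - a) \<le> S" for js a y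
      proof -
        let ?l = "k - length js"
        have "ennreal (norm (U js a - tpoly ?l (\<lambda>is. U (is @ js) y) (a - y))) \<le> ennreal (norm (a - y) ^ ?l) *
          (\<integral>\<^sup>+s. ennreal (s ^ (?l - 1) * (\<Sum>is | length is = ?l. norm (U (is @ js) (a + s *\<^sub>R (y - a))))) * indicator {0..1} s \<partial>lborel)"
          using jet_taylor_remainder[OF jet_append[OF U, of js], of ?l a y] that by simp
        also have "\<dots> \<le> ennreal (S ^ ?l) * G H ?l a y"
          unfolding G_def
        proof (rule mult_mono[OF _ nn_integral_mono])
          show "ennreal (norm (a - y) ^ ?l) \<le> ennreal (S ^ ?l)"
            using that by (intro ennreal_leI power_mono) (auto simp: norm_minus_commute)
          fix s :: real
          \<comment> \<open>The derivatives of order k - |js| of \<open>U js\<close> are among the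
            derivatives of order k of \<open>U []\<close>.\<close>
          have "(\<Sum>is | length is = ?l. norm (U (is @ js) z)) \<le> H z" for z
          proof -
            have "(\<Sum>is | length is = ?l. norm (U (is @ js) z)) = (\<Sum>is\<in>(\<lambda>is. is @ js) ` {is. length is = ?l}. norm (U is z))"
              by (subst sum.reindex) (auto simp: inj_on_def)
            also have "\<dots> \<le> H z" unfolding H_def using that by (intro sum_mono2) auto
            finally show ?thesis .
          qed
          then show "ennreal (s ^ (?l - 1) * (\<Sum>is | length is = ?l. norm (U (is @ js) (a + s *\<^sub>R (y - a))))) * indicator {0..1} s
              \<le> ennreal (s ^ (?l - 1) * H (a + s *\<^sub>R (y - a))) * indicator {0..1} s"
            by (cases "s \<in> {0..1}") (auto intro!: ennreal_leI mult_left_mono)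
        qed auto
        finally show ?thesis .
      qed
      have "M \<ge> 0"
      proof -
        have "k > 0" using assms by simp
        then have "vec_lambda (\<lambda>i. 1 + real 0) \<in> (grid k :: (real^'n) set)"
          unfolding grid_def by (intro image_eqI[of _ _ "\<lambda>_. 0"]) auto
        then show ?thesis using \<zeta> norm_ge_zero order_trans by blast
      qed
      have ptwise: "ennreal (norm (U is x)) \<le> ennreal (K * M) +
          (ennreal (S ^ ?n) * G H ?n x y + ennreal K * (\<Sum>z\<in>grid k. ennreal (S ^ k) * G H k (\<zeta> z) y))"
        if y: "y \<in> ?B" for y
      proof -
        define E where "E z = norm (U [] (\<zeta> z) - tpoly k (\<lambda>js. U js y) (\<zeta> z - y))" for z
        have inv: "perm_invariant (\<lambda>js. U js y)"
          unfolding perm_invariant_def using jet_mset[OF U] by metis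
        have "norm (U js y) \<le> W * (M + sum E (grid k))" if "length js < k" for js
        \<comment> \<open>The displaced nodes are the data points seen from y: \<zeta> z - y differs
          from z by \<epsilon> for the data point and by another \<epsilon> for y.\<close>
        proof (rule W[OF inv _ that, of "\<lambda>z. \<zeta> z - y"], intro ballI conjI)
          fix z :: "real^'n" assume z: "z \<in> grid k"
          have "norm (\<zeta> z - z) \<le> \<epsilon>" using \<zeta> z by blast
          then show "norm (\<zeta> z - y - z) \<le> 2 * \<epsilon>"
            using y norm_triangle_ineq4[of "\<zeta> z - z" y] by (simp add: algebra_simps)
          have "norm (tpoly k (\<lambda>js. U js y) (\<zeta> z - y)) \<le> norm (U [] (\<zeta> z)) + E z"
            unfolding E_def using norm_triangle_ineq4[of "U [] (\<zeta> z)" "U [] (\<zeta> z) - tpoly k (\<lambda>js. U js y) (\<zeta> z - y)"]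
            by simp
          also have "\<dots> \<le> M + sum E (grid k)"
            using \<zeta> z by (intro add_mono member_le_sum) (auto simp: E_def)
          finally show "norm (tpoly k (\<lambda>js. U js y) (\<zeta> z - y)) \<le> M + sum E (grid k)" .
        qed
        then have "norm (tpoly ?n (\<lambda>js. U (js @ is) y) (x - y)) \<le>
            real (card {js :: 'n list. length js < ?n}) * S ^ ?n * (W * (M + sum E (grid k)))"
          using dist_x[OF y] \<open>S \<ge> 1\<close> len by (intro norm_tpoly_le) (auto simp: norm_minus_commute)
        then have "norm (U is x) \<le> K * M + (norm (U is x - tpoly ?n (\<lambda>js. U (js @ is) y) (x - y)) + K * sum E (grid k))"
          using norm_triangle_ineq4[of "U is x - tpoly ?n (\<lambda>js. U (js @ is) y) (x - y)" "- tpoly ?n (\<lambda>js. U (js @ is) y) (x - y)"]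
          by (simp add: K_def algebra_simps)
        then have "ennreal (norm (U is x)) \<le> ennreal (K * M) +
            (ennreal (norm (U is x - tpoly ?n (\<lambda>js. U (js @ is) y) (x - y))) + ennreal K * (\<Sum>z\<in>grid k. ennreal (E z)))"
          using \<open>K \<ge> 0\<close> \<open>M \<ge> 0\<close> by (subst sum_ennreal)
            (auto simp: E_def sum_nonneg ennreal_mult[symmetric] ennreal_plus[symmetric] simp del: ennreal_plus intro!: ennreal_leI)
        also have "\<dots> \<le> ennreal (K * M) +
          (ennreal (S ^ ?n) * G H ?n x y + ennreal K * (\<Sum>z\<in>grid k. ennreal (S ^ k) * G H k (\<zeta> z) y))"
        proof (intro add_mono order_refl mult_left_mono sum_mono)
          show "ennreal (norm (U is x - tpoly ?n (\<lambda>js. U (js @ is) y) (x - y))) \<le> ennreal (S ^ ?n) * G H ?n x y"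
            using taylor[of "is" y x] dist_x[OF y] len \<open>m < k\<close> by simp
          fix z :: "real^'n" assume z: "z \<in> grid k"
          show "ennreal (E z) \<le> ennreal (S ^ k) * G H k (\<zeta> z) y"
            using taylor[of "[]" y "\<zeta> z"] dist_\<zeta>[OF y z] \<open>m < k\<close> by (simp add: E_def)
        qed auto
        finally show ?thesis .
      qed
      have I': "(\<integral>\<^sup>+z. ennreal (H z powr p) * indicator V z \<partial>lborel) \<le> ennreal I"
        using I by (simp add: H_def)
      \<comment> \<open>The quantity to be estimated does not depend on y, so integration over the
        ball multiplies it by the volume \<open>\<mu>\<close>, which is divided out at the
        end.\<close>
      have "ennreal (norm (U is x)) * ennreal \<mu> = (\<integral>\<^sup>+y. ennreal (norm (U is x)) * indicator ?B y \<partial>lborel)"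
        by (simp add: nn_integral_cmult_indicator em)
      also have "\<dots> \<le> (\<integral>\<^sup>+y. ennreal (K * M) * indicator ?B y +
          (ennreal (S ^ ?n) * (G H ?n x y * indicator ?B y) + ennreal K * (\<Sum>z\<in>grid k. ennreal (S ^ k) * (G H k (\<zeta> z) y * indicator ?B y))) \<partial>lborel)"
      proof (rule nn_integral_mono)
        fix y
        show "ennreal (norm (U is x)) * indicator ?B y \<le> ennreal (K * M) * indicator ?B y +
          (ennreal (S ^ ?n) * (G H ?n x y * indicator ?B y) + ennreal K * (\<Sum>z\<in>grid k. ennreal (S ^ k) * (G H k (\<zeta> z) y * indicator ?B y)))"
          using ptwise[of y] by (cases "y \<in> ?B") auto
      qed
      also have "\<dots> = ennreal (K * M) * ennreal \<mu> +
          (ennreal (S ^ ?n) * (\<integral>\<^sup>+y. G H ?n x y * indicator ?B y \<partial>lborel) +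
           ennreal K * (\<Sum>z\<in>grid k. ennreal (S ^ k) * (\<integral>\<^sup>+y. G H k (\<zeta> z) y * indicator ?B y \<partial>lborel)))"
        by (simp add: nn_integral_add nn_integral_cmult nn_integral_sum nn_integral_cmult_indicator em)
      also have "\<dots> \<le> ennreal (K * M) * ennreal \<mu> +
          (ennreal (S ^ ?n) * ennreal (C0 ?n * I powr (1 / p)) +
           ennreal K * (\<Sum>z\<in>(grid k :: (real^'n) set). ennreal (S ^ k) * ennreal (C0 k * I powr (1 / p))))"
      proof (intro add_mono order_refl mult_left_mono sum_mono)
        show "(\<integral>\<^sup>+y. G H ?n x y * indicator ?B y \<partial>lborel) \<le> ennreal (C0 ?n * I powr (1 / p))"
          using Q[of ?n, unfolded Q_def, rule_format, of H V x I] V I' I(2) H0 dist_x by simp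
        fix z :: "real^'n" assume z: "z \<in> grid k"
        show "(\<integral>\<^sup>+y. G H k (\<zeta> z) y * indicator ?B y \<partial>lborel) \<le> ennreal (C0 k * I powr (1 / p))"
          using Q[of k, unfolded Q_def, rule_format, of H V "\<zeta> z" I] V I' I(2) H0 dist_\<zeta>[OF _ z] \<zeta> z by simp
      qed auto
      also have "\<dots> = ennreal (K * M * \<mu> + A * I powr (1 / p))"
        using \<open>K \<ge> 0\<close> \<open>M \<ge> 0\<close> \<open>S \<ge> 1\<close> \<open>\<mu> > 0\<close> C0[of ?n] C0[of k]
        by (simp add: A_def ennreal_mult[symmetric] ennreal_plus[symmetric] ennreal_of_nat_eq_real_of_nat algebra_simps del: ennreal_plus)
      finally have "norm (U is x) * \<mu> \<le> K * M * \<mu> + A * I powr (1 / p)"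
        using \<open>K \<ge> 0\<close> \<open>M \<ge> 0\<close> \<open>\<mu> > 0\<close> \<open>A \<ge> 0\<close> by (simp add: ennreal_mult[symmetric] del: ennreal_plus)
      then have "norm (U is x) \<le> K * M + A / \<mu> * I powr (1 / p)"
        using \<open>\<mu> > 0\<close> by (simp add: field_simps)
      also have "\<dots> \<le> C * M + C * I powr (1 / p)"
        using \<open>M \<ge> 0\<close> by (intro add_mono mult_right_mono) (auto simp: C_def)
      finally show ?thesis by (simp add: algebra_simps)
    qed
    with \<open>C \<ge> 0\<close> show ?thesis by (intro exI[of _ C]) simp
  qed
  with \<open>\<epsilon> > 0\<close> \<open>\<epsilon> \<le> 1 / 4\<close> show ?thesis by (intro exI[of _ \<epsilon>]) simp
qed

section \<open>Lebesgue points\<close>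

text \<open>The strong form, with the norm inside the average: it suits a kernel that is known only
  through its size, its support and its mass.\<close>

definition lebesgue_point :: "(real^'n::finite \<Rightarrow> 'b::euclidean_space) \<Rightarrow> real^'n \<Rightarrow> bool" where
  "lebesgue_point f x \<longleftrightarrow>
     ((\<lambda>\<epsilon>. integral (cbox x (x + \<epsilon> *\<^sub>R One)) (\<lambda>y. norm (f y - f x)) / \<epsilon> ^ CARD('n)) \<longlongrightarrow> 0) (at_right 0)"

lemma content_cbox_One:
  fixes x :: "real^'n::finite"
  assumes "0 \<le> \<epsilon>" shows "measure lborel (cbox x (x + \<epsilon> *\<^sub>R One)) = \<epsilon> ^ CARD('n)"
proof -
  have "measure lborel (cbox x (x + \<epsilon> *\<^sub>R One)) = (\<Prod>b\<in>(Basis :: (real^'n) set). inner (x + \<epsilon> *\<^sub>R One) b - inner x b)"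
    using assms by (intro content_cbox) (auto simp: inner_add_left inner_sum_left_Basis)
  also have "\<dots> = (\<Prod>b\<in>(Basis :: (real^'n) set). \<epsilon>)"
    by (intro prod.cong) (auto simp: inner_add_left inner_sum_left_Basis)
  finally show ?thesis by simp
qed

lemma norm_diff_integrable_on_cbox:
  fixes f :: "real^'n::finite \<Rightarrow> 'b::euclidean_space"
  assumes "integrable lebesgue f"
  shows "(\<lambda>y. norm (f y - q)) absolutely_integrable_on cbox a b"
proof -
  have "f absolutely_integrable_on cbox a b"
    using integrable_mult_indicator[OF _ assms, of "cbox a b"] by (simp add: set_integrable_def)
  moreover have "(\<lambda>_. q) absolutely_integrable_on cbox a b"
    by (intro absolutely_integrable_continuous) auto
  ultimately have "(\<lambda>y. f y - q) absolutely_integrable_on cbox a b"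
    by (rule set_integral_diff(1))
  then show ?thesis by (rule absolutely_integrable_norm[unfolded comp_def])
qed

text \<open>Differentiating the averages of |f - q| for countably many dense q costs one null set.
  Outside it, replacing f x in the average by a close q costs |f x - q| once in the average and once
  in its limit.\<close>

lemma AE_lebesgue_point:
  fixes f :: "real^'n::finite \<Rightarrow> 'b::euclidean_space"
  assumes f: "integrable lebesgue f"
  shows "AE x in lebesgue. lebesgue_point f x"
proof -
  obtain D :: "'b set" where D: "countable D" "\<And>X. open X \<Longrightarrow> X \<noteq> {} \<Longrightarrow> \<exists>d\<in>D. d \<in> X"
    using countable_dense_setE by blast
  have "\<exists>N. negligible N \<and> (\<forall>x e. x \<notin> N \<longrightarrow> 0 < e \<longrightarrow> (\<exists>d>0. \<forall>h. 0 < h \<and> h < d \<longrightarrow>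
      norm (integral (cbox x (x + h *\<^sub>R One)) (\<lambda>y. norm (f y - q)) /\<^sub>R h ^ CARD('n) - norm (f x - q)) < e))" for q
    using integrable_ccontinuous_explicit[of "\<lambda>y. norm (f y - q)"]
      norm_diff_integrable_on_cbox[OF f, THEN set_lebesgue_integral_eq_integral(1)]
    by (metis DIM_cart DIM_real mult.right_neutral)
  then obtain N where N: "\<And>q. negligible (N q)"
    "\<And>q x e. x \<notin> N q \<Longrightarrow> 0 < e \<Longrightarrow> \<exists>d>0. \<forall>h. 0 < h \<and> h < d \<longrightarrow>
      norm (integral (cbox x (x + h *\<^sub>R One)) (\<lambda>y. norm (f y - q)) /\<^sub>R h ^ CARD('n) - norm (f x - q)) < e"
    by metis
  have "negligible (\<Union>(N ` D))" using D N(1) by (intro negligible_countable_Union) auto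
  moreover have *: "lebesgue_point f x" if "x \<notin> \<Union>(N ` D)" for x
    unfolding lebesgue_point_def
  proof (rule tendstoI)
    fix e :: real assume "e > 0"
    obtain q where q: "q \<in> D" "norm (f x - q) < e / 3"
      using D(2)[of "ball (f x) (e / 3)"] \<open>e > 0\<close> by (auto simp: dist_norm)
    then have "x \<notin> N q" using that by blast
    then obtain d where "d > 0" and d: "\<And>h. 0 < h \<Longrightarrow> h < d \<Longrightarrow>
        norm (integral (cbox x (x + h *\<^sub>R One)) (\<lambda>y. norm (f y - q)) /\<^sub>R h ^ CARD('n) - norm (f x - q)) < e / 3"
      using N(2)[of x q "e / 3"] \<open>e > 0\<close> by auto
    have "dist (integral (cbox x (x + h *\<^sub>R One)) (\<lambda>y. norm (f y - f x)) / h ^ CARD('n)) 0 < e"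
      if h: "0 < h" "h < d" for h
    proof -
      let ?Q = "cbox x (x + h *\<^sub>R One)"
      note int = norm_diff_integrable_on_cbox[OF f, THEN set_lebesgue_integral_eq_integral(1)]
      have "integral ?Q (\<lambda>y. norm (f y - f x)) \<le> integral ?Q (\<lambda>y. norm (f y - q) + norm (f x - q))"
        using norm_triangle_ineq4[of "f y - q" "f x - q" for y]
        by (intro integral_le int integrable_add) auto
      also have "\<dots> = integral ?Q (\<lambda>y. norm (f y - q)) + norm (f x - q) * h ^ CARD('n)"
        using int h by (subst integral_add) (auto simp: content_cbox_One)
      finally have "integral ?Q (\<lambda>y. norm (f y - f x)) / h ^ CARD('n) \<le>
          integral ?Q (\<lambda>y. norm (f y - q)) / h ^ CARD('n) + norm (f x - q)"
        using h by (simp add: field_simps)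
      moreover have "integral ?Q (\<lambda>y. norm (f y - q)) / h ^ CARD('n) < norm (f x - q) + e / 3"
      proof -
        have "integral ?Q (\<lambda>y. norm (f y - q)) /\<^sub>R h ^ CARD('n) = integral ?Q (\<lambda>y. norm (f y - q)) / h ^ CARD('n)"
          by (simp add: divide_inverse mult.commute)
        then show ?thesis using d[OF h] unfolding real_norm_def by linarith
      qed
      moreover have "0 \<le> integral ?Q (\<lambda>y. norm (f y - f x)) / h ^ CARD('n)"
        using h by (intro divide_nonneg_nonneg integral_nonneg int) auto
      ultimately show ?thesis using q by simp
    qed
    then show "\<forall>\<^sub>F h in at_right 0. dist (integral (cbox x (x + h *\<^sub>R One)) (\<lambda>y. norm (f y - f x)) / h ^ CARD('n)) 0 < e"
      using \<open>d > 0\<close> unfolding eventually_at_right_field by blast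
  qed
  moreover have "{x \<in> space lebesgue. \<not> lebesgue_point f x} \<subseteq> \<Union>(N ` D)"
    using * by blast
  ultimately show ?thesis
    unfolding negligible_iff_null_sets by (intro AE_I')
qed

lemma cbox_subset_ball:
  fixes x :: "real^'n::finite"
  assumes "0 < \<epsilon>" "\<epsilon> < r / CARD('n)"
  shows "cbox x (x + \<epsilon> *\<^sub>R One) \<subseteq> ball x r"
proof
  fix y assume "y \<in> cbox x (x + \<epsilon> *\<^sub>R One)"
  then have y: "\<bar>vec_nth (y - x) i\<bar> \<le> \<epsilon>" for i by (auto simp: mem_box_cart algebra_simps)
  have "norm (y - x) \<le> (\<Sum>i\<in>UNIV. \<bar>vec_nth (y - x) i\<bar>)" by (rule norm_le_l1_cart)
  also have "\<dots> \<le> (\<Sum>i\<in>(UNIV :: 'n set). \<epsilon>)" by (rule sum_mono[OF y])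
  also have "\<dots> < r" using assms by (simp add: field_simps)
  finally show "y \<in> ball x r" by (simp add: dist_norm norm_minus_commute)
qed

lemma eventually_cbox_subset:
  fixes x :: "real^'n::finite"
  assumes "open S" "x \<in> S"
  shows "\<forall>\<^sub>F \<epsilon> in at_right 0. cbox x (x + \<epsilon> *\<^sub>R One) \<subseteq> S"
proof -
  obtain r where r: "r > 0" "ball x r \<subseteq> S" using assms openE by blast
  then show ?thesis
    using cbox_subset_ball[of _ r x] unfolding eventually_at_right_field
    by (intro exI[of _ "r / CARD('n)"]) (auto intro: subset_trans)
qed

text \<open>The data points form a null set, so a statement about almost every point says nothing
  about them; there this criterion is used.\<close>

lemma isCont_lebesgue_point:
  fixes f :: "real^'n::finite \<Rightarrow> 'b::euclidean_space"
  assumes f: "integrable lebesgue f" and "isCont f x"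
  shows "lebesgue_point f x"
  unfolding lebesgue_point_def
proof (rule tendstoI)
  fix e :: real assume "e > 0"
  then obtain d where "d > 0" and d: "\<And>y. dist y x < d \<Longrightarrow> dist (f y) (f x) < e / 2"
    using \<open>isCont f x\<close> unfolding continuous_at_eps_delta by (metis half_gt_zero)
  have "\<forall>\<^sub>F \<epsilon> in at_right 0. cbox x (x + \<epsilon> *\<^sub>R One) \<subseteq> ball x d"
    using \<open>d > 0\<close> by (intro eventually_cbox_subset) auto
  moreover have "\<forall>\<^sub>F \<epsilon> in at_right (0 :: real). 0 < \<epsilon>"
    by (rule eventually_at_right_less)
  ultimately show "\<forall>\<^sub>F h in at_right 0. dist (integral (cbox x (x + h *\<^sub>R One)) (\<lambda>y. norm (f y - f x)) / h ^ CARD('n)) 0 < e"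
  proof eventually_elim
    case (elim h)
    let ?Q = "cbox x (x + h *\<^sub>R One)"
    note int = norm_diff_integrable_on_cbox[OF f, THEN set_lebesgue_integral_eq_integral(1)]
    have "integral ?Q (\<lambda>y. norm (f y - f x)) \<le> integral ?Q (\<lambda>y. e / 2)"
      using elim d by (intro integral_le int) (auto simp: dist_norm norm_minus_commute less_imp_le subset_iff)
    also have "\<dots> = e / 2 * h ^ CARD('n)" using elim by (simp add: content_cbox_One)
    finally have "integral ?Q (\<lambda>y. norm (f y - f x)) / h ^ CARD('n) \<le> e / 2"
      using elim by (simp add: field_simps)
    moreover have "0 \<le> integral ?Q (\<lambda>y. norm (f y - f x)) / h ^ CARD('n)"
      using elim by (intro divide_nonneg_nonneg integral_nonneg int) auto
    ultimately show ?case
      using \<open>e > 0\<close> unfolding dist_real_def diff_0_right by linarith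
  qed
qed

lemma mollifier_jet: "mollifier C \<epsilon> Z \<Longrightarrow> jet Z"
  by (simp add: mollifier_def)

lemma mollifier_bounded: "mollifier C \<epsilon> Z \<Longrightarrow> bounded (range (Z is))"
  unfolding mollifier_def
  by (intro continuous_compact_support_bounded[of _ "cbox (- (\<epsilon> *\<^sub>R One)) 0"] jet_continuous) auto

lemma mollifier_eq_0:
  assumes "mollifier C \<epsilon> Z" "y \<notin> cbox x (x + \<epsilon> *\<^sub>R One)"
  shows "Z is (x - y) = 0"
proof -
  have "x - y \<notin> cbox (- (\<epsilon> *\<^sub>R One)) 0"
    using assms(2) by (auto simp: mem_box_cart algebra_simps)
  then show ?thesis using assms(1) by (simp add: mollifier_def)
qed

lemma integrable_bounded_scaleR:
  fixes f :: "'a \<Rightarrow> 'b::euclidean_space" and g :: "'a \<Rightarrow> real"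
  assumes "integrable M f" "g \<in> borel_measurable M" "\<And>y. \<bar>g y\<bar> \<le> B"
  shows "integrable M (\<lambda>y. g y *\<^sub>R f y)"
proof (rule Bochner_Integration.integrable_bound)
  show "integrable M (\<lambda>y. B *\<^sub>R f y)" using assms by simp
  show "(\<lambda>y. g y *\<^sub>R f y) \<in> borel_measurable M" using assms by auto
  show "AE y in M. norm (g y *\<^sub>R f y) \<le> norm (B *\<^sub>R f y)"
  proof (intro AE_I2)
    fix y
    have "\<bar>g y\<bar> \<le> \<bar>B\<bar>" using assms(3)[of y] by linarith
    then show "norm (g y *\<^sub>R f y) \<le> norm (B *\<^sub>R f y)" by (simp add: mult_right_mono)
  qed
qed

lemma jet_reflect_measurable_lebesgue:
  "jet Z \<Longrightarrow> (\<lambda>y. Z is (x - y)) \<in> borel_measurable lebesgue"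
  by (rule measurable_completion) (simp add: jet_measurable measurable_compose[OF _ jet_measurable])

lemma integrable_mollifier_scaleR:
  fixes f :: "real^'n::finite \<Rightarrow> 'b::euclidean_space"
  assumes "mollifier C \<epsilon> Z" "integrable lebesgue f"
  shows "integrable lebesgue (\<lambda>y. Z is (x - y) *\<^sub>R f y)"
proof -
  obtain B where "\<And>z. norm (Z is z) \<le> B"
    using mollifier_bounded[OF assms(1), of "is"] by (auto simp: bounded_iff)
  then show ?thesis
    using assms by (intro integrable_bounded_scaleR[where B = B] jet_reflect_measurable_lebesgue) (auto simp: mollifier_jet)
qed

lemma mollifier_nn_integral:
  fixes Z :: "'n::finite list \<Rightarrow> real^'n \<Rightarrow> real"
  assumes "mollifier C \<epsilon> Z"
  shows "(\<integral>\<^sup>+y. ennreal (Z [] (x - y)) \<partial>lborel) = 1" "(\<integral>\<^sup>+z. ennreal (Z [] (z - y)) \<partial>lborel) = 1"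
proof -
  have [measurable]: "Z [] \<in> borel_measurable borel" using assms by (simp add: mollifier_def jet_measurable)
  have "(\<integral>\<^sup>+z. ennreal (Z [] z) \<partial>lborel) = 1" using assms by (simp add: mollifier_def)
  moreover have "(\<integral>\<^sup>+z. ennreal (Z [] z) \<partial>lborel) = (\<integral>\<^sup>+y. ennreal (Z [] (x - y)) \<partial>lborel)"
    by (subst nn_integral_lborel_affine[where c = "-1" and t = x]) auto
  moreover have "(\<integral>\<^sup>+z. ennreal (Z [] z) \<partial>lborel) = (\<integral>\<^sup>+z. ennreal (Z [] (z - y)) \<partial>lborel)"
    by (subst nn_integral_lborel_affine[where c = 1 and t = "- y"]) auto
  ultimately show "(\<integral>\<^sup>+y. ennreal (Z [] (x - y)) \<partial>lborel) = 1" "(\<integral>\<^sup>+z. ennreal (Z [] (z - y)) \<partial>lborel) = 1" by auto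
qed

text \<open>Total mass one moves f x under the integral; the size of the kernel then bounds the
  error by \<open>C\<close> times the average in \<open>lebesgue_point\<close>.\<close>

lemma mollifier_tendsto:
  fixes f :: "real^'n::finite \<Rightarrow> 'b::euclidean_space"
  assumes Z: "\<And>\<epsilon>. \<epsilon> > 0 \<Longrightarrow> mollifier C \<epsilon> (Z \<epsilon>)" and "C \<ge> 0"
    and f: "integrable lebesgue f" and "lebesgue_point f x"
  shows "((\<lambda>\<epsilon>. LINT y|lebesgue. Z \<epsilon> [] (x - y) *\<^sub>R f y) \<longlongrightarrow> f x) (at_right 0)"
proof -
  have "\<forall>\<^sub>F \<epsilon> in at_right 0. norm ((LINT y|lebesgue. Z \<epsilon> [] (x - y) *\<^sub>R f y) - f x) \<le>
      C * (integral (cbox x (x + \<epsilon> *\<^sub>R One)) (\<lambda>y. norm (f y - f x)) / \<epsilon> ^ CARD('n))"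
    using eventually_at_right_less[of "0 :: real"]
  proof eventually_elim
    case (elim \<epsilon>)
    let ?Q = "cbox x (x + \<epsilon> *\<^sub>R One)"
    have M: "mollifier C \<epsilon> (Z \<epsilon>)" using Z elim by blast
    have nn: "0 \<le> Z \<epsilon> [] z" "Z \<epsilon> [] z \<le> C / \<epsilon> ^ CARD('n)" for z using M by (simp_all add: mollifier_def)
    have "(\<integral>\<^sup>+y. ennreal (Z \<epsilon> [] (x - y)) \<partial>lebesgue) = ennreal 1"
      using mollifier_nn_integral(1)[OF M] by (simp add: nn_integral_completion)
    then have I1: "integrable lebesgue (\<lambda>y. Z \<epsilon> [] (x - y))" "(LINT y|lebesgue. Z \<epsilon> [] (x - y)) = 1"
      using nn_integral_eq_integrable[of "\<lambda>y. Z \<epsilon> [] (x - y)" lebesgue 1] nn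
        jet_reflect_measurable_lebesgue[OF mollifier_jet[OF M]] by simp_all
    have int1: "integrable lebesgue (\<lambda>y. Z \<epsilon> [] (x - y) *\<^sub>R f y)"
      by (rule integrable_mollifier_scaleR[OF M f])
    have int2: "integrable lebesgue (\<lambda>y. Z \<epsilon> [] (x - y) *\<^sub>R f x)"
      using I1 by simp
    have Q: "integrable lebesgue (\<lambda>y. indicator ?Q y *\<^sub>R norm (f y - f x))"
      using norm_diff_integrable_on_cbox[OF f] by (simp add: set_integrable_def)
    have "(LINT y|lebesgue. Z \<epsilon> [] (x - y) *\<^sub>R f y) - f x =
        (LINT y|lebesgue. Z \<epsilon> [] (x - y) *\<^sub>R f y - Z \<epsilon> [] (x - y) *\<^sub>R f x)"
      using int1 int2 I1 by simp
    also have "norm \<dots> \<le> (LINT y|lebesgue. (C / \<epsilon> ^ CARD('n)) * (indicator ?Q y *\<^sub>R norm (f y - f x)))"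
    proof (rule Bochner_Integration.integral_norm_bound_integral)
      fix y
      show "norm (Z \<epsilon> [] (x - y) *\<^sub>R f y - Z \<epsilon> [] (x - y) *\<^sub>R f x) \<le> (C / \<epsilon> ^ CARD('n)) * (indicator ?Q y *\<^sub>R norm (f y - f x))"
      proof (cases "y \<in> ?Q")
        case True
        then show ?thesis using nn[of "x - y"]
          by (simp add: scaleR_diff_right[symmetric] mult_right_mono del: times_divide_eq_left)
      next
        case False
        then show ?thesis using mollifier_eq_0[OF M False] by simp
      qed
    qed (use int1 int2 Q in auto)
    also have "\<dots> = (C / \<epsilon> ^ CARD('n)) * integral ?Q (\<lambda>y. norm (f y - f x))"
      using set_lebesgue_integral_eq_integral(2)[OF norm_diff_integrable_on_cbox[OF f, of x "x + \<epsilon> *\<^sub>R One" "f x"]]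
      by (simp only: integral_mult_right_zero set_lebesgue_integral_def)
    finally show ?case by simp
  qed
  moreover have "((\<lambda>\<epsilon>. C * (integral (cbox x (x + \<epsilon> *\<^sub>R One)) (\<lambda>y. norm (f y - f x)) / \<epsilon> ^ CARD('n))) \<longlongrightarrow> 0) (at_right 0)"
    using \<open>lebesgue_point f x\<close> unfolding lebesgue_point_def by (rule tendsto_mult_right_zero)
  ultimately have "((\<lambda>\<epsilon>. (LINT y|lebesgue. Z \<epsilon> [] (x - y) *\<^sub>R f y) - f x) \<longlongrightarrow> 0) (at_right 0)"
    by (rule Lim_null_comparison)
  then show ?thesis by (rule LIM_zero_cancel)
qed

section \<open>Weak derivatives\<close>

lemma test_function_mollifier:
  assumes "mollifier C \<epsilon> Z" "cbox x (x + \<epsilon> *\<^sub>R One) \<subseteq> interior S"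
  shows "test_function S (\<lambda>y. Z [] (x - y))"
  unfolding test_function_def
  by (intro conjI exI[of _ "cbox x (x + \<epsilon> *\<^sub>R One)"] allI impI compact_cbox assms(2)
      smooth_jet[OF mollifier_jet[OF assms(1)]] mollifier_eq_0[OF assms(1)])

text \<open>The sign of the reflected kernel cancels the sign in the definition of weak derivatives.
  For compact \<open>K\<close> the cut-off functions are integrable on the whole space, as
  mollification wants them, and they agree with the given ones on the support of the kernel.\<close>

lemma has_weak_deriv_mollified:
  fixes u :: "real^'n::finite \<Rightarrow> 'b::euclidean_space"
  assumes w: "has_weak_deriv S (count_list is) u g" and M: "mollifier C \<epsilon> Z"
    and K: "cbox x (x + \<epsilon> *\<^sub>R One) \<subseteq> K" "K \<subseteq> interior S"
  shows "(LINT y|lebesgue. Z is (x - y) *\<^sub>R (indicator K y *\<^sub>R u y)) =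
    (LINT y|lebesgue. Z [] (x - y) *\<^sub>R (indicator K y *\<^sub>R g y))"
proof -
  have sub: "y \<in> K \<and> y \<in> S" if "y \<in> cbox x (x + \<epsilon> *\<^sub>R One)" for y
    using that K interior_subset[of S] by blast
  have "test_function S (\<lambda>y. Z [] (x - y))"
    using test_function_mollifier[OF M] K by blast
  then have "(LINT y:S|lebesgue. partial_derivs is (\<lambda>y. Z [] (x - y)) y *\<^sub>R u y) =
      (-1) ^ mi_order (count_list is) *\<^sub>R (LINT y:S|lebesgue. Z [] (x - y) *\<^sub>R g y)"
    using w unfolding has_weak_deriv_def by blast
  moreover have "mi_order (count_list is) = length is"
    unfolding mi_order_def by (rule sum_count_set) auto
  moreover have "(LINT y:S|lebesgue. partial_derivs is (\<lambda>y. Z [] (x - y)) y *\<^sub>R u y) =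
      (LINT y|lebesgue. (-1) ^ length is *\<^sub>R (Z is (x - y) *\<^sub>R (indicator K y *\<^sub>R u y)))"
    unfolding set_lebesgue_integral_def partial_derivs_jet[OF mollifier_jet[OF M]]
  proof (rule Bochner_Integration.integral_cong)
    fix y
    show "indicator S y *\<^sub>R ((-1) ^ length is * Z is (x - y)) *\<^sub>R u y = (-1) ^ length is *\<^sub>R (Z is (x - y) *\<^sub>R (indicator K y *\<^sub>R u y))"
      using mollifier_eq_0[OF M, of y x "is"] sub[of y] by (cases "y \<in> cbox x (x + \<epsilon> *\<^sub>R One)") auto
  qed simp
  moreover have "(LINT y:S|lebesgue. Z [] (x - y) *\<^sub>R g y) = (LINT y|lebesgue. Z [] (x - y) *\<^sub>R (indicator K y *\<^sub>R g y))"
    unfolding set_lebesgue_integral_def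
  proof (rule Bochner_Integration.integral_cong)
    fix y
    show "indicator S y *\<^sub>R Z [] (x - y) *\<^sub>R g y = Z [] (x - y) *\<^sub>R (indicator K y *\<^sub>R g y)"
      using mollifier_eq_0[OF M, of y x "[]"] sub[of y] by (cases "y \<in> cbox x (x + \<epsilon> *\<^sub>R One)") auto
  qed simp
  ultimately show ?thesis by (simp del: scaleR_scaleR)
qed

lemma count_list_surj: "\<exists>is. count_list is = (\<gamma> :: 'n::finite \<Rightarrow> nat)"
proof -
  obtain "is" where "mset is = Abs_multiset \<gamma>" using ex_mset by blast
  then have "count_list is = \<gamma>" by (simp add: count_mset[symmetric] fun_eq_iff)
  then show ?thesis by blast
qed

lemma locally_integrableD:
  "locally_integrable S f \<Longrightarrow> compact K \<Longrightarrow> K \<subseteq> interior S \<Longrightarrow> integrable lebesgue (\<lambda>y. indicator K y *\<^sub>R f y)"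
  by (simp add: locally_integrable_def set_integrable_def)

text \<open>By exhausting the interior with compact sets, almost every interior point is a Lebesgue
  point of all the cut-offs of a locally integrable function.\<close>

lemma locally_integrable_AE_lebesgue_point:
  fixes f :: "real^'n::finite \<Rightarrow> 'b::euclidean_space"
  assumes "locally_integrable S f"
  shows "AE x in lebesgue. x \<in> interior S \<longrightarrow>
    (\<forall>K. compact K \<longrightarrow> K \<subseteq> interior S \<longrightarrow> x \<in> interior K \<longrightarrow> lebesgue_point (\<lambda>y. indicator K y *\<^sub>R f y) x)"
proof -
  obtain Q :: "nat \<Rightarrow> (real^'n) set" where Q: "\<And>n. compact (Q n)" "\<And>n. Q n \<subseteq> interior S"
      "\<And>n. Q n \<subseteq> interior (Q (Suc n))" "\<Union>(range Q) = interior S"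
    using open_Union_compact_subsets[OF open_interior] by metis
  have "AE x in lebesgue. \<forall>n. lebesgue_point (\<lambda>y. indicator (Q n) y *\<^sub>R f y) x"
    unfolding AE_all_countable using Q locally_integrableD[OF assms] by (intro allI AE_lebesgue_point) auto
  then show ?thesis
  proof eventually_elim
    case (elim x)
    show ?case
    proof (intro impI allI)
      fix K :: "(real^'n) set" assume x: "x \<in> interior S" and K: "compact K" "K \<subseteq> interior S" "x \<in> interior K"
      obtain n where "x \<in> Q n" using Q(4) x by auto
      then have "x \<in> interior (Q (Suc n))" using Q(3) by blast
      then have "\<forall>\<^sub>F \<epsilon> in at_right 0. cbox x (x + \<epsilon> *\<^sub>R One) \<subseteq> interior (Q (Suc n)) \<inter> interior K"
        using K by (intro eventually_cbox_subset) auto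
      \<comment> \<open>On small cubes both cut-offs are identically one, so the averages
        coincide.\<close>
      then have ev: "\<forall>\<^sub>F \<epsilon> in at_right 0.
          integral (cbox x (x + \<epsilon> *\<^sub>R One)) (\<lambda>y. norm (indicator (Q (Suc n)) y *\<^sub>R f y - indicator (Q (Suc n)) x *\<^sub>R f x)) / \<epsilon> ^ CARD('n)
          = integral (cbox x (x + \<epsilon> *\<^sub>R One)) (\<lambda>y. norm (indicator K y *\<^sub>R f y - indicator K x *\<^sub>R f x)) / \<epsilon> ^ CARD('n)"
      proof eventually_elim
        case (elim \<epsilon>)
        have "x \<in> Q (Suc n)" "x \<in> K" "y \<in> Q (Suc n) \<and> y \<in> K" if "y \<in> cbox x (x + \<epsilon> *\<^sub>R One)" for y
          using \<open>x \<in> interior (Q (Suc n))\<close> K(3) elim that interior_subset by blast+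
        then have "integral (cbox x (x + \<epsilon> *\<^sub>R One)) (\<lambda>y. norm (indicator (Q (Suc n)) y *\<^sub>R f y - indicator (Q (Suc n)) x *\<^sub>R f x))
          = integral (cbox x (x + \<epsilon> *\<^sub>R One)) (\<lambda>y. norm (indicator K y *\<^sub>R f y - indicator K x *\<^sub>R f x))"
          by (intro Henstock_Kurzweil_Integration.integral_cong) auto
        then show ?case by simp
      qed
      show "lebesgue_point (\<lambda>y. indicator K y *\<^sub>R f y) x"
        unfolding lebesgue_point_def
        by (rule Lim_transform_eventually[OF elim[THEN spec, of "Suc n", unfolded lebesgue_point_def] ev])
    qed
  qed
qed

text \<open>Mollifying u with the differentiated kernel gives the mollification of either
  derivative, and both converge at common Lebesgue points. This makes the choice in
  \<open>weak_deriv\<close> harmless.\<close>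

lemma has_weak_deriv_unique:
  fixes u :: "real^'n::finite \<Rightarrow> 'b::euclidean_space"
  assumes "has_weak_deriv S \<gamma> u g" "has_weak_deriv S \<gamma> u g'"
  shows "AE x in lebesgue. x \<in> interior S \<longrightarrow> g x = g' x"
proof -
  obtain "is" :: "'n list" where "is": "count_list is = \<gamma>" using count_list_surj by blast
  obtain C and Z :: "real \<Rightarrow> 'n list \<Rightarrow> real^'n \<Rightarrow> real" where "C \<ge> 0" and Z: "\<And>\<epsilon>. \<epsilon> > 0 \<Longrightarrow> mollifier C \<epsilon> (Z \<epsilon>)"
    using mollifier_exists by metis
  have loc: "locally_integrable S g" "locally_integrable S g'" using assms by (auto simp: has_weak_deriv_def)
  from locally_integrable_AE_lebesgue_point[OF loc(1)] locally_integrable_AE_lebesgue_point[OF loc(2)]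
  show ?thesis
  proof eventually_elim
    case (elim x)
    show ?case
    proof
      assume x: "x \<in> interior S"
      obtain r where r: "r > 0" "cball x r \<subseteq> interior S" using x open_contains_cball open_interior by blast
      have xK: "x \<in> interior (cball x r)" using r by simp
      have lp: "lebesgue_point (\<lambda>y. indicator (cball x r) y *\<^sub>R g y) x"
        "lebesgue_point (\<lambda>y. indicator (cball x r) y *\<^sub>R g' y) x"
        using elim x xK r(2) compact_cball by blast+
      note lim = mollifier_tendsto[OF Z \<open>C \<ge> 0\<close> locally_integrableD[OF loc(1) compact_cball r(2)] lp(1)]
        mollifier_tendsto[OF Z \<open>C \<ge> 0\<close> locally_integrableD[OF loc(2) compact_cball r(2)] lp(2)]
      have "\<forall>\<^sub>F \<epsilon> in at_right 0. cbox x (x + \<epsilon> *\<^sub>R One) \<subseteq> interior (cball x r)"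
        using xK by (intro eventually_cbox_subset) auto
      with eventually_at_right_less[of "0 :: real"]
      have "\<forall>\<^sub>F \<epsilon> in at_right 0. (LINT y|lebesgue. Z \<epsilon> [] (x - y) *\<^sub>R (indicator (cball x r) y *\<^sub>R g y)) =
          (LINT y|lebesgue. Z \<epsilon> [] (x - y) *\<^sub>R (indicator (cball x r) y *\<^sub>R g' y))"
      proof eventually_elim
        case (elim \<epsilon>)
        then have sub: "cbox x (x + \<epsilon> *\<^sub>R One) \<subseteq> cball x r" using interior_subset by blast
        have w: "has_weak_deriv S (count_list is) u g" "has_weak_deriv S (count_list is) u g'"
          using assms by (simp_all only: "is")
        show ?case
          by (rule trans[OF sym[OF has_weak_deriv_mollified[OF w(1) Z[OF elim(1)] sub r(2)]]
              has_weak_deriv_mollified[OF w(2) Z[OF elim(1)] sub r(2)]])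
      qed
      from tendsto_unique[OF _ Lim_transform_eventually[OF lim(1) this] lim(2)]
      show "g x = g' x" using r by simp
    qed
  qed
qed

section \<open>Test functions, and weak derivatives of sums, linear images and restrictions\<close>

lemma test_function_partial_derivs:
  assumes "test_function S \<psi>"
  obtains K where "compact K" "K \<subseteq> interior S" "\<And>is x. x \<notin> K \<Longrightarrow> partial_derivs is \<psi> x = 0"
    "\<And>is. continuous_on UNIV (partial_derivs is \<psi>)"
proof -
  obtain K where K: "compact K" "K \<subseteq> interior S" "\<And>x. x \<notin> K \<Longrightarrow> \<psi> x = 0" and "smooth \<psi>"
    using assms unfolding test_function_def by blast
  have "partial_derivs is \<psi> x = 0" if "x \<notin> K" for "is" x
    using that
  proof (induction "is" arbitrary: x)
    case Nil
    then show ?case using K by (simp add: partial_derivs_def)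
  next
    case (Cons i "is")
    have "(partial_derivs is \<psi> has_derivative (\<lambda>_. 0)) (at x)"
      by (rule has_derivative_transform_within_open[of "\<lambda>_. 0" _ _ _ "- K"])
        (use Cons K(1) in \<open>auto simp: compact_imp_closed open_Compl\<close>)
    then have "frechet_derivative (partial_derivs is \<psi>) (at x) = (\<lambda>_. 0)"
      by (metis frechet_derivative_at)
    then show ?case by (simp add: partial_derivs_def partial_deriv_def)
  qed
  moreover have "continuous_on UNIV (partial_derivs is \<psi>)" for "is"
    using \<open>smooth \<psi>\<close> by (simp add: smooth_def differentiable_imp_continuous_on)
  ultimately show thesis using that K by blast
qed

lemma set_integrable_test_function:
  fixes f :: "real^'n::finite \<Rightarrow> 'b::euclidean_space"
  assumes "test_function S \<psi>" "locally_integrable S f"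
  shows "set_integrable lebesgue S (\<lambda>x. partial_derivs is \<psi> x *\<^sub>R f x)"
proof -
  from test_function_partial_derivs[OF assms(1)] obtain K where
    K: "compact K" "K \<subseteq> interior S" "\<And>is x. x \<notin> K \<Longrightarrow> partial_derivs is \<psi> x = 0"
      and cont: "\<And>is. continuous_on UNIV (partial_derivs is \<psi>)" by metis
  obtain B where "\<And>z. norm (partial_derivs is \<psi> z) \<le> B"
    using continuous_compact_support_bounded[OF cont K(1) K(3), of "is"] by (auto simp: bounded_iff)
  then have "integrable lebesgue (\<lambda>x. partial_derivs is \<psi> x *\<^sub>R (indicator K x *\<^sub>R f x))"
    using K borel_measurable_continuous_onI[OF cont] assms(2)
    by (intro integrable_bounded_scaleR[where B = B and g = "partial_derivs is \<psi>" and f = "\<lambda>x. indicator K x *\<^sub>R f x"]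
        locally_integrableD measurable_completion) auto
  moreover have "(\<lambda>x. indicator S x *\<^sub>R partial_derivs is \<psi> x *\<^sub>R f x) = (\<lambda>x. partial_derivs is \<psi> x *\<^sub>R (indicator K x *\<^sub>R f x))"
  proof
    fix x
    show "indicator S x *\<^sub>R partial_derivs is \<psi> x *\<^sub>R f x = partial_derivs is \<psi> x *\<^sub>R (indicator K x *\<^sub>R f x)"
      using K(2,3) interior_subset[of S] by (cases "x \<in> K") auto
  qed
  ultimately show ?thesis by (simp only: set_integrable_def)
qed

lemma partial_derivs_Nil [simp]: "partial_derivs [] \<psi> = \<psi>"
  by (simp add: partial_derivs_def)

lemma locally_integrable_add:
  "locally_integrable S f \<Longrightarrow> locally_integrable S g \<Longrightarrow> locally_integrable S (\<lambda>x. f x + g x)"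
  unfolding locally_integrable_def by (auto intro: set_integral_add(1))

lemma locally_integrable_bounded_linear:
  "bounded_linear T \<Longrightarrow> locally_integrable S f \<Longrightarrow> locally_integrable S (\<lambda>x. T (f x))"
  unfolding locally_integrable_def
  by (auto intro: absolutely_integrable_linear[unfolded comp_def])

lemma has_weak_deriv_add:
  assumes "has_weak_deriv S \<gamma> f1 g1" "has_weak_deriv S \<gamma> f2 g2"
  shows "has_weak_deriv S \<gamma> (\<lambda>x. f1 x + f2 x) (\<lambda>x. g1 x + g2 x)"
proof -
  have loc: "locally_integrable S f1" "locally_integrable S f2" "locally_integrable S g1" "locally_integrable S g2"
    using assms by (auto simp: has_weak_deriv_def)
  show ?thesis
    unfolding has_weak_deriv_def
  proof (intro conjI allI impI; (elim conjE)?)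
    fix \<psi> "is" assume \<psi>: "test_function S \<psi>" and "is": "\<forall>i. count_list is i = \<gamma> i"
    have "set_integrable lebesgue S (\<lambda>x. \<psi> x *\<^sub>R g x)" if "locally_integrable S g" for g :: "real^'a \<Rightarrow> 'b"
      using set_integrable_test_function[OF \<psi> that, of "[]"] by simp
    from set_integral_add(2)[OF this[OF loc(3)] this[OF loc(4)]]
    have "(LINT x:S|lebesgue. \<psi> x *\<^sub>R (g1 x + g2 x)) = (LINT x:S|lebesgue. \<psi> x *\<^sub>R g1 x) + (LINT x:S|lebesgue. \<psi> x *\<^sub>R g2 x)"
      by (simp add: scaleR_add_right)
    moreover from set_integral_add(2)[OF set_integrable_test_function[OF \<psi> loc(1), of "is"] set_integrable_test_function[OF \<psi> loc(2), of "is"]]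
    have "(LINT x:S|lebesgue. partial_derivs is \<psi> x *\<^sub>R (f1 x + f2 x)) =
        (LINT x:S|lebesgue. partial_derivs is \<psi> x *\<^sub>R f1 x) + (LINT x:S|lebesgue. partial_derivs is \<psi> x *\<^sub>R f2 x)"
      by (simp add: scaleR_add_right)
    moreover have "(LINT x:S|lebesgue. partial_derivs is \<psi> x *\<^sub>R f1 x) = (-1) ^ mi_order \<gamma> *\<^sub>R (LINT x:S|lebesgue. \<psi> x *\<^sub>R g1 x)"
      "(LINT x:S|lebesgue. partial_derivs is \<psi> x *\<^sub>R f2 x) = (-1) ^ mi_order \<gamma> *\<^sub>R (LINT x:S|lebesgue. \<psi> x *\<^sub>R g2 x)"
      using assms \<psi> "is" unfolding has_weak_deriv_def by blast+
    ultimately show "(LINT x:S|lebesgue. partial_derivs is \<psi> x *\<^sub>R (f1 x + f2 x)) =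
        (-1) ^ mi_order \<gamma> *\<^sub>R (LINT x:S|lebesgue. \<psi> x *\<^sub>R (g1 x + g2 x))"
      by (simp add: scaleR_add_right)
  qed (use loc locally_integrable_add in auto)
qed

text \<open>Covers negation and multiplication by a fixed coefficient, also a complex one: weak
  derivatives only see the values as a real vector space.\<close>

lemma has_weak_deriv_bounded_linear:
  fixes T :: "'b::euclidean_space \<Rightarrow> 'c::euclidean_space"
  assumes "has_weak_deriv S \<gamma> f g" and T: "bounded_linear T"
  shows "has_weak_deriv S \<gamma> (\<lambda>x. T (f x)) (\<lambda>x. T (g x))"
proof -
  interpret bounded_linear T by (rule T)
  have loc: "locally_integrable S f" "locally_integrable S g"
    using assms by (auto simp: has_weak_deriv_def)
  have comm: "(LINT x:S|lebesgue. a x *\<^sub>R T (h x)) = T (LINT x:S|lebesgue. a x *\<^sub>R h x)"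
    if "set_integrable lebesgue S (\<lambda>x. a x *\<^sub>R h x)" for a :: "real^'a \<Rightarrow> real" and h
    using integral_bounded_linear[OF T that[unfolded set_integrable_def]]
    by (simp add: set_lebesgue_integral_def scaleR)
  show ?thesis
    unfolding has_weak_deriv_def
  proof (intro conjI allI impI; (elim conjE)?)
    fix \<psi> "is" assume \<psi>: "test_function S \<psi>" and "is": "\<forall>i. count_list is i = \<gamma> i"
    have "(LINT x:S|lebesgue. partial_derivs is \<psi> x *\<^sub>R f x) = (-1) ^ mi_order \<gamma> *\<^sub>R (LINT x:S|lebesgue. \<psi> x *\<^sub>R g x)"
      using assms \<psi> "is" unfolding has_weak_deriv_def by blast
    then show "(LINT x:S|lebesgue. partial_derivs is \<psi> x *\<^sub>R T (f x)) =
        (-1) ^ mi_order \<gamma> *\<^sub>R (LINT x:S|lebesgue. \<psi> x *\<^sub>R T (g x))"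
      using set_integrable_test_function[OF \<psi> loc(1), of "is"] set_integrable_test_function[OF \<psi> loc(2), of "[]"]
      by (simp add: comm scaleR)
  qed (use loc locally_integrable_bounded_linear[OF T] in auto)
qed

text \<open>A test function for T is one for S, and it vanishes outside a compact set in the
  interior of T, so the integrals over S and T agree.\<close>

lemma has_weak_deriv_subset:
  assumes "has_weak_deriv S \<gamma> f g" "T \<subseteq> S"
  shows "has_weak_deriv T \<gamma> f g"
proof -
  have int: "interior T \<subseteq> interior S" using assms by (simp add: interior_mono)
  have eq: "(LINT x:T|lebesgue. a x *\<^sub>R h x) = (LINT x:S|lebesgue. a x *\<^sub>R h x)"
    if "\<And>x. x \<notin> K \<Longrightarrow> a x = 0" "K \<subseteq> interior T" for a :: "real^'a \<Rightarrow> real" and h :: "real^'a \<Rightarrow> 'b" and K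
    unfolding set_lebesgue_integral_def
  proof (rule Bochner_Integration.integral_cong)
    fix x
    show "indicator T x *\<^sub>R a x *\<^sub>R h x = indicator S x *\<^sub>R a x *\<^sub>R h x"
      using that assms(2) interior_subset[of T] by (cases "x \<in> K") (auto simp: subset_iff)
  qed simp
  show ?thesis
    unfolding has_weak_deriv_def
  proof (intro conjI allI impI; (elim conjE)?)
    fix \<psi> "is" assume \<psi>: "test_function T \<psi>" and "is": "\<forall>i. count_list is i = \<gamma> i"
    then have "test_function S \<psi>" using int unfolding test_function_def by blast
    then have "(LINT x:S|lebesgue. partial_derivs is \<psi> x *\<^sub>R f x) = (-1) ^ mi_order \<gamma> *\<^sub>R (LINT x:S|lebesgue. \<psi> x *\<^sub>R g x)"
      using assms "is" unfolding has_weak_deriv_def by blast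
    moreover from test_function_partial_derivs[OF \<psi>] obtain K where
      K: "compact K" "K \<subseteq> interior T" "\<And>is x. x \<notin> K \<Longrightarrow> partial_derivs is \<psi> x = 0" by metis
    moreover have "\<psi> x = 0" if "x \<notin> K" for x using K(3)[OF that, of "[]"] by simp
    ultimately show "(LINT x:T|lebesgue. partial_derivs is \<psi> x *\<^sub>R f x) =
        (-1) ^ mi_order \<gamma> *\<^sub>R (LINT x:T|lebesgue. \<psi> x *\<^sub>R g x)"
      using eq[where a = "partial_derivs is \<psi>" and h = f, OF K(3) K(2)] eq[where a = \<psi> and h = g, OF _ K(2)] by simp
  qed (use assms int in \<open>auto simp: has_weak_deriv_def locally_integrable_def\<close>)
qed

section \<open>Lebesgue norms of weak derivatives\<close>

text \<open>The p-th power of the norm, as an extended nonnegative integral over the whole space: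
  estimates for it carry no finiteness conditions, and p-th roots are taken only at the end.\<close>

definition powr_integral :: "real \<Rightarrow> (real^'n::finite) set \<Rightarrow> (real^'n \<Rightarrow> 'b::real_normed_vector) \<Rightarrow> ennreal" where
  "powr_integral p S g = (\<integral>\<^sup>+x. ennreal (norm (g x) powr p) * indicator S x \<partial>lebesgue)"

text \<open>The set differs from its open interior by a part of the frontier, which is negligible
  for a convex set. The same fact lets \<open>S\<close> and \<open>interior S\<close> be exchanged
  in integrals.\<close>

lemma convex_sets_lebesgue: "convex (S :: (real^'n::finite) set) \<Longrightarrow> S \<in> sets lebesgue"
proof -
  assume "convex S"
  then have "negligible (frontier S)" by (rule negligible_convex_frontier)
  then have "negligible (S - interior S)" 
    by (rule negligible_subset) (use closure_subset[of S] in \<open>auto simp: frontier_def\<close>)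
  then have "(S - interior S) \<union> interior S \<in> sets lebesgue"
    by (intro sets.Un) (auto simp: negligible_imp_sets)
  then show ?thesis using interior_subset[of S] by (simp add: Un_absorb2 Un_commute)
qed

lemma convex_AE_interior:
  assumes "convex (S :: (real^'n::finite) set)" shows "AE x in lebesgue. x \<in> S \<longrightarrow> x \<in> interior S"
proof -
  have "frontier S \<in> null_sets lebesgue"
    using negligible_convex_frontier[OF assms] by (simp add: negligible_iff_null_sets)
  then show ?thesis
    by (rule AE_I') (use closure_subset[of S] in \<open>auto simp: frontier_def\<close>)
qed

lemma powr_integral_cong:
  assumes "convex S" "AE x in lebesgue. x \<in> interior S \<longrightarrow> f x = g x"
  shows "powr_integral p S f = powr_integral p S g"
  unfolding powr_integral_def
proof (rule nn_integral_cong_AE)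
  show "AE x in lebesgue. ennreal (norm (f x) powr p) * indicator S x = ennreal (norm (g x) powr p) * indicator S x"
    using assms(2) convex_AE_interior[OF assms(1)]
    by eventually_elim (auto simp: indicator_def)
qed

lemma eLp_norm_eq_powr_integral:
  assumes "S \<in> sets lebesgue" "0 < p"
  shows "eLp_norm (ennreal p) S g =
    (if powr_integral p S g = \<infinity> then \<infinity> else ennreal (enn2real (powr_integral p S g) powr (1 / p)))"
proof -
  have "ennreal p \<noteq> \<infinity>" by simp
  moreover have "(\<integral>\<^sup>+x. ennreal (norm (g x) powr p) \<partial>lebesgue_on S) = powr_integral p S g"
    unfolding powr_integral_def using assms(1) by (subst nn_integral_restrict_space) auto
  ultimately show ?thesis using assms(2) by (simp add: eLp_norm_def Let_def)
qed

text \<open>The choice in \<open>weak_deriv\<close> does not look at integrability. Measurability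
  and the finite integral are inherited from the witness in the definition of the Sobolev space,
  with which the chosen derivative agrees almost everywhere.\<close>

lemma sobolev_weak_deriv:
  assumes f: "f \<in> sobolev_space k p S" and S: "convex S" and p: "1 \<le> p" and \<gamma>: "mi_order \<gamma> \<le> k"
  shows "has_weak_deriv S \<gamma> f (weak_deriv S \<gamma> f)" "powr_integral p S (weak_deriv S \<gamma> f) < \<infinity>"
    "weak_deriv S \<gamma> f \<in> borel_measurable (lebesgue_on S)"
proof -
  obtain g where g: "has_weak_deriv S \<gamma> f g" "g \<in> Lp_space (ennreal p) S"
    using f \<gamma> unfolding sobolev_space_def by blast
  show w: "has_weak_deriv S \<gamma> f (weak_deriv S \<gamma> f)"
    unfolding weak_deriv_def by (rule someI[of "has_weak_deriv S \<gamma> f", OF g(1)])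
  have ae: "AE x in lebesgue. x \<in> interior S \<longrightarrow> weak_deriv S \<gamma> f x = g x"
    by (rule has_weak_deriv_unique[OF w g(1)])
  have "powr_integral p S g < \<infinity>"
    using g(2) p convex_sets_lebesgue[OF S]
    by (auto simp: Lp_space_def eLp_norm_eq_powr_integral less_top[symmetric] split: if_splits)
  then show "powr_integral p S (weak_deriv S \<gamma> f) < \<infinity>"
    using powr_integral_cong[OF S ae] by simp
  have "(\<lambda>x. if x \<in> S then g x else 0) \<in> borel_measurable lebesgue"
    using g(2) convex_sets_lebesgue[OF S] by (simp add: Lp_space_def borel_measurable_if)
  moreover have "AE x in lebesgue. (if x \<in> S then g x else 0) = (if x \<in> S then weak_deriv S \<gamma> f x else 0)"
    using ae convex_AE_interior[OF S] by eventually_elim auto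
  ultimately have "(\<lambda>x. if x \<in> S then weak_deriv S \<gamma> f x else 0) \<in> borel_measurable lebesgue"
    by (rule borel_measurable_AE)
  then show "weak_deriv S \<gamma> f \<in> borel_measurable (lebesgue_on S)"
    by (rule borel_measurable_if_D)
qed

definition sobolev_integral :: "nat \<Rightarrow> real \<Rightarrow> (real^'n::finite) set \<Rightarrow> (real^'n \<Rightarrow> 'b::euclidean_space) \<Rightarrow> ennreal" where
  "sobolev_integral k p S f = (\<Sum>\<gamma> | mi_order \<gamma> = k. powr_integral p S (weak_deriv S \<gamma> f))"

lemma finite_mi_order [simp]: "finite {\<gamma> :: 'n::finite \<Rightarrow> nat. mi_order \<gamma> = k}"
proof (rule finite_subset)
  show "{\<gamma> :: 'n \<Rightarrow> nat. mi_order \<gamma> = k} \<subseteq> (\<Pi>\<^sub>E i\<in>UNIV. {..k})"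
    by (auto simp: mi_order_def intro: member_le_sum)
qed (intro finite_PiE; simp)

lemma sobolev_seminorm_eq:
  assumes f: "f \<in> sobolev_space k p S" and S: "convex S" and p: "1 \<le> p"
  shows "sobolev_integral k p S f < \<infinity>"
    "sobolev_seminorm k p S f = enn2real (sobolev_integral k p S f) powr (1 / p)"
proof -
  have fin: "powr_integral p S (weak_deriv S \<gamma> f) < \<infinity>" if "mi_order \<gamma> = k" for \<gamma>
    using sobolev_weak_deriv(2)[OF f S p] that by simp
  then show "sobolev_integral k p S f < \<infinity>"
    by (simp add: sobolev_integral_def)
  have "enn2real (eLp_norm (ennreal p) S (weak_deriv S \<gamma> f)) powr p = enn2real (powr_integral p S (weak_deriv S \<gamma> f))"
    if "mi_order \<gamma> = k" for \<gamma>
    using fin[OF that] p convex_sets_lebesgue[OF S]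
    by (simp add: eLp_norm_eq_powr_integral less_top[symmetric] powr_powr)
  then have "(\<Sum>\<gamma> | mi_order \<gamma> = k. enn2real (eLp_norm (ennreal p) S (weak_deriv S \<gamma> f)) powr p) = enn2real (sobolev_integral k p S f)"
    using fin unfolding sobolev_integral_def by (subst enn2real_sum) (auto intro!: sum.cong)
  then show "sobolev_seminorm k p S f = enn2real (sobolev_integral k p S f) powr (1 / p)"
    by (simp add: sobolev_seminorm_def)
qed

text \<open>Allows the seminorm to be computed from any convenient family of weak derivatives in
  place of the chosen ones.\<close>

lemma sobolev_spaceI:
  assumes S: "convex S" and p: "1 \<le> p"
    and G: "\<And>\<gamma>. mi_order \<gamma> \<le> k \<Longrightarrow> has_weak_deriv S \<gamma> f (G \<gamma>)" "\<And>\<gamma>. mi_order \<gamma> \<le> k \<Longrightarrow> powr_integral p S (G \<gamma>) < \<infinity>"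
      "\<And>\<gamma>. mi_order \<gamma> \<le> k \<Longrightarrow> G \<gamma> \<in> borel_measurable (lebesgue_on S)"
  shows "f \<in> sobolev_space k p S" "sobolev_integral k p S f = (\<Sum>\<gamma> | mi_order \<gamma> = k. powr_integral p S (G \<gamma>))"
proof -
  have "G \<gamma> \<in> Lp_space (ennreal p) S" if "mi_order \<gamma> \<le> k" for \<gamma>
    using G[OF that] p convex_sets_lebesgue[OF S] by (simp add: Lp_space_def eLp_norm_eq_powr_integral)
  then show f: "f \<in> sobolev_space k p S" using G(1) unfolding sobolev_space_def by blast
  have "powr_integral p S (weak_deriv S \<gamma> f) = powr_integral p S (G \<gamma>)" if "mi_order \<gamma> = k" for \<gamma>
    using that G(1) sobolev_weak_deriv(1)[OF f S p] by (intro powr_integral_cong[OF S] has_weak_deriv_unique) auto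
  then show "sobolev_integral k p S f = (\<Sum>\<gamma> | mi_order \<gamma> = k. powr_integral p S (G \<gamma>))"
    by (simp add: sobolev_integral_def)
qed

lemma powr_integral_subset: "T \<subseteq> S \<Longrightarrow> powr_integral p T g \<le> powr_integral p S g"
  unfolding powr_integral_def by (intro nn_integral_mono) (auto simp: indicator_def)

lemma sobolev_subset:
  assumes f: "f \<in> sobolev_space k p S" and S: "convex S" "convex T" "T \<subseteq> S" and p: "1 \<le> p"
  shows "f \<in> sobolev_space k p T" "sobolev_integral k p T f \<le> sobolev_integral k p S f"
proof -
  note W = sobolev_weak_deriv[OF f S(1) p]
  have *: "has_weak_deriv T \<gamma> f (weak_deriv S \<gamma> f)" "powr_integral p T (weak_deriv S \<gamma> f) < \<infinity>"
    "weak_deriv S \<gamma> f \<in> borel_measurable (lebesgue_on T)" if "mi_order \<gamma> \<le> k" for \<gamma>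
    using W[OF that] S(3) has_weak_deriv_subset powr_integral_subset[OF S(3), of p "weak_deriv S \<gamma> f"] measurable_restrict_mono
    by (blast intro: le_less_trans)+
  show "f \<in> sobolev_space k p T" using sobolev_spaceI(1)[OF S(2) p *] .
  have "sobolev_integral k p T f = (\<Sum>\<gamma> | mi_order \<gamma> = k. powr_integral p T (weak_deriv S \<gamma> f))"
    using sobolev_spaceI(2)[OF S(2) p *] .
  also have "\<dots> \<le> sobolev_integral k p S f"
    unfolding sobolev_integral_def by (intro sum_mono powr_integral_subset S)
  finally show "sobolev_integral k p T f \<le> sobolev_integral k p S f" .
qed

text \<open>Takes the place of Minkowski's inequality; the lost factors are constants and go into
  \<open>C\<close> or \<open>C\<^sub>W\<close>.\<close>

lemma powr_add_le:
  fixes a b p :: real assumes "0 \<le> a" "0 \<le> b" "0 \<le> p"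
  shows "(a + b) powr p \<le> 2 powr p * (a powr p + b powr p)"
proof -
  have "(a + b) powr p \<le> (2 * max a b) powr p" using assms by (intro powr_mono2) auto
  also have "\<dots> = 2 powr p * max a b powr p" using assms by (intro powr_mult)
  also have "max a b powr p \<le> a powr p + b powr p" by (simp add: max_def)
  finally show ?thesis by simp
qed

lemma powr_integral_indicator:
  "0 < p \<Longrightarrow> powr_integral p S f = (\<integral>\<^sup>+x. ennreal (norm (if x \<in> S then f x else 0) powr p) \<partial>lebesgue)"
  unfolding powr_integral_def by (intro nn_integral_cong) (auto simp: indicator_def)

lemma powr_integral_add_le:
  fixes f g :: "real^'n::finite \<Rightarrow> 'b::euclidean_space"
  assumes "S \<in> sets lebesgue" "0 < p" and fg: "f \<in> borel_measurable (lebesgue_on S)" "g \<in> borel_measurable (lebesgue_on S)"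
  shows "powr_integral p S (\<lambda>x. f x + g x) \<le> ennreal (2 powr p) * (powr_integral p S f + powr_integral p S g)"
proof -
  let ?f = "\<lambda>x. if x \<in> S then f x else 0" and ?g = "\<lambda>x. if x \<in> S then g x else 0"
  have [measurable]: "?f \<in> borel_measurable lebesgue" "?g \<in> borel_measurable lebesgue"
    using fg assms(1) by (auto intro: borel_measurable_if_I)
  have "powr_integral p S (\<lambda>x. f x + g x) \<le>
      (\<integral>\<^sup>+x. ennreal (2 powr p) * (ennreal (norm (?f x) powr p) + ennreal (norm (?g x) powr p)) \<partial>lebesgue)"
    unfolding powr_integral_indicator[OF assms(2)]
  proof (rule nn_integral_mono)
    fix x
    have "norm (?f x + ?g x) powr p \<le> (norm (?f x) + norm (?g x)) powr p"
      using assms(2) by (intro powr_mono2 norm_triangle_ineq) auto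
    also have "\<dots> \<le> 2 powr p * (norm (?f x) powr p + norm (?g x) powr p)"
      using assms(2) by (intro powr_add_le) auto
    finally show "ennreal (norm (if x \<in> S then f x + g x else 0) powr p) \<le>
        ennreal (2 powr p) * (ennreal (norm (?f x) powr p) + ennreal (norm (?g x) powr p))"
      by (auto simp: ennreal_mult[symmetric] ennreal_plus[symmetric] simp del: ennreal_plus intro!: ennreal_leI split: if_splits)
  qed
  also have "\<dots> = ennreal (2 powr p) * (powr_integral p S f + powr_integral p S g)"
    unfolding powr_integral_indicator[OF assms(2)] by (subst nn_integral_cmult) (auto simp: nn_integral_add)
  finally show ?thesis .
qed

lemma sobolev_add:
  assumes f: "f \<in> sobolev_space k p S" "g \<in> sobolev_space k p S" and S: "convex S" and p: "1 \<le> p"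
  shows "(\<lambda>x. f x + g x) \<in> sobolev_space k p S"
    "sobolev_integral k p S (\<lambda>x. f x + g x) \<le> ennreal (2 powr p) * (sobolev_integral k p S f + sobolev_integral k p S g)"
proof -
  note W = sobolev_weak_deriv[OF f(1) S p] sobolev_weak_deriv[OF f(2) S p]
  let ?G = "\<lambda>\<gamma> x. weak_deriv S \<gamma> f x + weak_deriv S \<gamma> g x"
  have le: "powr_integral p S (?G \<gamma>) \<le> ennreal (2 powr p) * (powr_integral p S (weak_deriv S \<gamma> f) + powr_integral p S (weak_deriv S \<gamma> g))"
    if "mi_order \<gamma> \<le> k" for \<gamma>
    using W[OF that] p convex_sets_lebesgue[OF S] by (intro powr_integral_add_le) auto
  have *: "has_weak_deriv S \<gamma> (\<lambda>x. f x + g x) (?G \<gamma>)" "powr_integral p S (?G \<gamma>) < \<infinity>"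
    "?G \<gamma> \<in> borel_measurable (lebesgue_on S)" if "mi_order \<gamma> \<le> k" for \<gamma>
    using W[OF that] le[OF that]
    by (auto intro: has_weak_deriv_add le_less_trans simp: ennreal_mult_less_top)
  show "(\<lambda>x. f x + g x) \<in> sobolev_space k p S" using sobolev_spaceI(1)[OF S p *] .
  have "sobolev_integral k p S (\<lambda>x. f x + g x) = (\<Sum>\<gamma> | mi_order \<gamma> = k. powr_integral p S (?G \<gamma>))"
    using sobolev_spaceI(2)[OF S p *] .
  also have "\<dots> \<le> (\<Sum>\<gamma> | mi_order \<gamma> = k. ennreal (2 powr p) * (powr_integral p S (weak_deriv S \<gamma> f) + powr_integral p S (weak_deriv S \<gamma> g)))"
    using le by (intro sum_mono) auto
  finally show "sobolev_integral k p S (\<lambda>x. f x + g x) \<le> ennreal (2 powr p) * (sobolev_integral k p S f + sobolev_integral k p S g)"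
    by (simp only: sobolev_integral_def sum_distrib_left sum.distrib distrib_left)
qed

lemma sobolev_bounded_linear:
  fixes T :: "'b::euclidean_space \<Rightarrow> 'b"
  assumes f: "f \<in> sobolev_space k p S" and S: "convex S" and p: "1 \<le> p" and T: "bounded_linear T" and K: "\<And>v. norm (T v) \<le> K * norm v"
  shows "(\<lambda>x. T (f x)) \<in> sobolev_space k p S"
    "sobolev_integral k p S (\<lambda>x. T (f x)) \<le> ennreal (K powr p) * sobolev_integral k p S f"
proof -
  note W = sobolev_weak_deriv[OF f S p]
  let ?G = "\<lambda>\<gamma> x. T (weak_deriv S \<gamma> f x)"
  obtain b :: 'b where "b \<in> Basis" by (meson nonempty_Basis all_not_in_conv)
  then have "0 \<le> K" using order_trans[OF norm_ge_zero K[of b]] by simp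
  have le: "powr_integral p S (?G \<gamma>) \<le> ennreal (K powr p) * powr_integral p S (weak_deriv S \<gamma> f)"
    if "mi_order \<gamma> \<le> k" for \<gamma>
  proof -
    have [measurable]: "(\<lambda>x. if x \<in> S then weak_deriv S \<gamma> f x else 0) \<in> borel_measurable lebesgue"
      using W[OF that] convex_sets_lebesgue[OF S] by (intro borel_measurable_if_I)
    have "powr_integral p S (?G \<gamma>) \<le> (\<integral>\<^sup>+x. ennreal (K powr p) * ennreal (norm (if x \<in> S then weak_deriv S \<gamma> f x else 0) powr p) \<partial>lebesgue)"
      unfolding powr_integral_def
    proof (rule nn_integral_mono)
      fix x
      have "norm (T (weak_deriv S \<gamma> f x)) powr p \<le> (K * norm (weak_deriv S \<gamma> f x)) powr p"
        using p K by (intro powr_mono2) auto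
      then show "ennreal (norm (T (weak_deriv S \<gamma> f x)) powr p) * indicator S x \<le>
          ennreal (K powr p) * ennreal (norm (if x \<in> S then weak_deriv S \<gamma> f x else 0) powr p)"
        using \<open>0 \<le> K\<close> by (auto simp: powr_mult ennreal_mult[symmetric] indicator_def intro!: ennreal_leI)
    qed
    then show ?thesis using p by (simp add: nn_integral_cmult powr_integral_indicator)
  qed
  have *: "has_weak_deriv S \<gamma> (\<lambda>x. T (f x)) (?G \<gamma>)" "powr_integral p S (?G \<gamma>) < \<infinity>"
    "?G \<gamma> \<in> borel_measurable (lebesgue_on S)" if "mi_order \<gamma> \<le> k" for \<gamma>
    using W[OF that] le[OF that] has_weak_deriv_bounded_linear[OF _ T]
      measurable_compose[OF _ borel_measurable_continuous_onI[OF linear_continuous_on[OF T]]]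
    by (auto intro: le_less_trans simp: ennreal_mult_less_top)
  show "(\<lambda>x. T (f x)) \<in> sobolev_space k p S" using sobolev_spaceI(1)[OF S p *] .
  have "sobolev_integral k p S (\<lambda>x. T (f x)) = (\<Sum>\<gamma> | mi_order \<gamma> = k. powr_integral p S (?G \<gamma>))"
    using sobolev_spaceI(2)[OF S p *] .
  also have "\<dots> \<le> (\<Sum>\<gamma> | mi_order \<gamma> = k. ennreal (K powr p) * powr_integral p S (weak_deriv S \<gamma> f))"
    using le by (intro sum_mono) auto
  finally show "sobolev_integral k p S (\<lambda>x. T (f x)) \<le> ennreal (K powr p) * sobolev_integral k p S f"
    by (simp add: sobolev_integral_def sum_distrib_left)
qed

section \<open>The pointwise estimate\<close>

text \<open>The substitution y = c + \<delta> z multiplies derivatives of order m by \<delta>^m, and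
  the integral of the p-th powers of the derivatives of order k by \<delta>^(k p - d); the p-th root
  of the latter is the power with exponent k - d/p.\<close>

lemma jet_scaled_estimate:
  fixes p :: real
  assumes "1 \<le> p" "m < k"
    and "p > 1 \<Longrightarrow> real k > real m + real CARD('n::finite) / p" and "p = 1 \<Longrightarrow> k \<ge> m + CARD('n)"
  shows "\<exists>\<epsilon>>0. \<epsilon> \<le> 1 / 4 \<and> (\<forall>R. \<exists>C\<ge>0. \<forall>(U :: 'n list \<Rightarrow> real^'n \<Rightarrow> 'b::euclidean_space) V x c \<delta> \<zeta> M I is.
     jet U \<longrightarrow> convex V \<longrightarrow> closed V \<longrightarrow> 0 < \<delta> \<longrightarrow> cball c (\<delta> * \<epsilon>) \<subseteq> V \<longrightarrow> x \<in> V \<longrightarrow> \<delta> \<le> norm (x - c) \<longrightarrow> norm (x - c) \<le> R * \<delta> \<longrightarrow>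
     (\<forall>z\<in>grid k. \<zeta> z \<in> V \<and> norm (\<zeta> z - (c + \<delta> *\<^sub>R z)) \<le> \<delta> * \<epsilon> \<and> norm (U [] (\<zeta> z)) \<le> M) \<longrightarrow> length is = m \<longrightarrow>
     (\<integral>\<^sup>+z. ennreal ((\<Sum>js | length js = k. norm (U js z)) powr p) * indicator V z \<partial>lborel) \<le> ennreal I \<longrightarrow> 0 \<le> I \<longrightarrow>
     \<delta> ^ m * norm (U is x) \<le> C * (M + \<delta> powr (real k - real CARD('n) / p) * I powr (1 / p)))"
proof -
  define Q where "Q \<epsilon> R C \<longleftrightarrow> (\<forall>(U :: 'n list \<Rightarrow> real^'n \<Rightarrow> 'b) V x \<zeta> M I is.
     jet U \<longrightarrow> convex V \<longrightarrow> V \<in> sets borel \<longrightarrow> ball 0 \<epsilon> \<subseteq> V \<longrightarrow> x \<in> V \<longrightarrow> 1 \<le> norm x \<longrightarrow> norm x \<le> R \<longrightarrow>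
     (\<forall>z\<in>grid k. \<zeta> z \<in> V \<and> norm (\<zeta> z - z) \<le> \<epsilon> \<and> norm (U [] (\<zeta> z)) \<le> M) \<longrightarrow> length is = m \<longrightarrow>
     (\<integral>\<^sup>+z. ennreal ((\<Sum>js | length js = k. norm (U js z)) powr p) * indicator V z \<partial>lborel) \<le> ennreal I \<longrightarrow> 0 \<le> I \<longrightarrow>
     norm (U is x) \<le> C * (M + I powr (1 / p)))" for \<epsilon> R C :: real
  have "\<exists>\<epsilon>>0. \<epsilon> \<le> 1 / 4 \<and> (\<forall>R. \<exists>C\<ge>0. Q \<epsilon> R C)"
    unfolding Q_def by (rule jet_unit_scale_estimate[OF assms(1-4)])
  then obtain \<epsilon> where "\<epsilon> > 0" "\<epsilon> \<le> 1 / 4" and Q: "\<And>R. \<exists>C\<ge>0. Q \<epsilon> R C" by blast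
  have "\<delta> ^ m * norm (U is x) \<le> C * (M + \<delta> powr (real k - real CARD('n) / p) * I powr (1 / p))"
    if "Q \<epsilon> R C" and U: "jet U" and V: "convex V" "closed V" "cball c (\<delta> * \<epsilon>) \<subseteq> V" "x \<in> V" and "0 < \<delta>"
      and x: "\<delta> \<le> norm (x - c)" "norm (x - c) \<le> R * \<delta>"
      and \<zeta>: "\<forall>z\<in>grid k. \<zeta> z \<in> V \<and> norm (\<zeta> z - (c + \<delta> *\<^sub>R z)) \<le> \<delta> * \<epsilon> \<and> norm (U [] (\<zeta> z)) \<le> M" and len: "length is = m"
      and I: "(\<integral>\<^sup>+z. ennreal ((\<Sum>js | length js = k. norm (U js z)) powr p) * indicator V z \<partial>lborel) \<le> ennreal I" "0 \<le> I"
    for R C and U :: "'n list \<Rightarrow> real^'n \<Rightarrow> 'b" and V x c \<delta> \<zeta> M I "is"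
  proof -
    define U' where "U' = (\<lambda>is x. (1 * \<delta> ^ length is) *\<^sub>R U is (c + \<delta> *\<^sub>R x))"
    define s where "s y = (1 / \<delta>) *\<^sub>R (y - c)" for y
    have cs: "c + \<delta> *\<^sub>R s y = y" for y using \<open>0 < \<delta>\<close> by (simp add: s_def)
    have sc: "s (c + \<delta> *\<^sub>R y) = y" for y using \<open>0 < \<delta>\<close> by (simp add: s_def)
    have norm_s: "norm (s y - z) = norm (y - (c + \<delta> *\<^sub>R z)) / \<delta>" for y z
    proof -
      have "s y - z = (1 / \<delta>) *\<^sub>R (y - (c + \<delta> *\<^sub>R z))" using \<open>0 < \<delta>\<close> by (simp add: s_def algebra_simps)
      then show ?thesis using \<open>0 < \<delta>\<close> by simp
    qed
    define V' where "V' = s ` V"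
    have V'_iff: "y \<in> V' \<longleftrightarrow> c + \<delta> *\<^sub>R y \<in> V" for y
      unfolding V'_def using cs sc by (metis imageE imageI)
    then have V': "V' = (\<lambda>y. c + \<delta> *\<^sub>R y) -` V" by auto
    have "U' = (\<lambda>is x. (1 * \<delta> ^ length is) *\<^sub>R U is (c + \<delta> *\<^sub>R x))" by (simp add: U'_def)
    then have 1: "jet U'" using jet_affine[OF U, of 1 \<delta> c] by simp
    have 2: "convex V'"
    proof -
      have "V' = (\<lambda>y. (1 / \<delta>) *\<^sub>R y) ` ((\<lambda>y. - c + y) ` V)" by (auto simp: V'_def s_def image_image)
      then show ?thesis using V by (simp add: convex_scaling convex_translation)
    qed
    have "closed V'" unfolding V' using V by (intro closed_vimage) (auto intro!: continuous_intros)
    then have 3: "V' \<in> sets borel" by simp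
    have 4: "ball 0 \<epsilon> \<subseteq> V'"
    proof
      fix y :: "real^'n" assume "y \<in> ball 0 \<epsilon>"
      then have "c + \<delta> *\<^sub>R y \<in> cball c (\<delta> * \<epsilon>)" using \<open>0 < \<delta>\<close> by (simp add: dist_norm)
      then show "y \<in> V'" using V V'_iff by blast
    qed
    have 5: "s x \<in> V'" "1 \<le> norm (s x)" "norm (s x) \<le> R"
      using V x \<open>0 < \<delta>\<close> norm_s[of x 0] by (auto simp: V'_def pos_le_divide_eq pos_divide_le_eq)
    have 6: "\<forall>z\<in>grid k. s (\<zeta> z) \<in> V' \<and> norm (s (\<zeta> z) - z) \<le> \<epsilon> \<and> norm (U' [] (s (\<zeta> z))) \<le> M"
      using \<zeta> \<open>0 < \<delta>\<close> by (auto simp: V'_def norm_s U'_def cs field_simps)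
    have [measurable]: "U js \<in> borel_measurable borel" for js by (rule jet_measurable[OF U])
    have [measurable]: "V \<in> sets borel" using V by simp
    let ?H = "\<lambda>z. ennreal ((\<Sum>js | length js = k. norm (U js z)) powr p) * indicator V z"
    define I' where "I' = (\<delta> powr (real k * p - real CARD('n))) * I"
    have "(\<integral>\<^sup>+z. ennreal ((\<Sum>js | length js = k. norm (U' js z)) powr p) * indicator V' z \<partial>lborel) =
        (\<integral>\<^sup>+z. ennreal (\<delta> powr (real k * p)) * ?H (c + \<delta> *\<^sub>R z) \<partial>lborel)"
    proof (rule nn_integral_cong)
      fix z
      have "(\<Sum>js | length js = k. norm (U' js z)) = \<delta> ^ k * (\<Sum>js | length js = k. norm (U js (c + \<delta> *\<^sub>R z)))"
        using \<open>0 < \<delta>\<close> by (simp add: U'_def sum_distrib_left)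
      then have "(\<Sum>js | length js = k. norm (U' js z)) powr p = \<delta> powr (real k * p) * (\<Sum>js | length js = k. norm (U js (c + \<delta> *\<^sub>R z))) powr p"
        using \<open>0 < \<delta>\<close> by (simp add: powr_mult sum_nonneg powr_realpow[symmetric] powr_powr)
      then show "ennreal ((\<Sum>js | length js = k. norm (U' js z)) powr p) * indicator V' z = ennreal (\<delta> powr (real k * p)) * ?H (c + \<delta> *\<^sub>R z)"
        using V'_iff[of z] by (simp add: ennreal_mult indicator_def)
    qed
    also have "\<dots> = ennreal (\<delta> powr (real k * p)) * (\<integral>\<^sup>+z. ?H (c + \<delta> *\<^sub>R z) \<partial>lborel)"
      by (intro nn_integral_cmult) measurable
    also have "(\<integral>\<^sup>+z. ?H (c + \<delta> *\<^sub>R z) \<partial>lborel) = ennreal (\<delta> powr (- real CARD('n))) * (\<integral>\<^sup>+z. ?H z \<partial>lborel)"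
    proof -
      have "(\<integral>\<^sup>+z. ?H z \<partial>lborel) = ennreal (\<delta> ^ CARD('n)) * (\<integral>\<^sup>+z. ?H (c + \<delta> *\<^sub>R z) \<partial>lborel)"
        using nn_integral_lborel_affine[of ?H \<delta> c] \<open>0 < \<delta>\<close> by simp
      moreover have "ennreal (\<delta> powr (- real CARD('n))) * ennreal (\<delta> ^ CARD('n)) = 1"
        using \<open>0 < \<delta>\<close> by (simp add: ennreal_mult[symmetric] powr_realpow[symmetric] powr_add[symmetric])
      ultimately show ?thesis by (simp add: mult.assoc[symmetric])
    qed
    also have "ennreal (\<delta> powr (real k * p)) * (ennreal (\<delta> powr (- real CARD('n))) * (\<integral>\<^sup>+z. ?H z \<partial>lborel))
        \<le> ennreal (\<delta> powr (real k * p)) * (ennreal (\<delta> powr (- real CARD('n))) * ennreal I)"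
      using I by (intro mult_left_mono) auto
    also have "\<dots> = ennreal I'"
      using I by (simp add: I'_def ennreal_mult[symmetric] powr_diff powr_minus_divide)
    finally have 7: "(\<integral>\<^sup>+z. ennreal ((\<Sum>js | length js = k. norm (U' js z)) powr p) * indicator V' z \<partial>lborel) \<le> ennreal I'" .
    have "norm (U' is (s x)) \<le> C * (M + I' powr (1 / p))"
      using \<open>Q \<epsilon> R C\<close>[unfolded Q_def, rule_format, OF 1 2 3 4 5 6[rule_format] len 7] I by (simp add: I'_def)
    moreover have "norm (U' is (s x)) = \<delta> ^ m * norm (U is x)"
      using \<open>0 < \<delta>\<close> len by (simp add: U'_def cs)
    moreover have "I' powr (1 / p) = \<delta> powr (real k - real CARD('n) / p) * I powr (1 / p)"
    proof -
      have "(real k * p - real CARD('n)) / p = real k - real CARD('n) / p"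
        using \<open>1 \<le> p\<close> by (simp add: field_simps)
      then show ?thesis using I \<open>0 < \<delta>\<close> by (simp add: I'_def powr_mult powr_powr)
    qed
    ultimately show ?thesis by simp
  qed
  note est = this
  have "\<exists>C\<ge>0. \<forall>(U :: 'n list \<Rightarrow> real^'n \<Rightarrow> 'b) V x c \<delta> \<zeta> M I is.
     jet U \<longrightarrow> convex V \<longrightarrow> closed V \<longrightarrow> 0 < \<delta> \<longrightarrow> cball c (\<delta> * \<epsilon>) \<subseteq> V \<longrightarrow> x \<in> V \<longrightarrow> \<delta> \<le> norm (x - c) \<longrightarrow> norm (x - c) \<le> R * \<delta> \<longrightarrow>
     (\<forall>z\<in>grid k. \<zeta> z \<in> V \<and> norm (\<zeta> z - (c + \<delta> *\<^sub>R z)) \<le> \<delta> * \<epsilon> \<and> norm (U [] (\<zeta> z)) \<le> M) \<longrightarrow> length is = m \<longrightarrow>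
     (\<integral>\<^sup>+z. ennreal ((\<Sum>js | length js = k. norm (U js z)) powr p) * indicator V z \<partial>lborel) \<le> ennreal I \<longrightarrow> 0 \<le> I \<longrightarrow>
     \<delta> ^ m * norm (U is x) \<le> C * (M + \<delta> powr (real k - real CARD('n) / p) * I powr (1 / p))" for R
  proof -
    obtain C where "C \<ge> 0" "Q \<epsilon> R C" using Q[of R] by (elim exE conjE)
    show ?thesis
      by (intro exI[of _ C] conjI allI impI \<open>C \<ge> 0\<close>; (rule est[OF \<open>Q \<epsilon> R C\<close>]; assumption))
  qed
  note ex = this
  show ?thesis
    by (rule exI[of _ \<epsilon>], intro conjI allI \<open>\<epsilon> > 0\<close> \<open>\<epsilon> \<le> 1 / 4\<close> ex)
qed

lemma sum_powr_le:
  fixes a :: "'i \<Rightarrow> real"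
  assumes "finite A" "\<And>i. i \<in> A \<Longrightarrow> 0 \<le> a i" "0 < p"
  shows "(\<Sum>i\<in>A. a i) powr p \<le> real (card A) powr p * (\<Sum>i\<in>A. a i powr p)"
proof (cases "A = {}")
  case False
  have "(\<Sum>i\<in>A. a i) \<le> real (card A) * Max (a ` A)"
    using assms by (intro sum_bounded_above) auto
  then have "(\<Sum>i\<in>A. a i) powr p \<le> (real (card A) * Max (a ` A)) powr p"
    using assms by (intro powr_mono2 sum_nonneg) auto
  also have "\<dots> = real (card A) powr p * Max (a ` A) powr p"
    by (rule powr_mult)
  also have "Max (a ` A) powr p \<le> (\<Sum>i\<in>A. a i powr p)"
  proof -
    have "Max (a ` A) \<in> a ` A" using assms False by (intro Max_in) auto
    then obtain i where "i \<in> A" "Max (a ` A) = a i" by auto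
    then show ?thesis using assms member_le_sum[of i A "\<lambda>i. a i powr p"] by simp
  qed
  finally show ?thesis by (simp add: mult_left_mono)
qed (use assms in simp)

text \<open>Jensen's inequality for t^p and total mass at most one, up to the factor 2^p inherited
  from \<open>nn_integral_Holder_one\<close>.\<close>

lemma powr_le_nn_integral_powr:
  fixes f :: "'a \<Rightarrow> real"
  assumes [measurable]: "f \<in> borel_measurable M" and f0: "\<And>x. 0 \<le> f x" and p: "1 \<le> p"
    and "emeasure M (space M) \<le> 1" and a: "ennreal a \<le> (\<integral>\<^sup>+x. ennreal (f x) \<partial>M)" "0 \<le> a"
  shows "ennreal (a powr p) \<le> ennreal (2 powr p) * (\<integral>\<^sup>+x. ennreal (f x powr p) \<partial>M)"
proof (cases "(\<integral>\<^sup>+x. ennreal (f x powr p) \<partial>M) = \<infinity>")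
  case True
  then show ?thesis using p by (simp add: ennreal_mult_top)
next
  case False
  then obtain I where I: "(\<integral>\<^sup>+x. ennreal (f x powr p) \<partial>M) = ennreal I" "0 \<le> I"
    by (cases "\<integral>\<^sup>+x. ennreal (f x powr p) \<partial>M") auto
  have "(\<integral>\<^sup>+x. ennreal (f x) \<partial>M) \<le> ennreal (2 * 1 powr (1 - 1 / p) * I powr (1 / p))"
    using assms I by (intro nn_integral_Holder_one) auto
  then have "a \<le> 2 * I powr (1 / p)"
    using a order_trans by (fastforce simp: ennreal_le_iff)
  then have "a powr p \<le> (2 * I powr (1 / p)) powr p" using a p by (intro powr_mono2) auto
  also have "\<dots> = 2 powr p * I" using I p by (simp add: powr_mult powr_powr)
  finally show ?thesis using I by (simp add: ennreal_mult[symmetric] ennreal_leI)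
qed

text \<open>Pointwise this is Jensen's inequality for the probability measure with density
  \<open>Z [] (z - y)\<close>; integrating over z by Fubini's theorem removes the kernel.\<close>

lemma mollified_powr_integral_le:
  fixes g :: "real^'n::finite \<Rightarrow> 'b::euclidean_space"
  assumes Z: "mollifier C \<epsilon> Z" and g: "integrable lebesgue g" and p: "1 \<le> p"
  shows "(\<integral>\<^sup>+z. ennreal (norm (LINT y|lebesgue. Z [] (z - y) *\<^sub>R g y) powr p) \<partial>lborel) \<le>
    ennreal (2 powr p) * (\<integral>\<^sup>+y. ennreal (norm (g y) powr p) \<partial>lebesgue)"
proof -
  have [measurable]: "Z [] \<in> borel_measurable borel" using Z by (simp add: mollifier_def jet_measurable)
  have Z0: "0 \<le> Z [] z" for z using Z by (simp add: mollifier_def)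
  \<comment> \<open>Fubini's theorem is applied on the Borel product, so the norm, which is only
    Lebesgue measurable, is replaced by a Borel function equal to it almost everywhere.\<close>
  have "(\<lambda>y. norm (g y)) \<in> borel_measurable lebesgue" using g by simp
  from completion_ex_borel_measurable_real[OF this]
  obtain w0 where w0: "w0 \<in> borel_measurable lborel" "AE y in lborel. norm (g y) = w0 y" by blast
  define w where "w y = \<bar>w0 y\<bar>" for y
  have [measurable]: "w \<in> borel_measurable borel" using w0 by (simp add: w_def[abs_def])
  have w: "AE y in lborel. norm (g y) = w y" using w0(2) by eventually_elim (metis abs_norm_cancel w_def)
  have w0: "0 \<le> w y" for y by (simp add: w_def)
  have ptw: "ennreal (norm (LINT y|lebesgue. Z [] (z - y) *\<^sub>R g y) powr p) \<le>
      ennreal (2 powr p) * (\<integral>\<^sup>+y. ennreal (Z [] (z - y)) * ennreal (w y powr p) \<partial>lborel)" for z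
  proof -
    let ?M = "density lborel (\<lambda>y. ennreal (Z [] (z - y)))"
    have "ennreal (norm (LINT y|lebesgue. Z [] (z - y) *\<^sub>R g y)) \<le> (\<integral>\<^sup>+y. ennreal (norm (Z [] (z - y) *\<^sub>R g y)) \<partial>lebesgue)"
      by (rule integral_norm_bound_ennreal[OF integrable_mollifier_scaleR[OF Z g]])
    also have "\<dots> = (\<integral>\<^sup>+y. ennreal (Z [] (z - y)) * ennreal (w y) \<partial>lborel)"
      unfolding nn_integral_completion
      by (rule nn_integral_cong_AE) (use w in eventually_elim, simp add: ennreal_mult' Z0)
    also have "\<dots> = (\<integral>\<^sup>+y. ennreal (w y) \<partial>?M)" by (simp add: nn_integral_density)
    finally have "ennreal (norm (LINT y|lebesgue. Z [] (z - y) *\<^sub>R g y) powr p) \<le> ennreal (2 powr p) * (\<integral>\<^sup>+y. ennreal (w y powr p) \<partial>?M)"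
      using p mollifier_nn_integral(1)[OF Z, of z]
      by (intro powr_le_nn_integral_powr) (auto simp: w0 emeasure_density)
    then show ?thesis by (simp add: nn_integral_density)
  qed
  have "(\<integral>\<^sup>+z. ennreal (norm (LINT y|lebesgue. Z [] (z - y) *\<^sub>R g y) powr p) \<partial>lborel) \<le>
      (\<integral>\<^sup>+z. ennreal (2 powr p) * (\<integral>\<^sup>+y. ennreal (Z [] (z - y)) * ennreal (w y powr p) \<partial>lborel) \<partial>lborel)"
    by (intro nn_integral_mono ptw)
  also have "\<dots> = ennreal (2 powr p) * (\<integral>\<^sup>+z. (\<integral>\<^sup>+y. ennreal (Z [] (z - y)) * ennreal (w y powr p) \<partial>lborel) \<partial>lborel)"
    by (intro nn_integral_cmult) measurable
  also have "(\<integral>\<^sup>+z. (\<integral>\<^sup>+y. ennreal (Z [] (z - y)) * ennreal (w y powr p) \<partial>lborel) \<partial>lborel) =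
      (\<integral>\<^sup>+y. (\<integral>\<^sup>+z. ennreal (Z [] (z - y)) * ennreal (w y powr p) \<partial>lborel) \<partial>lborel)"
    by (rule lborel_pair.Fubini') measurable
  also have "\<dots> = (\<integral>\<^sup>+y. ennreal (w y powr p) \<partial>lborel)"
    using mollifier_nn_integral(2)[OF Z] by (simp add: nn_integral_multc)
  also have "\<dots> = (\<integral>\<^sup>+y. ennreal (norm (g y) powr p) \<partial>lebesgue)"
    unfolding nn_integral_completion
    by (rule nn_integral_cong_AE) (use w in eventually_elim, simp)
  finally show ?thesis .
qed

text \<open>Mollification takes room near the boundary, but the estimate for jets only looks at a
  convex set that holds x, the data points and the ball around c. Their convex hull is compact in T,
  so a whole neighbourhood of it stays inside. The Lebesgue point condition lets the derivative be
  evaluated at x itself, in the limit.\<close>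

lemma weak_deriv_pointwise_estimate:
  fixes p :: real
  assumes p: "1 \<le> p" "m < k"
    and "p > 1 \<Longrightarrow> real k > real m + real CARD('n::finite) / p" and "p = 1 \<Longrightarrow> k \<ge> m + CARD('n)"
  shows "\<exists>\<epsilon>>0. \<epsilon> \<le> 1 / 4 \<and> (\<forall>R\<ge>1. \<exists>C\<ge>0. \<exists>S\<ge>1. \<forall>(T :: (real^'n) set) (u :: real^'n \<Rightarrow> 'b::euclidean_space) G x c \<delta> \<zeta> M I is.
     open T \<longrightarrow> convex T \<longrightarrow> (\<forall>js. length js \<le> k \<longrightarrow> has_weak_deriv T (count_list js) u (G js)) \<longrightarrow> continuous_on T u \<longrightarrow>
     0 < \<delta> \<longrightarrow> cball c (\<delta> * \<epsilon>) \<subseteq> T \<longrightarrow> x \<in> T \<longrightarrow> \<delta> \<le> norm (x - c) \<longrightarrow> norm (x - c) \<le> R * \<delta> \<longrightarrow>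
     (\<forall>z\<in>grid k. \<zeta> z \<in> T \<and> norm (\<zeta> z - (c + \<delta> *\<^sub>R z)) \<le> \<delta> * \<epsilon> \<and> norm (u (\<zeta> z)) \<le> M) \<longrightarrow> length is = m \<longrightarrow>
     (\<forall>K. compact K \<longrightarrow> K \<subseteq> T \<longrightarrow> x \<in> interior K \<longrightarrow> lebesgue_point (\<lambda>y. indicator K y *\<^sub>R G is y) x) \<longrightarrow>
     (\<Sum>js | length js = k. powr_integral p (T \<inter> cball x (S * \<delta>)) (G js)) \<le> ennreal I \<longrightarrow> 0 \<le> I \<longrightarrow>
     \<delta> ^ m * norm (G is x) \<le> C * (M + \<delta> powr (real k - real CARD('n) / p) * I powr (1 / p)))"
proof -
  define Q where "Q \<epsilon> R C \<longleftrightarrow> (\<forall>(U :: 'n list \<Rightarrow> real^'n \<Rightarrow> 'b) V x c \<delta> \<zeta> M I is.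
     jet U \<longrightarrow> convex V \<longrightarrow> closed V \<longrightarrow> 0 < \<delta> \<longrightarrow> cball c (\<delta> * \<epsilon>) \<subseteq> V \<longrightarrow> x \<in> V \<longrightarrow> \<delta> \<le> norm (x - c) \<longrightarrow> norm (x - c) \<le> R * \<delta> \<longrightarrow>
     (\<forall>z\<in>grid k. \<zeta> z \<in> V \<and> norm (\<zeta> z - (c + \<delta> *\<^sub>R z)) \<le> \<delta> * \<epsilon> \<and> norm (U [] (\<zeta> z)) \<le> M) \<longrightarrow> length is = m \<longrightarrow>
     (\<integral>\<^sup>+z. ennreal ((\<Sum>js | length js = k. norm (U js z)) powr p) * indicator V z \<partial>lborel) \<le> ennreal I \<longrightarrow> 0 \<le> I \<longrightarrow>
     \<delta> ^ m * norm (U is x) \<le> C * (M + \<delta> powr (real k - real CARD('n) / p) * I powr (1 / p)))" for \<epsilon> R C :: real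
  have "\<exists>\<epsilon>>0. \<epsilon> \<le> 1 / 4 \<and> (\<forall>R. \<exists>C\<ge>0. Q \<epsilon> R C)"
    unfolding Q_def by (rule jet_scaled_estimate[OF assms(1-4)])
  then obtain \<epsilon> where "\<epsilon> > 0" "\<epsilon> \<le> 1 / 4" and Q: "\<And>R. \<exists>C\<ge>0. Q \<epsilon> R C" by blast
  obtain C1 and Z :: "real \<Rightarrow> 'n list \<Rightarrow> real^'n \<Rightarrow> real" where "C1 \<ge> 0" and Z: "\<And>e. e > 0 \<Longrightarrow> mollifier C1 e (Z e)"
    using mollifier_exists by metis
  let ?J = "{js :: 'n list. length js = k}"
  define N where "N = real (card ?J)"
  \<comment> \<open>The factor \<open>2 * N\<close> has two sources: \<open>N\<close>, the number of
    lists of length k, from exchanging a sum with p-th powers, and 2 from the integral of the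
    mollified derivatives.\<close>
  have main: "\<delta> ^ m * norm (G is x) \<le> C * max 1 (2 * N) * (M + \<delta> powr (real k - real CARD('n) / p) * I powr (1 / p))"
    if QC: "Q \<epsilon> R C" and "0 \<le> C" and T: "open T" "convex T" and G: "\<forall>js. length js \<le> k \<longrightarrow> has_weak_deriv T (count_list js) u (G js)"
      and u: "continuous_on T u" and "0 < \<delta>" and ball: "cball c (\<delta> * \<epsilon>) \<subseteq> T" and x: "x \<in> T" "\<delta> \<le> norm (x - c)" "norm (x - c) \<le> R * \<delta>"
      and \<zeta>: "\<forall>z\<in>grid k. \<zeta> z \<in> T \<and> norm (\<zeta> z - (c + \<delta> *\<^sub>R z)) \<le> \<delta> * \<epsilon> \<and> norm (u (\<zeta> z)) \<le> M" and len: "length is = m"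
      and leb: "\<forall>K. compact K \<longrightarrow> K \<subseteq> T \<longrightarrow> x \<in> interior K \<longrightarrow> lebesgue_point (\<lambda>y. indicator K y *\<^sub>R G is y) x"
      and I: "(\<Sum>js\<in>?J. powr_integral p (T \<inter> cball x ((R + real (CARD('n) * k) + 2) * \<delta>)) (G js)) \<le> ennreal I" "0 \<le> I"
    for R C and T :: "(real^'n) set" and u :: "real^'n \<Rightarrow> 'b" and G x c \<delta> \<zeta> M I "is"
  proof -
    have intT: "interior T = T" using T by (simp add: interior_open)
    define V where "V = convex hull (insert x (\<zeta> ` grid k \<union> cball c (\<delta> * \<epsilon>)))"
    \<comment> \<open>The point x is within R \<delta> of c, and the other points are within (d k +
      1) \<delta>, because nodes have norm at most d k. One further \<delta> gives strict
      inequality, hence an open ball.\<close>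
    let ?B = "ball x ((R + real (CARD('n) * k) + 2) * \<delta>)"
    have "compact V"
      unfolding V_def
      by (intro compact_convex_hull compact_insert compact_Un finite_imp_compact finite_imageI finite_grid compact_cball)
    then have V: "convex V" "compact V" "x \<in> V" "\<forall>z\<in>grid k. \<zeta> z \<in> V" "cball c (\<delta> * \<epsilon>) \<subseteq> V"
      using hull_subset[of "insert x (\<zeta> ` grid k \<union> cball c (\<delta> * \<epsilon>))" convex] unfolding V_def by auto
    have "V \<subseteq> T"
      unfolding V_def using T x ball \<zeta> by (intro hull_minimal) auto
    have "V \<subseteq> ?B"
      unfolding V_def
    proof (rule hull_minimal)
      have "dist x y < (R + real (CARD('n) * k) + 2) * \<delta>" if "norm (y - c) \<le> (real (CARD('n) * k) + 1) * \<delta>" for y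
      proof -
        have "dist x y \<le> norm (x - c) + norm (y - c)"
          using norm_triangle_ineq4[of "x - c" "y - c"] by (simp add: dist_norm)
        also have "\<dots> \<le> (R + real (CARD('n) * k) + 1) * \<delta>" using x that by (simp add: algebra_simps)
        also have "\<dots> < (R + real (CARD('n) * k) + 2) * \<delta>" using \<open>0 < \<delta>\<close> by simp
        finally show ?thesis .
      qed
      note near = this
      have "norm (y - c) \<le> (real (CARD('n) * k) + 1) * \<delta>" if "y \<in> cball c (\<delta> * \<epsilon>)" for y
      proof -
        have "norm (y - c) \<le> \<delta> * \<epsilon>" using that by (simp add: dist_norm norm_minus_commute)
        also have "\<dots> \<le> (real (CARD('n) * k) + 1) * \<delta>"
        proof -
          have "\<epsilon> \<le> real (CARD('n) * k) + 1"
            using \<open>\<epsilon> \<le> 1 / 4\<close> of_nat_0_le_iff[of "CARD('n) * k", where 'a = real] by linarith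
          then show ?thesis using \<open>0 < \<delta>\<close> by (simp add: mult.commute[of \<delta>])
        qed
        finally show ?thesis .
      qed
      moreover have "norm (\<zeta> z - c) \<le> (real (CARD('n) * k) + 1) * \<delta>" if "z \<in> grid k" for z
      proof -
        have "norm (\<zeta> z - c) \<le> norm (\<zeta> z - (c + \<delta> *\<^sub>R z)) + norm (\<delta> *\<^sub>R z)"
          using norm_triangle_ineq[of "\<zeta> z - (c + \<delta> *\<^sub>R z)" "\<delta> *\<^sub>R z"] by (simp add: algebra_simps)
        also have "\<dots> \<le> \<delta> * \<epsilon> + \<delta> * real (CARD('n) * k)"
          using \<zeta> that norm_grid_le[OF that] \<open>0 < \<delta>\<close> by (intro add_mono) (auto intro!: mult_left_mono)
        also have "\<dots> \<le> \<delta> * 1 + \<delta> * real (CARD('n) * k)"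
          using \<open>0 < \<delta>\<close> \<open>\<epsilon> \<le> 1 / 4\<close> by (intro add_mono mult_left_mono) auto
        finally show ?thesis by (simp add: algebra_simps)
      qed
      moreover have "0 < (R + real (CARD('n) * k) + 2) * \<delta>"
      proof -
        have "0 \<le> R * \<delta>" using x order_trans[OF norm_ge_zero] by blast
        moreover have "0 < real (CARD('n) * k) + 2" by (simp add: add_nonneg_pos)
        ultimately have "0 < R * \<delta> + (real (CARD('n) * k) + 2) * \<delta>"
          using \<open>0 < \<delta>\<close> by (intro add_nonneg_pos[OF _ mult_pos_pos])
        then show ?thesis by (simp add: algebra_simps)
      qed
      ultimately show "insert x (\<zeta> ` grid k \<union> cball c (\<delta> * \<epsilon>)) \<subseteq> ?B"
        using near by auto
    qed simp
    with \<open>V \<subseteq> T\<close> V T obtain e where "e > 0" and e: "(\<Union>y\<in>V. cball y e) \<subseteq> T \<inter> ?B"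
      using compact_subset_open_imp_cball_epsilon_subset[of V "T \<inter> ?B"] by (metis Int_subset_iff open_Int open_ball)
    define K where "K = (\<Union>y\<in>V. cball y e)"
    \<comment> \<open>Written as a sum of two compact sets, the closed neighbourhood of the hull is
      seen to be compact.\<close>
    have "K = {a + b |a b. a \<in> V \<and> b \<in> cball 0 e}"
    proof -
      have "z \<in> K \<longleftrightarrow> z \<in> {a + b |a b. a \<in> V \<and> b \<in> cball 0 e}" for z
      proof
        assume "z \<in> K"
        then obtain y where "y \<in> V" "dist y z \<le> e" by (auto simp: K_def)
        then show "z \<in> {a + b |a b. a \<in> V \<and> b \<in> cball 0 e}"
          by (intro CollectI exI[of _ y] exI[of _ "z - y"]) (auto simp: dist_norm norm_minus_commute)
      next
        assume "z \<in> {a + b |a b. a \<in> V \<and> b \<in> cball 0 e}"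
        then obtain a b where "z = a + b" "a \<in> V" "norm b \<le> e" by auto
        then show "z \<in> K" unfolding K_def by (intro UN_I[of a]) (auto simp: dist_norm)
      qed
      then show ?thesis by blast
    qed
    then have "compact K" using compact_sums[OF V(2) compact_cball[of 0 e]] by (simp only:)
    have KT: "K \<subseteq> T" "K \<subseteq> ?B" using e by (auto simp: K_def)
    have Vint: "y \<in> interior K" if "y \<in> V" for y
      using that \<open>e > 0\<close> by (intro interiorI[of "ball y e"]) (auto simp: K_def intro!: bexI[of _ y])
    have "integrable lebesgue (\<lambda>y. indicator K y *\<^sub>R G js y)" if "length js \<le> k" for js
      using G that KT intT \<open>compact K\<close> by (intro locally_integrableD[of T]) (auto simp: has_weak_deriv_def)
    note intG = this
    have "locally_integrable T u" using G[rule_format, of "[]"] by (simp add: has_weak_deriv_def)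
    then have intu: "integrable lebesgue (\<lambda>y. indicator K y *\<^sub>R u y)"
      using KT intT \<open>compact K\<close> by (intro locally_integrableD[of T]) auto
    define U where "U \<epsilon> js y = (LINT z|lebesgue. Z \<epsilon> js (y - z) *\<^sub>R (indicator K z *\<^sub>R u z))" for \<epsilon> js y
    have jetU: "jet (U \<epsilon>)" if "\<epsilon> > 0" for \<epsilon>
      unfolding U_def using Z[OF that] intu mollifier_bounded
      by (intro jet_convolution) (auto simp: mollifier_jet)
    have UG: "U \<epsilon> js y = (LINT z|lebesgue. Z \<epsilon> [] (y - z) *\<^sub>R (indicator K z *\<^sub>R G js z))"
      if "\<epsilon> > 0" "\<epsilon> < e / CARD('n)" "length js \<le> k" "y \<in> V" for \<epsilon> js y
      unfolding U_def
    proof (rule has_weak_deriv_mollified[OF G[rule_format, OF that(3)] Z[OF that(1)]])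
      show "cbox y (y + \<epsilon> *\<^sub>R One) \<subseteq> K"
        using cbox_subset_ball[OF that(1,2), of y] that(4) ball_subset_cball[of y e] unfolding K_def by blast
    qed (use KT intT in auto)
    define I' where "I' = (2 * N) powr p * I"
    have "I' \<ge> 0" using I by (simp add: I'_def)
    have "closed V" using V compact_imp_closed by blast
    then have [measurable]: "V \<in> sets borel" by simp
    have IU: "(\<integral>\<^sup>+z. ennreal ((\<Sum>js\<in>?J. norm (U \<epsilon> js z)) powr p) * indicator V z \<partial>lborel) \<le> ennreal I'"
      if \<epsilon>: "\<epsilon> > 0" "\<epsilon> < e / CARD('n)" for \<epsilon>
    proof -
      define g where "g js z = (LINT y|lebesgue. Z \<epsilon> [] (z - y) *\<^sub>R (indicator K y *\<^sub>R G js y))" for js z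
      have [measurable]: "g js \<in> borel_measurable borel" if "js \<in> ?J" for js
        unfolding g_def[abs_def] using jet_convolution[of "Z \<epsilon>" "\<lambda>y. indicator K y *\<^sub>R G js y"] Z[OF \<epsilon>(1)] mollifier_bounded intG that
        by (intro jet_measurable[where U = "\<lambda>is z. LINT y|lebesgue. Z \<epsilon> is (z - y) *\<^sub>R (indicator K y *\<^sub>R G js y)"])
          (auto simp: mollifier_jet)
      have "(\<integral>\<^sup>+z. ennreal ((\<Sum>js\<in>?J. norm (U \<epsilon> js z)) powr p) * indicator V z \<partial>lborel) \<le>
          (\<integral>\<^sup>+z. ennreal (N powr p) * (\<Sum>js\<in>?J. ennreal (norm (g js z) powr p)) \<partial>lborel)"
      proof (rule nn_integral_mono)
        fix z
        show "ennreal ((\<Sum>js\<in>?J. norm (U \<epsilon> js z)) powr p) * indicator V z \<le> ennreal (N powr p) * (\<Sum>js\<in>?J. ennreal (norm (g js z) powr p))"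
        proof (cases "z \<in> V")
          case True
          have "(\<Sum>js\<in>?J. norm (U \<epsilon> js z)) powr p \<le> N powr p * (\<Sum>js\<in>?J. norm (U \<epsilon> js z) powr p)"
            unfolding N_def using p by (intro sum_powr_le) auto
          also have "(\<Sum>js\<in>?J. norm (U \<epsilon> js z) powr p) = (\<Sum>js\<in>?J. norm (g js z) powr p)"
            using UG[OF \<epsilon> _ True] unfolding g_def by (intro sum.cong) auto
          finally show ?thesis
            using True by (simp add: sum_ennreal ennreal_mult[symmetric] sum_nonneg ennreal_leI)
        qed simp
      qed
      also have "\<dots> = ennreal (N powr p) * (\<Sum>js\<in>?J. \<integral>\<^sup>+z. ennreal (norm (g js z) powr p) \<partial>lborel)"
        by (subst nn_integral_cmult) (auto simp: nn_integral_sum simp del: sum_ennreal)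
      also have "\<dots> \<le> ennreal (N powr p) * (\<Sum>js\<in>?J. ennreal (2 powr p) * powr_integral p (T \<inter> cball x ((R + real (CARD('n) * k) + 2) * \<delta>)) (G js))"
      proof (intro mult_left_mono sum_mono)
        fix js assume js: "js \<in> ?J"
        have "(\<integral>\<^sup>+z. ennreal (norm (g js z) powr p) \<partial>lborel) \<le> ennreal (2 powr p) * (\<integral>\<^sup>+y. ennreal (norm (indicator K y *\<^sub>R G js y) powr p) \<partial>lebesgue)"
          using js unfolding g_def by (intro mollified_powr_integral_le[OF Z[OF \<epsilon>(1)]] intG p(1)) auto
        also have "\<dots> \<le> ennreal (2 powr p) * powr_integral p (T \<inter> cball x ((R + real (CARD('n) * k) + 2) * \<delta>)) (G js)"
          unfolding powr_integral_def using KT p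
          by (intro mult_left_mono nn_integral_mono) (auto simp: indicator_def subset_iff less_imp_le)
        finally show "(\<integral>\<^sup>+z. ennreal (norm (g js z) powr p) \<partial>lborel) \<le> ennreal (2 powr p) * powr_integral p (T \<inter> cball x ((R + real (CARD('n) * k) + 2) * \<delta>)) (G js)" .
      qed auto
      also have "\<dots> \<le> ennreal (N powr p) * (ennreal (2 powr p) * ennreal I)"
        unfolding sum_distrib_left[symmetric] using I by (intro mult_left_mono) auto
      also have "\<dots> = ennreal I'"
        using I by (simp add: I'_def N_def powr_mult ennreal_mult[symmetric] ac_simps)
      finally show ?thesis .
    qed
    have lim_G: "((\<lambda>\<epsilon>. LINT z|lebesgue. Z \<epsilon> [] (x - z) *\<^sub>R (indicator K z *\<^sub>R G is z)) \<longlongrightarrow> G is x) (at_right 0)"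
    proof -
      have "x \<in> K" using Vint[OF V(3)] interior_subset by blast
      have "lebesgue_point (\<lambda>y. indicator K y *\<^sub>R G is y) x"
        using leb \<open>compact K\<close> KT Vint[OF V(3)] by blast
      from mollifier_tendsto[OF Z \<open>0 \<le> C1\<close> intG this] show ?thesis
        using \<open>x \<in> K\<close> len \<open>m < k\<close> by simp
    qed
    have lim_u: "((\<lambda>\<epsilon>. U \<epsilon> [] y) \<longlongrightarrow> u y) (at_right 0)" if "y \<in> V" for y
    proof -
      have "y \<in> interior K" using Vint that by blast
      then have "y \<in> K" using interior_subset by blast
      have "isCont u y" using u T KT \<open>y \<in> K\<close> continuous_on_eq_continuous_at by blast
      moreover have "\<forall>\<^sub>F z in at y. indicator K z *\<^sub>R u z = u z"
        using \<open>y \<in> interior K\<close> interior_subset[of K] unfolding eventually_at_topological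
        by (intro exI[of _ "interior K"]) auto
      ultimately have "isCont (\<lambda>z. indicator K z *\<^sub>R u z) y"
        using \<open>y \<in> K\<close> unfolding isCont_def by (simp add: tendsto_cong)
      from mollifier_tendsto[OF Z \<open>0 \<le> C1\<close> intu isCont_lebesgue_point[OF intu this]] show ?thesis
        using \<open>y \<in> K\<close> by (simp add: U_def)
    qed
    let ?D = "\<delta> powr (real k - real CARD('n) / p)"
    \<comment> \<open>The mollified values at the data points only tend to those of u, so they may
      exceed M by a small \<eta>, which is removed after the limit.\<close>
    have "\<delta> ^ m * norm (G is x) \<le> C * (M + \<eta> + ?D * I' powr (1 / p))" if "\<eta> > 0" for \<eta>
    proof (rule tendsto_upperbound)
      show "((\<lambda>\<epsilon>. \<delta> ^ m * norm (LINT z|lebesgue. Z \<epsilon> [] (x - z) *\<^sub>R (indicator K z *\<^sub>R G is z))) \<longlongrightarrow> \<delta> ^ m * norm (G is x)) (at_right 0)"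
        by (intro tendsto_intros lim_G)
      have "\<forall>\<^sub>F \<epsilon> in at_right 0. norm (U \<epsilon> [] (\<zeta> z)) < M + \<eta>" if "z \<in> grid k" for z
        using tendsto_norm[OF lim_u[of "\<zeta> z"]] V(4) that \<zeta> \<open>\<eta> > 0\<close>
        by (intro order_tendstoD(2)[where y = "norm (u (\<zeta> z))"]) (auto intro: le_less_trans)
      then have "\<forall>\<^sub>F \<epsilon> in at_right 0. \<forall>z\<in>grid k. norm (U \<epsilon> [] (\<zeta> z)) < M + \<eta>"
        by (intro eventually_ball_finite) auto
      moreover have "\<forall>\<^sub>F \<epsilon> in at_right (0::real). 0 < \<epsilon> \<and> \<epsilon> < e / CARD('n)"
        using \<open>e > 0\<close> unfolding eventually_at_right_field by (intro exI[of _ "e / CARD('n)"]) auto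
      ultimately show "\<forall>\<^sub>F \<epsilon> in at_right 0. \<delta> ^ m * norm (LINT z|lebesgue. Z \<epsilon> [] (x - z) *\<^sub>R (indicator K z *\<^sub>R G is z)) \<le> C * (M + \<eta> + ?D * I' powr (1 / p))"
      proof eventually_elim
        case (elim \<epsilon>')
        then have \<epsilon>': "0 < \<epsilon>'" "\<epsilon>' < e / CARD('n)" by auto
        have "\<delta> ^ m * norm (U \<epsilon>' is x) \<le> C * (M + \<eta> + ?D * I' powr (1 / p))"
        proof (rule QC[unfolded Q_def, rule_format, OF jetU[OF \<epsilon>'(1)] V(1) \<open>closed V\<close> \<open>0 < \<delta>\<close> V(5,3) x(2,3) _ len IU[OF \<epsilon>'] \<open>0 \<le> I'\<close>])
          fix z :: "real^'n" assume "z \<in> grid k"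
          then show "\<zeta> z \<in> V \<and> norm (\<zeta> z - (c + \<delta> *\<^sub>R z)) \<le> \<delta> * \<epsilon> \<and> norm (U \<epsilon>' [] (\<zeta> z)) \<le> M + \<eta>"
            using V(4) \<zeta> elim by (auto intro: less_imp_le)
        qed
        then show ?case using UG[OF \<epsilon>', of "is" x] len \<open>m < k\<close> V(3) by simp
      qed
    qed simp
    note bound = this
    have lim: "\<delta> ^ m * norm (G is x) \<le> C * (M + ?D * I' powr (1 / p)) + C * \<eta>" if "\<eta> > 0" for \<eta>
      using bound[OF that] by (simp add: algebra_simps)
    have "\<delta> ^ m * norm (G is x) \<le> C * (M + ?D * I' powr (1 / p))"
    proof (rule field_le_epsilon)
      fix \<eta> :: real assume "\<eta> > 0"
      \<comment> \<open>Division by C + 1 also serves the case C = 0.\<close>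
      then have "\<delta> ^ m * norm (G is x) \<le> C * (M + ?D * I' powr (1 / p)) + C * (\<eta> / (C + 1))"
        using \<open>0 \<le> C\<close> by (intro lim) simp
      moreover have "C * (\<eta> / (C + 1)) \<le> \<eta>"
        using \<open>0 \<le> C\<close> \<open>\<eta> > 0\<close> by (simp add: field_simps)
      ultimately show "\<delta> ^ m * norm (G is x) \<le> C * (M + ?D * I' powr (1 / p)) + \<eta>" by linarith
    qed
    also have "I' powr (1 / p) = 2 * N * I powr (1 / p)"
      using I p by (simp add: I'_def N_def powr_mult powr_powr)
    also have "C * (M + ?D * (2 * N * I powr (1 / p))) \<le> C * (max 1 (2 * N) * M + max 1 (2 * N) * (?D * I powr (1 / p)))"
    proof (intro mult_left_mono add_mono \<open>0 \<le> C\<close>)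
      have "k > 0" using \<open>m < k\<close> by simp
      then have "vec_lambda (\<lambda>i. 1 + real 0) \<in> (grid k :: (real^'n) set)"
        unfolding grid_def by (intro image_eqI[of _ _ "\<lambda>_. 0"]) auto
      then have "0 \<le> M" using \<zeta> norm_ge_zero order_trans by blast
      then show "M \<le> max 1 (2 * N) * M" using mult_right_mono[of 1 "max 1 (2 * N)" M] by simp
      have "2 * N * (?D * I powr (1 / p)) \<le> max 1 (2 * N) * (?D * I powr (1 / p))" by (intro mult_right_mono) auto
      then show "?D * (2 * N * I powr (1 / p)) \<le> max 1 (2 * N) * (?D * I powr (1 / p))" by (simp add: ac_simps)
    qed
    finally show ?thesis by (simp add: algebra_simps)
  qed
  show ?thesis
  proof (rule exI[of _ \<epsilon>], intro conjI allI impI)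
    fix R :: real assume "R \<ge> 1"
    obtain C where C: "C \<ge> 0" "Q \<epsilon> R C" using Q[of R] by (elim exE conjE)
    show "\<exists>C\<ge>0. \<exists>S\<ge>1. \<forall>(T :: (real^'n) set) (u :: real^'n \<Rightarrow> 'b) G x c \<delta> \<zeta> M I is.
     open T \<longrightarrow> convex T \<longrightarrow> (\<forall>js. length js \<le> k \<longrightarrow> has_weak_deriv T (count_list js) u (G js)) \<longrightarrow> continuous_on T u \<longrightarrow>
     0 < \<delta> \<longrightarrow> cball c (\<delta> * \<epsilon>) \<subseteq> T \<longrightarrow> x \<in> T \<longrightarrow> \<delta> \<le> norm (x - c) \<longrightarrow> norm (x - c) \<le> R * \<delta> \<longrightarrow>
     (\<forall>z\<in>grid k. \<zeta> z \<in> T \<and> norm (\<zeta> z - (c + \<delta> *\<^sub>R z)) \<le> \<delta> * \<epsilon> \<and> norm (u (\<zeta> z)) \<le> M) \<longrightarrow> length is = m \<longrightarrow>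
     (\<forall>K. compact K \<longrightarrow> K \<subseteq> T \<longrightarrow> x \<in> interior K \<longrightarrow> lebesgue_point (\<lambda>y. indicator K y *\<^sub>R G is y) x) \<longrightarrow>
     (\<Sum>js | length js = k. powr_integral p (T \<inter> cball x (S * \<delta>)) (G js)) \<le> ennreal I \<longrightarrow> 0 \<le> I \<longrightarrow>
     \<delta> ^ m * norm (G is x) \<le> C * (M + \<delta> powr (real k - real CARD('n) / p) * I powr (1 / p))"
    proof (rule exI[of _ "C * max 1 (2 * N)"], rule conjI[rotated],
        rule exI[of _ "R + real (CARD('n) * k) + 2"], intro conjI allI impI)
      show "0 \<le> C * max 1 (2 * N)" using C by simp
      show "1 \<le> R + real (CARD('n) * k) + 2" using \<open>R \<ge> 1\<close> by simp
    qed (rule main[OF C(2,1)]; assumption)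
  qed (use \<open>\<epsilon> > 0\<close> \<open>\<epsilon> \<le> 1 / 4\<close> in auto)
qed

section \<open>From the pointwise estimate to Lebesgue norms\<close>

text \<open>A point z belongs to the ball around x exactly for x in the ball around z: this is the
  finite overlap of a covering, in integrated form.\<close>

lemma nn_integral_ball_average:
  fixes F :: "real^'n::finite \<Rightarrow> ennreal"
  assumes [measurable]: "F \<in> borel_measurable borel"
  shows "(\<integral>\<^sup>+x. (\<integral>\<^sup>+z. F z * indicator (cball x \<rho>) z \<partial>lborel) \<partial>lborel) = emeasure lborel (cball (0 :: real^'n) \<rho>) * (\<integral>\<^sup>+z. F z \<partial>lborel)"
proof -
  have [measurable]: "Measurable.pred (borel \<Otimes>\<^sub>M borel) (\<lambda>w :: (real^'n) \<times> (real^'n). snd w \<in> cball (fst w) \<rho>)"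
    unfolding mem_cball by measurable
  have [measurable]: "Measurable.pred (borel \<Otimes>\<^sub>M borel) (\<lambda>w :: (real^'n) \<times> (real^'n). fst w \<in> cball (snd w) \<rho>)"
    unfolding mem_cball by measurable
  have "(\<integral>\<^sup>+x. (\<integral>\<^sup>+z. F z * indicator (cball x \<rho>) z \<partial>lborel) \<partial>lborel) = (\<integral>\<^sup>+z. (\<integral>\<^sup>+x. F z * indicator (cball x \<rho>) z \<partial>lborel) \<partial>lborel)"
    by (rule lborel_pair.Fubini') measurable
  also have "\<dots> = (\<integral>\<^sup>+z. F z * emeasure lborel (cball (0 :: real^'n) \<rho>) \<partial>lborel)"
  proof (rule nn_integral_cong)
    fix z :: "real^'n"
    have "(\<integral>\<^sup>+x. F z * indicator (cball x \<rho>) z \<partial>lborel) = (\<integral>\<^sup>+x. F z * indicator (cball z \<rho>) x \<partial>lborel)"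
      by (intro nn_integral_cong) (auto simp: indicator_def dist_commute)
    also have "\<dots> = F z * emeasure lborel (cball z \<rho>)" by (simp add: nn_integral_cmult_indicator)
    also have "emeasure lborel (cball z \<rho>) = emeasure lborel (cball (0 :: real^'n) \<rho>)"
      by (cases "\<rho> \<ge> 0") (auto simp: emeasure_cball)
    finally show "(\<integral>\<^sup>+x. F z * indicator (cball x \<rho>) z \<partial>lborel) = F z * emeasure lborel (cball (0 :: real^'n) \<rho>)" .
  qed
  also have "\<dots> = emeasure lborel (cball (0 :: real^'n) \<rho>) * (\<integral>\<^sup>+z. F z \<partial>lborel)"
    by (simp add: nn_integral_multc mult.commute)
  finally show ?thesis .
qed

text \<open>The local integrals are at most J, and their integral over x is at most W J. For p \<le>
  q the first bound takes care of the excess power of the integrand; for q < p the power q/p is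
  dominated by an affine function, and the finite volume of T enters. So W gets the exponent min
  (1/p) (1/q), and with W of order h^d this produces (d/p - d/q)_+.\<close>

lemma nn_integral_powr_ball_average_le:
  fixes F :: "real^'n::finite \<Rightarrow> ennreal" and p q V W J :: real
  assumes [measurable]: "F \<in> borel_measurable borel" "T \<in> sets borel" and F: "(\<integral>\<^sup>+z. F z \<partial>lborel) \<le> ennreal J" "0 \<le> J"
    and pq: "1 \<le> p" "1 \<le> q" and V: "emeasure lborel T \<le> ennreal V" "0 \<le> V"
    and W: "emeasure lborel (cball (0 :: real^'n) \<rho>) \<le> ennreal W" "0 < W"
  shows "(\<integral>\<^sup>+x. ennreal (enn2real (\<integral>\<^sup>+z. F z * indicator (cball x \<rho>) z \<partial>lborel) powr (q / p)) * indicator T x \<partial>lborel)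
    \<le> ennreal ((1 + V) * (W powr min (1 / p) (1 / q) * J powr (1 / p)) powr q)"
proof -
  have [measurable]: "Measurable.pred (borel \<Otimes>\<^sub>M borel) (\<lambda>w :: (real^'n) \<times> (real^'n). snd w \<in> cball (fst w) \<rho>)"
    unfolding mem_cball by measurable
  define I where "I x = (\<integral>\<^sup>+z. F z * indicator (cball x \<rho>) z \<partial>lborel)" for x
  have [measurable]: "I \<in> borel_measurable borel" unfolding I_def by measurable
  define i where "i x = enn2real (I x)" for x
  have [measurable]: "i \<in> borel_measurable borel" unfolding i_def by measurable
  have "I x \<le> ennreal J" for x
    unfolding I_def by (rule order_trans[OF nn_integral_mono F(1)]) (auto simp: indicator_def)
  then have i: "I x = ennreal (i x)" "i x \<le> J" "0 \<le> i x" for x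
    using F(2) by (auto simp: i_def enn2real_leI less_top[symmetric] intro!: ennreal_enn2real[symmetric] le_less_trans[of "I x" "ennreal J"])
  have "(\<integral>\<^sup>+x. I x \<partial>lborel) \<le> ennreal W * ennreal J"
    unfolding I_def nn_integral_ball_average[OF assms(1)] using W F by (intro mult_mono) auto
  then have int: "(\<integral>\<^sup>+x. ennreal (i x) \<partial>lborel) \<le> ennreal (W * J)"
    using W F by (simp add: i(1)[symmetric] ennreal_mult)
  have comb: "(\<integral>\<^sup>+x. ennreal (i x powr (q / p)) * indicator T x \<partial>lborel) \<le> ennreal (a * (W * J) + b * V)"
    if "0 \<le> a" "0 \<le> b" "\<And>x. i x powr (q / p) \<le> a * i x + b" for a b
  proof -
    have "(\<integral>\<^sup>+x. ennreal (i x powr (q / p)) * indicator T x \<partial>lborel) \<le>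
        (\<integral>\<^sup>+x. ennreal a * ennreal (i x) + ennreal b * indicator T x \<partial>lborel)"
    proof (rule nn_integral_mono)
      fix x
      show "ennreal (i x powr (q / p)) * indicator T x \<le> ennreal a * ennreal (i x) + ennreal b * indicator T x"
        using that(1,2) that(3)[of x] i(3)[of x]
        by (cases "x \<in> T") (auto simp: ennreal_mult[symmetric] ennreal_plus[symmetric] simp del: ennreal_plus intro!: ennreal_leI)
    qed
    also have "\<dots> = ennreal a * (\<integral>\<^sup>+x. ennreal (i x) \<partial>lborel) + ennreal b * emeasure lborel T"
      by (simp add: nn_integral_add nn_integral_cmult nn_integral_cmult_indicator)
    also have "\<dots> \<le> ennreal a * ennreal (W * J) + ennreal b * ennreal V"
      using int V by (intro add_mono mult_left_mono) auto
    also have "\<dots> = ennreal (a * (W * J) + b * V)"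
      using that W F V by (simp add: ennreal_mult[symmetric] ennreal_plus[symmetric] del: ennreal_plus)
    finally show ?thesis .
  qed
  have "(\<integral>\<^sup>+x. ennreal (i x powr (q / p)) * indicator T x \<partial>lborel) \<le> ennreal ((1 + V) * (W powr min (1 / p) (1 / q) * J powr (1 / p)) powr q)"
  proof (cases "J = 0")
    case True
    then have "i x = 0" for x using i[of x] by auto
    then show ?thesis using pq by simp
  next
    case False
    with F have "J > 0" by simp
    show ?thesis
    proof (cases "p \<le> q")
      case True
      have "i x powr (q / p) \<le> J powr (q / p - 1) * i x + 0" for x
      proof (cases "i x = 0")
        case False
        with i[of x] have "0 < i x" by simp
        then have "i x powr (q / p) = i x powr (q / p - 1) * i x" by (simp add: powr_diff)
        also have "\<dots> \<le> J powr (q / p - 1) * i x"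
          using i[of x] True pq by (intro mult_right_mono powr_mono2) (auto simp: field_simps)
        finally show ?thesis by simp
      qed (use pq in simp)
      from comb[OF _ _ this] have "(\<integral>\<^sup>+x. ennreal (i x powr (q / p)) * indicator T x \<partial>lborel) \<le> ennreal (J powr (q / p - 1) * (W * J))" by simp
      also have "J powr (q / p - 1) * (W * J) = (W powr min (1 / p) (1 / q) * J powr (1 / p)) powr q"
      proof -
        have "min (1 / p) (1 / q) = 1 / q" using True pq by (simp add: min_def field_simps)
        then show ?thesis using \<open>J > 0\<close> W pq by (simp add: powr_mult powr_powr powr_diff)
      qed
      also have "\<dots> \<le> (1 + V) * (W powr min (1 / p) (1 / q) * J powr (1 / p)) powr q"
        using V by (simp add: mult_le_cancel_right1)
      finally show ?thesis by (simp add: ennreal_leI)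
    next
      case False
      \<comment> \<open>The affine bound is built at the level W J: up to this level the constant
        \<open>l\<close> suffices, above it the slope \<open>l'\<close> does, since the exponent q/p
        - 1 is negative.\<close>
      define l where "l = (W * J) powr (q / p)"
      define l' where "l' = (W * J) powr (q / p - 1)"
      have WJ: "0 < W * J" using W \<open>J > 0\<close> by simp
      have "i x powr (q / p) \<le> l' * i x + l" for x
      proof (cases "i x \<le> W * J")
        case True
        then have "i x powr (q / p) \<le> l" unfolding l_def using i[of x] pq by (intro powr_mono2) auto
        then show ?thesis using i[of x] by (simp add: l'_def add_increasing)
      next
        case False
        then have "0 < i x" using WJ by linarith
        then have "i x powr (q / p) = i x powr (q / p - 1) * i x" by (simp add: powr_diff)
        also have "\<dots> \<le> l' * i x"
          unfolding l'_def using i[of x] False \<open>\<not> p \<le> q\<close> pq WJ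
          by (intro mult_right_mono powr_mono2') (auto simp: field_simps)
        finally show ?thesis by (simp add: l_def add_increasing2)
      qed
      from comb[OF _ _ this] have "(\<integral>\<^sup>+x. ennreal (i x powr (q / p)) * indicator T x \<partial>lborel) \<le> ennreal (l' * (W * J) + l * V)"
        by (simp add: l_def l'_def)
      also have "l' * (W * J) = l" using WJ by (simp add: l_def l'_def powr_diff)
      also have "l + l * V = (1 + V) * (W powr min (1 / p) (1 / q) * J powr (1 / p)) powr q"
      proof -
        have "min (1 / p) (1 / q) = 1 / p" using False pq by (simp add: min_def field_simps)
        then show ?thesis using \<open>J > 0\<close> W pq by (simp add: l_def powr_mult powr_powr algebra_simps)
      qed
      finally show ?thesis .
    qed
  qed
  then show ?thesis by (simp add: i_def I_def)
qed

text \<open>One formula serves all q: a factor 2 pays for splitting the two summands, and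
  \<open>2 * (1 + V)\<close> for the volume of T.\<close>

lemma eLp_norm_le_of_pointwise:
  fixes g :: "real^'n::finite \<Rightarrow> 'b::euclidean_space" and F :: "real^'n \<Rightarrow> ennreal" and p A B V W J :: real
  assumes T: "convex T" and V: "emeasure lborel (interior T) \<le> ennreal V" "0 \<le> V" and g: "g \<in> borel_measurable (lebesgue_on T)"
    and meas [measurable]: "F \<in> borel_measurable borel" and F: "(\<integral>\<^sup>+z. F z \<partial>lborel) \<le> ennreal J" "0 \<le> J"
    and p: "1 \<le> p" and q: "1 \<le> q"
    and W: "emeasure lborel (cball (0 :: real^'n) \<rho>) \<le> ennreal W" "0 < W" and AB: "0 \<le> A" "0 \<le> B"
    and le: "AE x in lebesgue. x \<in> interior T \<longrightarrow>
      norm (g x) \<le> A + B * enn2real (\<integral>\<^sup>+z. F z * indicator (cball x \<rho>) z \<partial>lborel) powr (1 / p)"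
  shows "eLp_norm q T g \<le> ennreal (4 * (1 + V) * (A + B * (W powr min (1 / p) (enn2real (1 / q)) * J powr (1 / p))))"
proof -
  define i where "i x = enn2real (\<integral>\<^sup>+z. F z * indicator (cball x \<rho>) z \<partial>lborel)" for x
  have [measurable]: "Measurable.pred (borel \<Otimes>\<^sub>M borel) (\<lambda>w :: (real^'n) \<times> (real^'n). snd w \<in> cball (fst w) \<rho>)"
    unfolding mem_cball by measurable
  have [measurable]: "i \<in> borel_measurable borel" unfolding i_def by measurable
  have i: "0 \<le> i x" "i x \<le> J" for x
  proof -
    have "(\<integral>\<^sup>+z. F z * indicator (cball x \<rho>) z \<partial>lborel) \<le> ennreal J"
      by (rule order_trans[OF nn_integral_mono F(1)]) (auto simp: indicator_def)
    then show "i x \<le> J" using F(2) by (simp add: i_def enn2real_leI)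
  qed (simp add: i_def)
  have Tl: "T \<in> sets lebesgue" by (rule convex_sets_lebesgue[OF T])
  have leT: "AE x in lebesgue. x \<in> T \<longrightarrow> x \<in> interior T \<and> norm (g x) \<le> A + B * i x powr (1 / p)"
    using le convex_AE_interior[OF T] by eventually_elim (auto simp: i_def)
  define E where "E = A + B * (W powr min (1 / p) (enn2real (1 / q)) * J powr (1 / p))"
  have "E \<ge> 0" using AB by (simp add: E_def)
  show ?thesis
  proof (cases "q = \<infinity>")
    case True
    have "AE x in lebesgue_on T. ennreal (norm (g x)) \<le> ennreal E"
      unfolding AE_restrict_space_iff[of T lebesgue, simplified, OF Tl]
      using leT
    proof eventually_elim
      case (elim x)
      show ?case
      proof
        assume "x \<in> T"
        have "norm (g x) \<le> A + B * i x powr (1 / p)" using elim \<open>x \<in> T\<close> by simp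
        also have "\<dots> \<le> A + B * J powr (1 / p)"
          using i[of x] AB p by (intro add_left_mono mult_left_mono powr_mono2) auto
        \<comment> \<open>For q = \<infinity> the reciprocal 1/q is 0, so W has the exponent 0 and
          the formula reduces to the supremum bound.\<close>
        finally show "ennreal (norm (g x)) \<le> ennreal E"
          using True W p by (simp add: E_def ennreal_leI min_def)
      qed
    qed
    then have "eLp_norm q T g \<le> ennreal E"
      using True g by (auto simp: eLp_norm_def intro!: esssup_I)
    also have "E \<le> 4 * (1 + V) * E"
      using \<open>E \<ge> 0\<close> V by (simp add: mult_le_cancel_right1)
    finally show ?thesis by (simp add: E_def ennreal_leI)
  next
    case False
    then obtain r where r: "q = ennreal r" "0 \<le> r" by (cases q) auto
    with q have "1 \<le> r" by (simp add: ennreal_1[symmetric] del: ennreal_1)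
    have qi: "enn2real (1 / q) = 1 / r"
      using r \<open>1 \<le> r\<close> by (simp add: divide_ennreal[of 1 r, simplified])
    have "powr_integral r T g \<le> (\<integral>\<^sup>+x. ennreal (2 powr r * A powr r) * indicator (interior T) x +
        ennreal (2 powr r * B powr r) * (ennreal (i x powr (r / p)) * indicator (interior T) x) \<partial>lebesgue)"
      unfolding powr_integral_def
    proof (rule nn_integral_mono_AE)
      show "AE x in lebesgue. ennreal (norm (g x) powr r) * indicator T x \<le> ennreal (2 powr r * A powr r) * indicator (interior T) x +
        ennreal (2 powr r * B powr r) * (ennreal (i x powr (r / p)) * indicator (interior T) x)"
        using leT
      proof eventually_elim
        case (elim x)
        show ?case
        proof (cases "x \<in> T")
          case True
          have "norm (g x) powr r \<le> (A + B * i x powr (1 / p)) powr r"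
            using elim True \<open>1 \<le> r\<close> by (intro powr_mono2) auto
          also have "\<dots> \<le> 2 powr r * (A powr r + (B * i x powr (1 / p)) powr r)"
            using AB \<open>1 \<le> r\<close> by (intro powr_add_le) auto
          also have "\<dots> = 2 powr r * A powr r + 2 powr r * B powr r * i x powr (r / p)"
            by (simp add: powr_mult powr_powr algebra_simps)
          finally show ?thesis
            using True elim by (auto simp: ennreal_mult[symmetric] ennreal_plus[symmetric] simp del: ennreal_plus intro!: ennreal_leI)
        qed simp
      qed
    qed
    also have "\<dots> = ennreal (2 powr r * A powr r) * emeasure lborel (interior T) +
        ennreal (2 powr r * B powr r) * (\<integral>\<^sup>+x. ennreal (i x powr (r / p)) * indicator (interior T) x \<partial>lborel)"
      unfolding nn_integral_completion by (simp add: nn_integral_add nn_integral_cmult nn_integral_cmult_indicator)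
    also have "\<dots> \<le> ennreal (2 powr r * A powr r) * ennreal V +
        ennreal (2 powr r * B powr r) * ennreal ((1 + V) * (W powr min (1 / p) (1 / r) * J powr (1 / p)) powr r)"
      unfolding i_def using V F W p \<open>1 \<le> r\<close>
      by (intro add_mono mult_left_mono nn_integral_powr_ball_average_le) auto
    also have "\<dots> = ennreal (2 powr r * (A powr r * V + B powr r * ((1 + V) * (W powr min (1 / p) (1 / r) * J powr (1 / p)) powr r)))"
      using V by (simp add: ennreal_mult[symmetric] ennreal_plus[symmetric] algebra_simps del: ennreal_plus)
    also have "\<dots> \<le> ennreal ((4 * (1 + V) * E) powr r)"
    proof (rule ennreal_leI)
      have "B powr r * ((1 + V) * (W powr min (1 / p) (1 / r) * J powr (1 / p)) powr r) = (1 + V) * (B * (W powr min (1 / p) (1 / r) * J powr (1 / p))) powr r"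
        by (simp add: powr_mult)
      also have "\<dots> \<le> (1 + V) * E powr r"
        using V AB \<open>1 \<le> r\<close> by (intro mult_left_mono powr_mono2) (auto simp: E_def qi)
      finally have 1: "B powr r * ((1 + V) * (W powr min (1 / p) (1 / r) * J powr (1 / p)) powr r) \<le> (1 + V) * E powr r" .
      have "A powr r * V \<le> E powr r * (1 + V)"
        using V AB \<open>1 \<le> r\<close> by (intro mult_mono powr_mono2) (auto simp: E_def)
      with 1 have "2 powr r * (A powr r * V + B powr r * ((1 + V) * (W powr min (1 / p) (1 / r) * J powr (1 / p)) powr r)) \<le>
          2 powr r * (2 * (1 + V) * E powr r)"
        by (intro mult_left_mono) (auto simp: algebra_simps)
      \<comment> \<open>A number that is at least 1 does not exceed its r-th power, so the factor
        can be moved under the power.\<close>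
      also have "\<dots> \<le> 2 powr r * ((2 * (1 + V)) powr r * E powr r)"
        using V \<open>1 \<le> r\<close> powr_mono[of 1 r "2 * (1 + V)"] by (intro mult_left_mono mult_right_mono) auto
      also have "\<dots> = (4 * (1 + V) * E) powr r"
        by (simp add: powr_mult[symmetric] algebra_simps)
      finally show "2 powr r * (A powr r * V + B powr r * ((1 + V) * (W powr min (1 / p) (1 / r) * J powr (1 / p)) powr r)) \<le> (4 * (1 + V) * E) powr r" .
    qed
    finally have *: "powr_integral r T g \<le> ennreal ((4 * (1 + V) * E) powr r)" .
    then have fin: "powr_integral r T g \<noteq> \<infinity>" by (auto simp: top_unique)
    from * have "enn2real (powr_integral r T g) \<le> (4 * (1 + V) * E) powr r" by (simp add: enn2real_leI)
    then have "enn2real (powr_integral r T g) powr (1 / r) \<le> ((4 * (1 + V) * E) powr r) powr (1 / r)"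
      using \<open>1 \<le> r\<close> by (intro powr_mono2) auto
    also have "\<dots> = 4 * (1 + V) * E" using \<open>1 \<le> r\<close> V \<open>E \<ge> 0\<close> by (simp add: powr_powr)
    finally show ?thesis
      using fin r \<open>1 \<le> r\<close> Tl by (simp add: eLp_norm_eq_powr_integral E_def ennreal_leI)
  qed
qed

section \<open>The sampling inequality on a bounded convex set\<close>

text \<open>With D = d k + 1, the ball of radius D \<delta> around c holds the scaled grid, whose
  nodes have norm at most d k, and all points within h \<le> \<delta> of it. The homothety with
  center x that maps b to c maps the ball of radius r/2 around b onto this ball, and convexity keeps
  the image in the interior of T.\<close>

lemma local_norming_points:
  fixes T :: "(real^'n::finite) set"
  assumes T: "convex T" "bounded T" "interior T \<noteq> {}" and "0 < k" and "0 < \<epsilon>" "\<epsilon> \<le> 1 / 4"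
  shows "\<exists>R\<ge>1. \<exists>h\<^sub>0>0. \<forall>X h x. 0 < h \<longrightarrow> h \<le> h\<^sub>0 \<longrightarrow> (\<forall>y\<in>T. \<exists>z\<in>X. dist y z \<le> h) \<longrightarrow> x \<in> interior T \<longrightarrow>
    (\<exists>c \<zeta>. cball c (h / \<epsilon> * \<epsilon>) \<subseteq> interior T \<and> h / \<epsilon> \<le> norm (x - c) \<and> norm (x - c) \<le> R * (h / \<epsilon>) \<and>
      (\<forall>z\<in>grid k. \<zeta> z \<in> X \<inter> interior T \<and> norm (\<zeta> z - (c + (h / \<epsilon>) *\<^sub>R z)) \<le> h / \<epsilon> * \<epsilon>))"
proof -
  obtain a where "a \<in> interior T" using T(3) by blast
  then obtain r where r: "r > 0" "cball a r \<subseteq> interior T"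
    using open_contains_cball[of "interior T"] by auto
  obtain \<Delta> where \<Delta>: "\<And>x y. x \<in> T \<Longrightarrow> y \<in> T \<Longrightarrow> dist x y \<le> \<Delta>"
    using T(2) by (meson bounded_two_points)
  define D where "D = real (CARD('n) * k) + 1"
  have "1 \<le> CARD('n) * k" using \<open>0 < k\<close> by (simp add: Suc_le_eq)
  then have "real 1 \<le> real (CARD('n) * k)" by (simp only: of_nat_le_iff)
  then have "2 \<le> D" by (simp add: D_def)
  \<comment> \<open>Makes the fraction t = \<kappa> \<delta> of the way from x to b satisfy t r / 2
    = D \<delta>; the bound on h says that t \<le> 1.\<close>
  define \<kappa> where "\<kappa> = 2 * D / r"
  have "\<kappa> > 0" using r \<open>2 \<le> D\<close> by (simp add: \<kappa>_def)
  have "\<exists>c \<zeta>. cball c (h / \<epsilon> * \<epsilon>) \<subseteq> interior T \<and> h / \<epsilon> \<le> norm (x - c) \<and> norm (x - c) \<le> max 1 (\<kappa> * \<Delta>) * (h / \<epsilon>) \<and>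
      (\<forall>z\<in>grid k. \<zeta> z \<in> X \<inter> interior T \<and> norm (\<zeta> z - (c + (h / \<epsilon>) *\<^sub>R z)) \<le> h / \<epsilon> * \<epsilon>)"
    if h: "0 < h" "h \<le> \<epsilon> / \<kappa>" and X: "\<forall>y\<in>T. \<exists>z\<in>X. dist y z \<le> h" and x: "x \<in> interior T" for X h x
  proof -
    define \<delta> where "\<delta> = h / \<epsilon>"
    have "\<delta> > 0" "\<delta> * \<epsilon> = h" using h \<open>0 < \<epsilon>\<close> by (auto simp: \<delta>_def)
    define t where "t = \<kappa> * \<delta>"
    have t: "0 < t" "t \<le> 1"
      using h \<open>0 < \<kappa>\<close> \<open>0 < \<epsilon>\<close> by (auto simp: t_def \<delta>_def field_simps)
    have tr: "t * (r / 2) = D * \<delta>" using r by (simp add: t_def \<kappa>_def)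
    \<comment> \<open>If x is close to a, going toward a would hardly move x; then a ball of radius
      r/2 whose center is off a by r/2 is taken instead. The lower bound r/4 becomes norm (x - c)
      \<ge> \<delta> below, as D \<ge> 2.\<close>
    obtain b where b: "cball b (r / 2) \<subseteq> interior T" "r / 4 \<le> norm (b - x)"
    proof (cases "r / 4 \<le> norm (a - x)")
      case True
      moreover have "cball a (r / 2) \<subseteq> cball a r" using r by (intro subset_cball) auto
      ultimately show thesis using that[of a] r by blast
    next
      case False
      define a' where "a' = a + (r / 2) *\<^sub>R axis undefined 1"
      have "norm (a' - a) = r / 2" using r by (simp add: a'_def)
      moreover have "cball a' (r / 2) \<subseteq> cball a r"
      proof
        fix y assume "y \<in> cball a' (r / 2)"
        then show "y \<in> cball a r"
          using calculation dist_triangle[of a y a'] by (simp add: dist_norm norm_minus_commute)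
      qed
      ultimately show thesis using that[of a'] r False norm_triangle_ineq4[of "a' - x" "a - x"] by auto
    qed
    define c where "c = x + t *\<^sub>R (b - x)"
    have inT: "y \<in> interior T" if "norm (y - c) \<le> D * \<delta>" for y
    proof -
      have "norm (y - c) / t \<le> (t * (r / 2)) / t" using that t unfolding tr by (intro divide_right_mono) auto
      then have "norm ((1 / t) *\<^sub>R (y - c)) \<le> r / 2" using t by (simp only: norm_scaleR) simp
      then have "b + (1 / t) *\<^sub>R (y - c) \<in> interior T"
        using b(1) by (auto simp: dist_norm)
      then have "(1 - t) *\<^sub>R x + t *\<^sub>R (b + (1 / t) *\<^sub>R (y - c)) \<in> interior T"
        using T(1) x t by (intro convexD_alt convex_interior) auto
      moreover have "(1 - t) *\<^sub>R x + t *\<^sub>R (b + (1 / t) *\<^sub>R (y - c)) = y"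
        using t by (simp add: c_def algebra_simps)
      ultimately show ?thesis by simp
    qed
    have "\<forall>z\<in>grid k. \<exists>w\<in>X. dist (c + \<delta> *\<^sub>R z) w \<le> h"
    proof
      fix z :: "real^'n" assume z: "z \<in> grid k"
      have "norm (\<delta> *\<^sub>R z) \<le> D * \<delta>"
        using norm_grid_le[OF z] \<open>\<delta> > 0\<close> by (simp add: D_def mult.commute[of \<delta>])
      then have "c + \<delta> *\<^sub>R z \<in> T" using inT[of "c + \<delta> *\<^sub>R z"] interior_subset by auto
      then show "\<exists>w\<in>X. dist (c + \<delta> *\<^sub>R z) w \<le> h" using X by blast
    qed
    then obtain \<zeta> where \<zeta>: "\<And>z. z \<in> grid k \<Longrightarrow> \<zeta> z \<in> X" "\<And>z. z \<in> grid k \<Longrightarrow> dist (c + \<delta> *\<^sub>R z) (\<zeta> z) \<le> h"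
      by metis
    have "h \<le> \<delta>" using \<open>\<delta> * \<epsilon> = h\<close> \<open>\<epsilon> \<le> 1 / 4\<close> \<open>\<delta> > 0\<close> mult_left_mono[of \<epsilon> 1 \<delta>] by simp
    show ?thesis
      unfolding \<delta>_def[symmetric]
    proof (intro exI[of _ c] exI[of _ \<zeta>] conjI ballI)
      show "cball c (\<delta> * \<epsilon>) \<subseteq> interior T"
      proof
        fix y assume "y \<in> cball c (\<delta> * \<epsilon>)"
        then have "norm (y - c) \<le> 1 * \<delta>" using \<open>h \<le> \<delta>\<close> \<open>\<delta> * \<epsilon> = h\<close> by (simp add: dist_norm norm_minus_commute)
        also have "\<dots> \<le> D * \<delta>" using \<open>2 \<le> D\<close> \<open>\<delta> > 0\<close> by (intro mult_right_mono) auto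
        finally show "y \<in> interior T" by (rule inT)
      qed
      have nc: "norm (x - c) = t * norm (b - x)" using t by (simp add: c_def)
      have "\<delta> \<le> D / 2 * \<delta>" using \<open>2 \<le> D\<close> \<open>\<delta> > 0\<close> by simp
      also have "\<dots> = t * (r / 4)" using tr by simp
      also have "\<dots> \<le> norm (x - c)" unfolding nc using b t by (intro mult_left_mono) auto
      finally show "\<delta> \<le> norm (x - c)" .
      have "b \<in> T" using b(1) r interior_subset[of T] by (auto simp: subset_iff)
      then have "norm (b - x) \<le> \<Delta>" using \<Delta>[of b x] x interior_subset[of T] by (auto simp: dist_norm)
      then have "norm (x - c) \<le> t * \<Delta>" unfolding nc using t by (intro mult_left_mono) auto
      also have "\<dots> = \<kappa> * \<Delta> * \<delta>" by (simp add: t_def)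
      also have "\<dots> \<le> max 1 (\<kappa> * \<Delta>) * \<delta>" using \<open>\<delta> > 0\<close> by (intro mult_right_mono) auto
      finally show "norm (x - c) \<le> max 1 (\<kappa> * \<Delta>) * \<delta>" .
      fix z :: "real^'n" assume z: "z \<in> grid k"
      show near: "norm (\<zeta> z - (c + \<delta> *\<^sub>R z)) \<le> \<delta> * \<epsilon>"
        using \<zeta>(2)[OF z] \<open>\<delta> * \<epsilon> = h\<close> by (simp add: dist_norm norm_minus_commute)
      have "norm (\<zeta> z - c) \<le> norm (\<zeta> z - (c + \<delta> *\<^sub>R z)) + norm (\<delta> *\<^sub>R z)"
        using norm_triangle_ineq[of "\<zeta> z - (c + \<delta> *\<^sub>R z)" "\<delta> *\<^sub>R z"] by (simp add: algebra_simps)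
      also have "\<dots> \<le> \<delta> + real (CARD('n) * k) * \<delta>"
        using near \<open>\<delta> * \<epsilon> = h\<close> \<open>h \<le> \<delta>\<close> norm_grid_le[OF z] \<open>\<delta> > 0\<close> by (intro add_mono) (auto simp: mult.commute[of \<delta>])
      also have "\<dots> = D * \<delta>" by (simp add: D_def algebra_simps)
      finally show "\<zeta> z \<in> X \<inter> interior T" using \<zeta>(1)[OF z] inT by blast
    qed
  qed
  note ex = this
  show ?thesis
  proof (rule exI[of _ "max 1 (\<kappa> * \<Delta>)"], rule conjI[rotated], rule exI[of _ "\<epsilon> / \<kappa>"], intro conjI allI impI)
    show "0 < \<epsilon> / \<kappa>" using \<open>0 < \<epsilon>\<close> \<open>0 < \<kappa>\<close> by simp
  qed ((rule ex; assumption), simp)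
qed

text \<open>That X meets T is asserted together with the estimate because \<open>Max\<close> is only
  meaningful on a nonempty set; the norming points, which lie in the interior of T, supply it. The
  constants are fixed before X and u.\<close>

lemma sampling_inequality:
  fixes T :: "(real^'n::finite) set" and k :: nat and p :: real and q :: ennreal and \<gamma> :: "'n \<Rightarrow> nat"
  defines "m \<equiv> mi_order \<gamma>" and "d \<equiv> real CARD('n)"
  assumes p: "1 \<le> p" and q: "1 \<le> q"
    and k1: "p > 1 \<Longrightarrow> real k > real m + d / p" and k2: "p = 1 \<Longrightarrow> k \<ge> m + CARD('n)"
    and T: "convex T" "bounded T" "interior T \<noteq> {}"
  shows "\<exists>C>0. \<exists>h\<^sub>0>0. \<forall>X h (u :: real^'n \<Rightarrow> 'b::euclidean_space).
    finite X \<longrightarrow> 0 < h \<longrightarrow> h \<le> h\<^sub>0 \<longrightarrow> (\<forall>y\<in>T. \<exists>z\<in>X. dist y z \<le> h) \<longrightarrow> u \<in> sobolev_space k p T \<longrightarrow> continuous_on T u \<longrightarrow>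
    X \<inter> T \<noteq> {} \<and> eLp_norm q T (weak_deriv T \<gamma> u) \<le> ennreal (C * (h powr (real k - real m - max 0 (d / p - enn2real (ennreal d / q))) * sobolev_seminorm k p T u
      + h powr (- real m) * Max ((\<lambda>x. norm (u x)) ` (X \<inter> T))))"
proof -
  have "d \<ge> 1" unfolding d_def by (simp add: Suc_le_eq)
  have "m < k"
  proof (cases "p = 1")
    case True
    moreover have "CARD('n) > 0" by simp
    ultimately show ?thesis using k2 by linarith
  next
    case False
    then have "0 < d / p" "real k > real m + d / p" using p \<open>d \<ge> 1\<close> k1 by auto
    then show ?thesis by linarith
  qed
  then have "k > 0" by simp
  let ?T = "interior T" and ?J = "{js :: 'n list. length js = k}"
  define P where "P \<epsilon> R C S \<longleftrightarrow> (\<forall>(T :: (real^'n) set) (u :: real^'n \<Rightarrow> 'b) G x c \<delta> \<zeta> M I is.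
     open T \<longrightarrow> convex T \<longrightarrow> (\<forall>js. length js \<le> k \<longrightarrow> has_weak_deriv T (count_list js) u (G js)) \<longrightarrow> continuous_on T u \<longrightarrow>
     0 < \<delta> \<longrightarrow> cball c (\<delta> * \<epsilon>) \<subseteq> T \<longrightarrow> x \<in> T \<longrightarrow> \<delta> \<le> norm (x - c) \<longrightarrow> norm (x - c) \<le> R * \<delta> \<longrightarrow>
     (\<forall>z\<in>grid k. \<zeta> z \<in> T \<and> norm (\<zeta> z - (c + \<delta> *\<^sub>R z)) \<le> \<delta> * \<epsilon> \<and> norm (u (\<zeta> z)) \<le> M) \<longrightarrow> length is = m \<longrightarrow>
     (\<forall>K. compact K \<longrightarrow> K \<subseteq> T \<longrightarrow> x \<in> interior K \<longrightarrow> lebesgue_point (\<lambda>y. indicator K y *\<^sub>R G is y) x) \<longrightarrow>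
     (\<Sum>js | length js = k. powr_integral p (T \<inter> cball x (S * \<delta>)) (G js)) \<le> ennreal I \<longrightarrow> 0 \<le> I \<longrightarrow>
     \<delta> ^ m * norm (G is x) \<le> C * (M + \<delta> powr (real k - real CARD('n) / p) * I powr (1 / p)))" for \<epsilon> R C S :: real
  have "\<exists>\<epsilon>>0. \<epsilon> \<le> 1 / 4 \<and> (\<forall>R\<ge>1. \<exists>C\<ge>0. \<exists>S\<ge>1. P \<epsilon> R C S)"
    unfolding P_def using k1 k2 by (intro weak_deriv_pointwise_estimate p \<open>m < k\<close>) (auto simp: d_def)
  then obtain \<epsilon> where "\<epsilon> > 0" "\<epsilon> \<le> 1 / 4" and P: "\<forall>R\<ge>1. \<exists>C\<ge>0. \<exists>S\<ge>1. P \<epsilon> R C S"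
    by (elim exE conjE)
  obtain R h\<^sub>0 where "R \<ge> 1" "h\<^sub>0 > 0" and loc: "\<And>X h x. 0 < h \<Longrightarrow> h \<le> h\<^sub>0 \<Longrightarrow> (\<forall>y\<in>T. \<exists>z\<in>X. dist y z \<le> h) \<Longrightarrow> x \<in> ?T \<Longrightarrow>
    (\<exists>c \<zeta>. cball c (h / \<epsilon> * \<epsilon>) \<subseteq> ?T \<and> h / \<epsilon> \<le> norm (x - c) \<and> norm (x - c) \<le> R * (h / \<epsilon>) \<and>
      (\<forall>z\<in>grid k. \<zeta> z \<in> X \<inter> ?T \<and> norm (\<zeta> z - (c + (h / \<epsilon>) *\<^sub>R z)) \<le> h / \<epsilon> * \<epsilon>))"
    using local_norming_points[OF T \<open>k > 0\<close> \<open>\<epsilon> > 0\<close> \<open>\<epsilon> \<le> 1 / 4\<close>] by blast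
  obtain C S where "C \<ge> 0" "S \<ge> 1" and PC: "P \<epsilon> R C S" using P \<open>R \<ge> 1\<close> by blast
  obtain "is" :: "'n list" where "is": "count_list is = \<gamma>" using count_list_surj by blast
  have len_count: "mi_order (count_list js) = length js" for js :: "'n list"
    unfolding mi_order_def by (rule sum_count_set) auto
  then have len: "length is = m" using "is" m_def by metis
  define N where "N = real (card ?J)"
  define V where "V = measure lborel ?T"
  have V: "emeasure lborel ?T \<le> ennreal V" "0 \<le> V"
  proof -
    have "emeasure lborel ?T < \<infinity>"
      by (rule emeasure_bounded_finite[OF bounded_subset[OF T(2) interior_subset]])
    then show "emeasure lborel ?T \<le> ennreal V" unfolding V_def by (subst emeasure_eq_ennreal_measure) auto
  qed (simp add: V_def)
  \<comment> \<open>\<open>e\<close> is the exponent of the ball volume; the identity below combines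
    the gain \<delta>^(d e) with the loss \<delta>^(- d/p) into \<delta>^(- \<theta>).\<close>
  define e where "e = min (1 / p) (enn2real (1 / q))"
  define \<theta> where "\<theta> = max 0 (d / p - enn2real (ennreal d / q))"
  have \<theta>: "- (d / p) + d * e = - \<theta>"
  proof -
    have "ennreal d / q = ennreal d * (1 / q)" by (simp add: divide_ennreal_def)
    then have "enn2real (ennreal d / q) = d * enn2real (1 / q)" using \<open>d \<ge> 1\<close> by (simp add: enn2real_mult)
    moreover have "d * e = min (d / p) (d * enn2real (1 / q))"
      using \<open>d \<ge> 1\<close> by (simp add: e_def min_mult_distrib_left)
    ultimately show ?thesis by (auto simp: \<theta>_def)
  qed
  define \<omega> where "\<omega> = unit_ball_vol d"
  have "\<omega> > 0" using \<open>d \<ge> 1\<close> by (simp add: \<omega>_def)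
  \<comment> \<open>The powers of 1/\<epsilon> appear because the pointwise estimate is in terms of
    \<delta> = h/\<epsilon>.\<close>
  define C1 where "C1 = 4 * (1 + V) * C * (\<omega> * S ^ CARD('n)) powr e * N powr (1 / p) * (1 / \<epsilon>) powr (real k - real m - \<theta>)"
  define C2 where "C2 = 4 * (1 + V) * C * (1 / \<epsilon>) powr (- real m)"
  have "C1 \<ge> 0" "C2 \<ge> 0" using V \<open>C \<ge> 0\<close> by (auto simp: C1_def C2_def)
  have "X \<inter> T \<noteq> {} \<and> eLp_norm q T (weak_deriv T \<gamma> u) \<le> ennreal ((C1 + C2 + 1) * (h powr (real k - real m - \<theta>) * sobolev_seminorm k p T u
      + h powr (- real m) * Max ((\<lambda>x. norm (u x)) ` (X \<inter> T))))"
    if X: "finite X" "\<forall>y\<in>T. \<exists>z\<in>X. dist y z \<le> h" and h: "0 < h" "h \<le> h\<^sub>0" and u: "u \<in> sobolev_space k p T" "continuous_on T u"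
    for X h and u :: "real^'n \<Rightarrow> 'b"
  proof -
    define \<delta> where "\<delta> = h / \<epsilon>"
    have "\<delta> > 0" using h \<open>\<epsilon> > 0\<close> by (simp add: \<delta>_def)
    define G where "G js = weak_deriv T (count_list js) u" for js
    define M where "M = Max ((\<lambda>x. norm (u x)) ` (X \<inter> T))"
    have M: "norm (u x) \<le> M" if "x \<in> X \<inter> T" for x
      unfolding M_def using that X by (intro Max_ge) auto
    have "X \<inter> T \<noteq> {}"
    proof -
      obtain x where "x \<in> ?T" using T(3) by blast
      from loc[OF h X(2) this] obtain c \<zeta> where
        "\<forall>z\<in>grid k. \<zeta> z \<in> X \<inter> ?T \<and> norm (\<zeta> z - (c + (h / \<epsilon>) *\<^sub>R z)) \<le> h / \<epsilon> * \<epsilon>"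
        by (elim exE conjE)
      moreover have "vec_lambda (\<lambda>i. 1 + real 0) \<in> (grid k :: (real^'n) set)"
        unfolding grid_def using \<open>k > 0\<close> by (intro image_eqI[of _ _ "\<lambda>_. 0"]) auto
      ultimately obtain y where "y \<in> X \<inter> ?T" by blast
      then show ?thesis using interior_subset by blast
    qed
    then have "0 \<le> M" using M norm_ge_zero order_trans by blast
    have Gw: "has_weak_deriv T (count_list js) u (G js)" "powr_integral p T (G js) < \<infinity>"
      "G js \<in> borel_measurable (lebesgue_on T)" if "length js \<le> k" for js
      using sobolev_weak_deriv[OF u(1) T(1) p, of "count_list js"] that len_count by (auto simp: G_def)
    \<comment> \<open>Derivatives are indexed by lists here and by multi-indices in the seminorm;
      each of the \<open>N\<close> lists is simply charged with the whole sum over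
      multi-indices.\<close>
    define J where "J = N * enn2real (sobolev_integral k p T u)"
    have "J \<ge> 0" by (simp add: J_def N_def)
    have sum_le: "(\<Sum>js\<in>?J. powr_integral p ?T (G js)) \<le> ennreal J"
    proof -
      have "(\<Sum>js\<in>?J. powr_integral p ?T (G js)) \<le> (\<Sum>js\<in>?J. sobolev_integral k p T u)"
      proof (rule sum_mono)
        fix js assume "js \<in> ?J"
        have "powr_integral p ?T (G js) \<le> powr_integral p T (G js)" by (intro powr_integral_subset interior_subset)
        also have "\<dots> \<le> sobolev_integral k p T u"
          unfolding sobolev_integral_def G_def using \<open>js \<in> ?J\<close> len_count
          by (intro member_le_sum[of "count_list js" _ "\<lambda>\<gamma>. powr_integral p T (weak_deriv T \<gamma> u)"]) auto
        finally show "powr_integral p ?T (G js) \<le> sobolev_integral k p T u" .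
      qed
      also have "\<dots> = ennreal J"
        using sobolev_seminorm_eq(1)[OF u(1) T(1) p]
        by (simp add: J_def N_def ennreal_mult ennreal_of_nat_eq_real_of_nat less_top)
      finally show ?thesis .
    qed
    have "\<exists>F'. F' \<in> borel_measurable borel \<and> (AE z in lborel. ennreal (norm (G js z) powr p) * indicator ?T z = F' z)" if "js \<in> ?J" for js
    proof -
      have "G js \<in> borel_measurable (lebesgue_on ?T)"
        using measurable_restrict_mono[OF Gw(3) interior_subset] that by simp
      then have [measurable]: "(\<lambda>z. if z \<in> ?T then G js z else 0) \<in> borel_measurable lebesgue"
        by (intro borel_measurable_if_I) auto
      have "(\<lambda>z. ennreal (norm (if z \<in> ?T then G js z else 0) powr p)) \<in> borel_measurable lebesgue" by measurable
      also have "(\<lambda>z. ennreal (norm (if z \<in> ?T then G js z else 0) powr p)) = (\<lambda>z. ennreal (norm (G js z) powr p) * indicator ?T z)"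
        using p by (auto simp: indicator_def)
      finally show ?thesis using completion_ex_borel_measurable by fastforce
    qed
    then have "\<forall>js\<in>?J. \<exists>F'. F' \<in> borel_measurable borel \<and> (AE z in lborel. ennreal (norm (G js z) powr p) * indicator ?T z = F' z)"
      by (rule ballI)
    from bchoice[OF this] obtain F' where F'0: "\<forall>js\<in>?J. F' js \<in> borel_measurable borel \<and>
        (AE z in lborel. ennreal (norm (G js z) powr p) * indicator ?T z = F' js z)" by (elim exE)
    have F': "F' js \<in> borel_measurable borel" "AE z in lborel. ennreal (norm (G js z) powr p) * indicator ?T z = F' js z"
      if "js \<in> ?J" for js
      using F'0[rule_format, OF that] by auto
    \<comment> \<open>A Borel representative of the summed p-th powers on the interior, fit for
      Fubini's theorem.\<close>
    define F where "F z = (\<Sum>js\<in>?J. F' js z)" for z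
    have Fmeas [measurable]: "F \<in> borel_measurable borel" unfolding F_def using F'(1) by measurable
    have F_int: "(\<Sum>js\<in>?J. powr_integral p (?T \<inter> A) (G js)) = (\<integral>\<^sup>+z. F z * indicator A z \<partial>lborel)"
      if [measurable]: "A \<in> sets borel" for A
    proof -
      have "powr_integral p (?T \<inter> A) (G js) = (\<integral>\<^sup>+z. F' js z * indicator A z \<partial>lborel)" if "js \<in> ?J" for js
        unfolding powr_integral_def nn_integral_completion
        by (rule nn_integral_cong_AE) (use F'(2)[OF that] in eventually_elim, auto simp: indicator_def)
      then have "(\<Sum>js\<in>?J. powr_integral p (?T \<inter> A) (G js)) = (\<integral>\<^sup>+z. (\<Sum>js\<in>?J. F' js z * indicator A z) \<partial>lborel)"
        using F'(1) by (subst nn_integral_sum) auto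
      then show ?thesis by (simp add: F_def sum_distrib_right)
    qed
    have FJ: "(\<integral>\<^sup>+z. F z \<partial>lborel) \<le> ennreal J"
      using F_int[of UNIV] sum_le by simp
    have pt: "AE x in lebesgue. x \<in> ?T \<longrightarrow> norm (G is x) \<le> C * \<delta> powr (- real m) * M +
        C * \<delta> powr (real k - d / p - real m) * enn2real (\<integral>\<^sup>+z. F z * indicator (cball x (S * \<delta>)) z \<partial>lborel) powr (1 / p)"
    proof -
      have "locally_integrable T (G is)" using Gw(1)[of "is"] len \<open>m < k\<close> by (auto simp: has_weak_deriv_def)
      from locally_integrable_AE_lebesgue_point[OF this] show ?thesis
      proof eventually_elim
        case (elim x)
        show ?case
        proof
          assume x: "x \<in> ?T"
          from loc[OF h X(2) x] obtain c \<zeta> where c: "cball c (\<delta> * \<epsilon>) \<subseteq> ?T" "\<delta> \<le> norm (x - c)" "norm (x - c) \<le> R * \<delta>"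
            and \<zeta>: "\<forall>z\<in>grid k. \<zeta> z \<in> X \<inter> ?T \<and> norm (\<zeta> z - (c + \<delta> *\<^sub>R z)) \<le> \<delta> * \<epsilon>"
            unfolding \<delta>_def[symmetric] by blast
          let ?I = "enn2real (\<integral>\<^sup>+z. F z * indicator (cball x (S * \<delta>)) z \<partial>lborel)"
          have "(\<integral>\<^sup>+z. F z * indicator (cball x (S * \<delta>)) z \<partial>lborel) \<le> ennreal J"
            by (rule order_trans[OF nn_integral_mono FJ]) (auto simp: indicator_def)
          then have I: "(\<Sum>js\<in>?J. powr_integral p (?T \<inter> cball x (S * \<delta>)) (G js)) \<le> ennreal ?I"
            using neq_top_trans[OF ennreal_neq_top] by (simp add: F_int ennreal_enn2real_if)
          have W: "\<forall>js. length js \<le> k \<longrightarrow> has_weak_deriv ?T (count_list js) u (G js)"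
            using Gw(1) has_weak_deriv_subset[OF _ interior_subset] by blast
          have \<zeta>': "\<forall>z\<in>grid k. \<zeta> z \<in> ?T \<and> norm (\<zeta> z - (c + \<delta> *\<^sub>R z)) \<le> \<delta> * \<epsilon> \<and> norm (u (\<zeta> z)) \<le> M"
            using \<zeta> M interior_subset[of T] by blast
          have "\<delta> ^ m * norm (G is x) \<le> C * (M + \<delta> powr (real k - real CARD('n) / p) * ?I powr (1 / p))"
            using elim x
            by (intro PC[unfolded P_def, rule_format, OF open_interior convex_interior[OF T(1)] W[rule_format]
                continuous_on_subset[OF u(2) interior_subset] \<open>\<delta> > 0\<close> c(1) x c(2,3) \<zeta>'[rule_format] len _ I]) auto
          then have "\<delta> powr (- real m) * (\<delta> ^ m * norm (G is x)) \<le> \<delta> powr (- real m) * (C * (M + \<delta> powr (real k - d / p) * ?I powr (1 / p)))"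
            unfolding d_def by (intro mult_left_mono) auto
          moreover have "\<delta> powr (- real m) * (\<delta> ^ m * norm (G is x)) = norm (G is x)"
            using \<open>\<delta> > 0\<close> by (simp add: powr_realpow[symmetric] powr_add[symmetric] mult.assoc[symmetric])
          moreover have "\<delta> powr (- real m) * (C * (M + \<delta> powr (real k - d / p) * ?I powr (1 / p))) =
              C * \<delta> powr (- real m) * M + C * (\<delta> powr (- real m) * \<delta> powr (real k - d / p)) * ?I powr (1 / p)"
            by (simp add: algebra_simps)
          moreover have "\<delta> powr (- real m) * \<delta> powr (real k - d / p) = \<delta> powr (real k - d / p - real m)"
            by (simp add: powr_add[symmetric])
          ultimately show "norm (G is x) \<le> C * \<delta> powr (- real m) * M + C * \<delta> powr (real k - d / p - real m) * ?I powr (1 / p)"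
            by simp
        qed
      qed
    qed
    define W where "W = \<omega> * (S * \<delta>) ^ CARD('n)"
    have "W > 0" using \<open>\<omega> > 0\<close> \<open>S \<ge> 1\<close> \<open>\<delta> > 0\<close> by (simp add: W_def)
    have Wle: "emeasure lborel (cball (0 :: real^'n) (S * \<delta>)) \<le> ennreal W"
      using \<open>S \<ge> 1\<close> \<open>\<delta> > 0\<close> by (simp add: emeasure_cball W_def \<omega>_def d_def)
    have gmeas: "G is \<in> borel_measurable (lebesgue_on T)" using Gw(3)[of "is"] len \<open>m < k\<close> by simp
    have "eLp_norm q T (G is) \<le> ennreal (4 * (1 + V) * (C * \<delta> powr (- real m) * M +
        C * \<delta> powr (real k - d / p - real m) * (W powr e * J powr (1 / p))))"
      unfolding e_def using \<open>C \<ge> 0\<close> \<open>0 \<le> M\<close>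
      by (intro eLp_norm_le_of_pointwise[OF T(1) V gmeas Fmeas FJ \<open>J \<ge> 0\<close> p q Wle \<open>W > 0\<close> _ _ pt]) auto
    also have "4 * (1 + V) * (C * \<delta> powr (- real m) * M + C * \<delta> powr (real k - d / p - real m) * (W powr e * J powr (1 / p))) =
        C1 * (h powr (real k - real m - \<theta>) * sobolev_seminorm k p T u) + C2 * (h powr (- real m) * M)"
    proof -
      let ?a = "real k - real m - \<theta>" and ?s = "sobolev_seminorm k p T u"
      have Jp: "J powr (1 / p) = N powr (1 / p) * ?s"
        by (simp add: J_def powr_mult sobolev_seminorm_eq(2)[OF u(1) T(1) p])
      have We: "W powr e = (\<omega> * S ^ CARD('n)) powr e * \<delta> powr (d * e)"
        using \<open>\<delta> > 0\<close> by (simp add: W_def power_mult_distrib powr_mult powr_realpow[symmetric] powr_powr d_def)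
      have "real k - d / p - real m + d * e = ?a" using \<theta> by linarith
      then have exps: "\<delta> powr (real k - d / p - real m) * \<delta> powr (d * e) = \<delta> powr ?a"
        by (simp only: powr_add[symmetric])
      have \<delta>h: "\<delta> powr a = (1 / \<epsilon>) powr a * h powr a" for a
        by (simp add: \<delta>_def powr_mult[symmetric])
      have "C * \<delta> powr (real k - d / p - real m) * (W powr e * J powr (1 / p)) =
          (\<delta> powr (real k - d / p - real m) * \<delta> powr (d * e)) * (C * (\<omega> * S ^ CARD('n)) powr e * N powr (1 / p) * ?s)"
        unfolding Jp We by (simp only: mult_ac)
      also have "\<dots> = ((1 / \<epsilon>) powr ?a * h powr ?a) * (C * (\<omega> * S ^ CARD('n)) powr e * N powr (1 / p) * ?s)"
        unfolding exps \<delta>h[of ?a] ..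
      finally have E: "C * \<delta> powr (real k - d / p - real m) * (W powr e * J powr (1 / p)) =
          ((1 / \<epsilon>) powr ?a * h powr ?a) * (C * (\<omega> * S ^ CARD('n)) powr e * N powr (1 / p) * ?s)" .
      show ?thesis
        unfolding E C1_def C2_def \<delta>h[of "- real m"] distrib_left[of "4 * (1 + V)"] by (simp only: mult_ac add.commute)
    qed
    also have "\<dots> \<le> (C1 + C2 + 1) * (h powr (real k - real m - \<theta>) * sobolev_seminorm k p T u) + (C1 + C2 + 1) * (h powr (- real m) * M)"
      using \<open>C1 \<ge> 0\<close> \<open>C2 \<ge> 0\<close> \<open>0 \<le> M\<close> by (intro add_mono mult_right_mono) (auto simp: sobolev_seminorm_def)
    finally have "eLp_norm q T (G is) \<le> ennreal ((C1 + C2 + 1) * (h powr (real k - real m - \<theta>) * sobolev_seminorm k p T u + h powr (- real m) * M))"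
      by (simp add: distrib_left ennreal_leI)
    with \<open>X \<inter> T \<noteq> {}\<close> "is" show ?thesis by (simp add: G_def M_def)
  qed
  note est = this
  show ?thesis
    unfolding \<theta>_def[symmetric]
  proof (rule exI[of _ "C1 + C2 + 1"], rule conjI[rotated], rule exI[of _ h\<^sub>0], intro conjI allI impI)
    show "0 < h\<^sub>0" by fact
    show "0 < C1 + C2 + 1" using \<open>C1 \<ge> 0\<close> \<open>C2 \<ge> 0\<close> by simp
  next
    fix X h and u :: "real^'n \<Rightarrow> 'b"
    assume "finite X" "0 < h" "h \<le> h\<^sub>0" "\<forall>y\<in>T. \<exists>z\<in>X. dist y z \<le> h" "u \<in> sobolev_space k p T" "continuous_on T u"
    from est[OF this(1,4,2,3,5,6)]
    show "X \<inter> T \<noteq> {}" "eLp_norm q T (weak_deriv T \<gamma> u) \<le> ennreal ((C1 + C2 + 1) * (h powr (real k - real m - \<theta>) * sobolev_seminorm k p T u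
      + h powr (- real m) * Max ((\<lambda>x. norm (u x)) ` (X \<inter> T))))" by (rule conjunct1, rule conjunct2)
  qed
qed

section \<open>Least squares and singular values\<close>

text \<open>The class describes conjugation only through the product of x with its conjugate; on a
  nonzero real number the value follows by cancelling.\<close>

lemma conjugate_of_real: "conjugate (of_real t :: 'b::real_or_complex) = of_real t"
proof (cases "t = 0")
  case False
  have "conjugate (of_real t :: 'b) * of_real t = of_real t * of_real t"
    using conjugate_mult_self[of "of_real t :: 'b"] by (simp add: of_real_def power2_eq_square)
  then show ?thesis using False by simp
qed simp

lemma vec_norm2_sq: "(vec_norm2 v)\<^sup>2 = (\<Sum>i<dim_vec v. (norm (v $ i))\<^sup>2)"
  by (simp add: vec_norm2_def L2_set_def sum_nonneg)

lemma vec_norm2_nonneg [simp]: "0 \<le> vec_norm2 v"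
  by (simp add: vec_norm2_def)

lemma cscalar_prod_self:
  fixes v :: "'b::real_or_complex vec"
  shows "v \<bullet>c v = of_real ((vec_norm2 v)\<^sup>2)"
proof -
  have "x * conjugate x = of_real ((norm x)\<^sup>2)" for x :: 'b
    using conjugate_mult_self[of x] by (simp add: of_real_def mult.commute)
  then show ?thesis
    by (simp add: scalar_prod_def vec_norm2_sq atLeast0LessThan)
qed

lemma vec_norm2_eq_0_iff:
  fixes v :: "'b::real_or_complex vec"
  assumes "v \<in> carrier_vec n" shows "vec_norm2 v = 0 \<longleftrightarrow> v = 0\<^sub>v n"
proof
  assume "vec_norm2 v = 0"
  then have "v $ i = 0" if "i < n" for i
    using that assms by (simp add: vec_norm2_def L2_set_eq_0_iff)
  then show "v = 0\<^sub>v n" using assms by (intro eq_vecI) auto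
qed (simp add: vec_norm2_def L2_set_eq_0_iff)

lemma vec_norm2_smult: "vec_norm2 (c \<cdot>\<^sub>v v) = norm (c :: 'b::real_normed_field) * vec_norm2 v"
proof -
  have "vec_norm2 (c \<cdot>\<^sub>v v) = L2_set (\<lambda>i. norm c * norm (v $ i)) {..<dim_vec v}"
    unfolding vec_norm2_def by (rule L2_set_cong) (auto simp: norm_mult)
  then show ?thesis by (simp add: vec_norm2_def L2_set_right_distrib)
qed

lemma vec_norm2_triangle:
  assumes "v \<in> carrier_vec n" "w \<in> carrier_vec n"
  shows "vec_norm2 (v :: 'b::real_normed_field vec) \<le> vec_norm2 (v - w) + vec_norm2 w"
proof -
  have "vec_norm2 v \<le> L2_set (\<lambda>i. norm ((v - w) $ i) + norm (w $ i)) {..<n}"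
    unfolding vec_norm2_def using assms norm_triangle_ineq[of "(v - w) $ i" "w $ i" for i]
    by (auto intro!: L2_set_mono) (metis diff_add_cancel norm_triangle_ineq)
  also have "\<dots> \<le> L2_set (\<lambda>i. norm ((v - w) $ i)) {..<n} + L2_set (\<lambda>i. norm (w $ i)) {..<n}"
    by (rule L2_set_triangle_ineq)
  finally show ?thesis using assms by (simp add: vec_norm2_def)
qed

lemma norm_index_le_vec_norm2: "i < dim_vec v \<Longrightarrow> norm (v $ i) \<le> vec_norm2 v"
  unfolding vec_norm2_def by (rule member_le_L2_set) auto

lemma mat_adjoint_carrier: "A \<in> carrier_mat r n \<Longrightarrow> mat_adjoint A \<in> carrier_mat n r"
  by (auto simp: mat_adjoint_def mat_of_rows_def)

lemma mat_adjoint_index: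
  "A \<in> carrier_mat r n \<Longrightarrow> i < n \<Longrightarrow> j < r \<Longrightarrow> mat_adjoint A $$ (i, j) = conjugate (A $$ (j, i))"
  by (auto simp: mat_adjoint_def mat_of_rows_def col_def)

lemma cscalar_prod_mat_adjoint:
  fixes A :: "'b::real_or_complex mat"
  assumes A: "A \<in> carrier_mat r n" and v: "v \<in> carrier_vec n" and w: "w \<in> carrier_vec r"
  shows "(A *\<^sub>v v) \<bullet>c w = v \<bullet>c (mat_adjoint A *\<^sub>v w)"
proof -
  have "(A *\<^sub>v v) \<bullet>c w = (\<Sum>i<r. (\<Sum>j<n. A $$ (i, j) * v $ j) * conjugate (w $ i))"
    using assms by (auto simp: scalar_prod_def atLeast0LessThan intro!: sum.cong)
  also have "\<dots> = (\<Sum>j<n. \<Sum>i<r. v $ j * conjugate (conjugate (A $$ (i, j)) * w $ i))"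
    by (subst sum.swap) (simp add: sum_distrib_left sum_distrib_right conjugate_dist_mul ac_simps)
  also have "\<dots> = v \<bullet>c (mat_adjoint A *\<^sub>v w)"
    using assms mat_adjoint_carrier[OF A]
    by (auto simp: scalar_prod_def atLeast0LessThan sum_conjugate sum_distrib_left mat_adjoint_index[OF A] intro!: sum.cong)
  finally show ?thesis .
qed

text \<open>Applied to R it expresses the Rayleigh quotient, applied to Q it shows that orthonormal
  columns preserve norms.\<close>

lemma mat_adjoint_mult_cscalar_prod:
  fixes R :: "'b::real_or_complex mat"
  assumes R: "R \<in> carrier_mat r n" and v: "v \<in> carrier_vec n" and w: "w \<in> carrier_vec n"
  shows "((mat_adjoint R * R) *\<^sub>v v) \<bullet>c w = (R *\<^sub>v v) \<bullet>c (R *\<^sub>v w)"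
proof -
  let ?A = "mat_adjoint R * R"
  have Rv: "R *\<^sub>v v \<in> carrier_vec r" "R *\<^sub>v w \<in> carrier_vec r" using R v w by auto
  have ad: "mat_adjoint R \<in> carrier_mat n r" by (rule mat_adjoint_carrier[OF R])
  have "(R *\<^sub>v w) \<bullet>c (R *\<^sub>v v) = w \<bullet>c (mat_adjoint R *\<^sub>v (R *\<^sub>v v))"
    by (rule cscalar_prod_mat_adjoint[OF R w Rv(1)])
  also have "mat_adjoint R *\<^sub>v (R *\<^sub>v v) = ?A *\<^sub>v v"
    using assoc_mult_mat_vec[OF ad R v] by simp
  finally have eq: "(R *\<^sub>v w) \<bullet>c (R *\<^sub>v v) = w \<bullet>c (?A *\<^sub>v v)" .
  have comm: "x \<bullet>c y = conjugate (y \<bullet>c x)" if "x \<in> carrier_vec k" "y \<in> carrier_vec k" for x y :: "'b vec" and k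
    using that by (simp add: scalar_prod_def sum_conjugate conjugate_dist_mul mult.commute)
  have Av: "?A *\<^sub>v v \<in> carrier_vec n" using ad R v by auto
  show ?thesis
    using eq comm[OF Av w] comm[OF Rv] by simp
qed

text \<open>A crude entrywise bound; the added 1 makes the constant positive also for the zero
  matrix.\<close>

lemma vec_norm2_mult_mat_vec_le:
  fixes A :: "'b::real_or_complex mat"
  assumes A: "A \<in> carrier_mat r n"
  shows "\<exists>K>0. \<forall>v\<in>carrier_vec n. vec_norm2 (A *\<^sub>v v) \<le> K * vec_norm2 v"
proof (intro exI conjI ballI)
  let ?K = "(\<Sum>i<r. \<Sum>j<n. norm (A $$ (i, j))) + 1"
  show "0 < ?K" by (intro add_nonneg_pos sum_nonneg) auto
  fix v :: "'b vec" assume v: "v \<in> carrier_vec n"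
  have "vec_norm2 (A *\<^sub>v v) \<le> (\<Sum>i<r. norm ((A *\<^sub>v v) $ i))"
  proof -
    have "dim_vec (A *\<^sub>v v) = r" using A by simp
    then show ?thesis
      using L2_set_le_sum[of "{..<r}" "\<lambda>i. norm ((A *\<^sub>v v) $ i)"] by (simp only: vec_norm2_def norm_ge_zero simp_thms)
  qed
  also have "\<dots> \<le> (\<Sum>i<r. \<Sum>j<n. norm (A $$ (i, j)) * vec_norm2 v)"
  proof (rule sum_mono)
    fix i assume "i \<in> {..<r}"
    then have "(A *\<^sub>v v) $ i = (\<Sum>j<n. A $$ (i, j) * v $ j)"
      using A v by (auto simp: scalar_prod_def atLeast0LessThan intro!: sum.cong)
    moreover have "norm (\<Sum>j<n. A $$ (i, j) * v $ j) \<le> (\<Sum>j<n. norm (A $$ (i, j)) * vec_norm2 v)"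
      using v norm_index_le_vec_norm2[of _ v] by (intro sum_norm_le) (auto simp: norm_mult intro!: mult_left_mono)
    ultimately show "norm ((A *\<^sub>v v) $ i) \<le> (\<Sum>j<n. norm (A $$ (i, j)) * vec_norm2 v)" by simp
  qed
  also have "\<dots> = (\<Sum>i<r. \<Sum>j<n. norm (A $$ (i, j))) * vec_norm2 v" by (simp only: sum_distrib_right)
  also have "\<dots> \<le> ?K * vec_norm2 v" by (intro mult_right_mono) auto
  finally show "vec_norm2 (A *\<^sub>v v) \<le> ?K * vec_norm2 v" .
qed

text \<open>If \<open>\<mu>\<close>, the infimum of the Rayleigh quotient, were not an eigenvalue, then
  \<open>B = R\<^sup>* R - \<mu> I\<close> would be invertible, and moving a near-minimizer \<open>v\<close> along
  \<open>w = B v\<close> would push the quotient below \<open>\<mu>\<close>. No compactness is needed.\<close>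

lemma rayleigh_infimum_eigenvalue:
  fixes R :: "'b::real_or_complex mat"
  assumes R: "R \<in> carrier_mat r n" and "0 < n"
  obtains \<mu> where "0 \<le> \<mu>" "eigenvalue (mat_adjoint R * R) (of_real \<mu>)"
    "\<And>v. v \<in> carrier_vec n \<Longrightarrow> \<mu> * (vec_norm2 v)\<^sup>2 \<le> (vec_norm2 (R *\<^sub>v v))\<^sup>2"
proof -
  let ?S = "{(vec_norm2 (R *\<^sub>v v))\<^sup>2 |v. v \<in> carrier_vec n \<and> vec_norm2 v = 1}"
  define \<mu> where "\<mu> = Inf ?S"
  have "vec_norm2 (unit_vec n 0 :: 'b vec) = 1"
  proof -
    have "(vec_norm2 (unit_vec n 0 :: 'b vec))\<^sup>2 = (\<Sum>i<n. if i = 0 then 1 else 0)"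
      unfolding vec_norm2_sq by (intro sum.cong) (auto simp: unit_vec_def)
    also have "\<dots> = 1" using \<open>0 < n\<close> by simp
    finally show ?thesis using vec_norm2_nonneg[of "unit_vec n 0 :: 'b vec"] by (simp add: power2_eq_1_iff)
  qed
  then have ne: "?S \<noteq> {}" by (auto intro!: exI[of _ "unit_vec n 0"])
  have bdd: "bdd_below ?S" by (intro bdd_belowI[of _ 0]) auto
  have "0 \<le> \<mu>" unfolding \<mu>_def by (intro cInf_greatest ne) auto
  have low: "\<mu> * (vec_norm2 v)\<^sup>2 \<le> (vec_norm2 (R *\<^sub>v v))\<^sup>2" if v: "v \<in> carrier_vec n" for v
  proof (cases "vec_norm2 v = 0")
    case False
    let ?u = "of_real (1 / vec_norm2 v) \<cdot>\<^sub>v v"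
    have "vec_norm2 ?u = 1" using False by (simp add: vec_norm2_smult norm_divide)
    then have "(vec_norm2 (R *\<^sub>v ?u))\<^sup>2 \<in> ?S" using v by auto
    then have "\<mu> \<le> (vec_norm2 (R *\<^sub>v ?u))\<^sup>2" unfolding \<mu>_def by (rule cInf_lower[OF _ bdd])
    also have "R *\<^sub>v ?u = of_real (1 / vec_norm2 v) \<cdot>\<^sub>v (R *\<^sub>v v)" using R v by (rule mult_mat_vec)
    also have "(vec_norm2 (of_real (1 / vec_norm2 v) \<cdot>\<^sub>v (R *\<^sub>v v)))\<^sup>2 = (vec_norm2 (R *\<^sub>v v))\<^sup>2 / (vec_norm2 v)\<^sup>2"
      by (simp add: vec_norm2_smult power_mult_distrib power_divide norm_divide)
    finally show ?thesis using False by (simp add: field_simps)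
  qed simp
  let ?A = "mat_adjoint R * R"
  let ?B = "char_matrix ?A (of_real \<mu>)"
  have A: "?A \<in> carrier_mat n n" using mat_adjoint_carrier[OF R] R by auto
  then have B: "?B \<in> carrier_mat n n" by simp
  have "eigenvalue ?A (of_real \<mu>)"
  proof (rule ccontr)
    assume "\<not> eigenvalue ?A (of_real \<mu>)"
    then have "det ?B \<noteq> 0" using eigenvalue_det[OF A] by blast
    from det_non_zero_imp_unit[OF B this, of "()"] obtain B' where B': "B' \<in> carrier_mat n n" "B' * ?B = 1\<^sub>m n"
      by (auto simp: Units_def ring_mat_def)
    obtain K where "K > 0" and K: "\<And>v. v \<in> carrier_vec n \<Longrightarrow> vec_norm2 (B' *\<^sub>v v) \<le> K * vec_norm2 v"
      using vec_norm2_mult_mat_vec_le[OF B'(1)] by blast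
    obtain L where "L > 0" and L: "\<And>v. v \<in> carrier_vec n \<Longrightarrow> vec_norm2 (R *\<^sub>v v) \<le> L * vec_norm2 v"
      using vec_norm2_mult_mat_vec_le[OF R] by blast
    have Bw: "?B *\<^sub>v x = ?A *\<^sub>v x - of_real \<mu> \<cdot>\<^sub>v x" if "x \<in> carrier_vec n" for x
    proof -
      have "((- of_real \<mu>) \<cdot>\<^sub>m 1\<^sub>m n) *\<^sub>v x = (- of_real \<mu>) \<cdot>\<^sub>v x"
        using that by (intro eq_vecI) (auto simp: row_smult)
      then have "?B *\<^sub>v x = ?A *\<^sub>v x + (- of_real \<mu>) \<cdot>\<^sub>v x"
        using that A unfolding char_matrix_def carrier_matD(1)[OF A]
        by (subst add_mult_distrib_mat_vec[of _ n n]) auto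
      also have "\<dots> = ?A *\<^sub>v x - of_real \<mu> \<cdot>\<^sub>v x"
        using that A by (intro eq_vecI) auto
      finally show ?thesis .
    qed
    \<comment> \<open>The quadratic form of \<open>?B\<close>, nonnegative because
      \<open>\<mu>\<close> is the infimum.\<close>
    define q where "q x = (vec_norm2 (R *\<^sub>v x))\<^sup>2 - \<mu> * (vec_norm2 x)\<^sup>2" for x
    have q0: "0 \<le> q x" if "x \<in> carrier_vec n" for x using low[OF that] by (simp add: q_def)
    have form: "(?B *\<^sub>v x) \<bullet>c y = (R *\<^sub>v x) \<bullet>c (R *\<^sub>v y) - of_real \<mu> * (x \<bullet>c y)" if "x \<in> carrier_vec n" "y \<in> carrier_vec n" for x y
    proof -
      have "(?B *\<^sub>v x) \<bullet>c y = (?A *\<^sub>v x) \<bullet>c y - (of_real \<mu> \<cdot>\<^sub>v x) \<bullet>c y"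
        unfolding Bw[OF that(1)] using that A by (intro minus_scalar_prod_distrib[of _ n]) auto
      then show ?thesis
        using that mat_adjoint_mult_cscalar_prod[OF R that] by simp
    qed
    have qform: "of_real (q x) = (?B *\<^sub>v x) \<bullet>c x" if "x \<in> carrier_vec n" for x
      using that by (simp add: form cscalar_prod_self q_def)
    have comm: "x \<bullet>c y = conjugate (y \<bullet>c x)" if "x \<in> carrier_vec k" "y \<in> carrier_vec k" for x y :: "'b vec" and k
      using that by (simp add: scalar_prod_def sum_conjugate conjugate_dist_mul mult.commute)
    have herm: "(?B *\<^sub>v x) \<bullet>c y = conjugate ((?B *\<^sub>v y) \<bullet>c x)" if "x \<in> carrier_vec n" "y \<in> carrier_vec n" for x y
    proof -
      have "R *\<^sub>v x \<in> carrier_vec r" "R *\<^sub>v y \<in> carrier_vec r" using that R by auto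
      then show ?thesis
        using comm[OF that] comm[of "R *\<^sub>v x" r "R *\<^sub>v y"] conjugate_of_real[of \<mu>, where 'b = 'b] that
        by (simp add: form conjugate_dist_mul conjugate_dist_add conjugate_neg diff_conv_add_uminus del: add_uminus_conv_diff)
    qed
    \<comment> \<open>The form is nonnegative at v - t B v; expanding it there, with
      \<open>?B\<close> Hermitian, gives the inequality.\<close>
    have step: "2 * t * (vec_norm2 (?B *\<^sub>v v))\<^sup>2 \<le> q v + t\<^sup>2 * q (?B *\<^sub>v v)" if v: "v \<in> carrier_vec n" for v and t :: real
    proof -
      define w where "w = ?B *\<^sub>v v"
      have w: "w \<in> carrier_vec n" using B v by (simp add: w_def)
      define x where "x = v - of_real t \<cdot>\<^sub>v w"
      have x: "x \<in> carrier_vec n" using v w by (simp add: x_def)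
      have Bx: "?B *\<^sub>v x = w - of_real t \<cdot>\<^sub>v (?B *\<^sub>v w)"
        unfolding x_def using B v w by (simp add: mult_minus_distrib_mat_vec mult_mat_vec w_def)
      have cx: "conjugate x = conjugate v - of_real t \<cdot>\<^sub>v conjugate w"
        using v w by (intro eq_vecI) (auto simp: x_def conjugate_dist_add conjugate_dist_mul conjugate_neg conjugate_of_real diff_conv_add_uminus simp del: add_uminus_conv_diff)
      have BwC: "?B *\<^sub>v w \<in> carrier_vec n" using B w by simp
      have "(?B *\<^sub>v x) \<bullet>c x = w \<bullet>c v - of_real t * (w \<bullet>c w) - of_real t * ((?B *\<^sub>v w) \<bullet>c v) + of_real t * of_real t * ((?B *\<^sub>v w) \<bullet>c w)"
        unfolding Bx cx using v w BwC
        by (simp add: minus_scalar_prod_distrib[of _ n] scalar_prod_minus_distrib[of _ n] algebra_simps)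
      moreover have "(?B *\<^sub>v w) \<bullet>c v = of_real ((vec_norm2 w)\<^sup>2)"
        using herm[OF w v] by (simp add: w_def[symmetric] cscalar_prod_self conjugate_of_real del: of_real_power)
      ultimately have "of_real (q x) = (of_real (q v - 2 * t * (vec_norm2 w)\<^sup>2 + t\<^sup>2 * q w) :: 'b)"
        using qform[OF x] qform[OF v] qform[OF w] by (simp add: w_def[symmetric] cscalar_prod_self power2_eq_square algebra_simps)
      then have "q x = q v - 2 * t * (vec_norm2 w)\<^sup>2 + t\<^sup>2 * q w" by (simp only: of_real_eq_iff)
      then show ?thesis using q0[OF x] by (simp add: w_def)
    qed
    \<comment> \<open>For w = B v, the choice t = 1 / L^2 gives |w|^2 / L^2 \<le> q v, while the
      inverse of \<open>?B\<close> gives |w| \<ge> 1 / K. A near-minimizer with q v below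
      \<open>\<eta>\<close> contradicts this.\<close>
    define \<eta> where "\<eta> = 1 / (L * K)\<^sup>2"
    have "\<eta> > 0" using \<open>L > 0\<close> \<open>K > 0\<close> by (simp add: \<eta>_def)
    then obtain s where "s \<in> ?S" "s < \<mu> + \<eta>"
      using cInf_lessD[OF ne, of "\<mu> + \<eta>"] by (auto simp: \<mu>_def)
    then obtain v where v: "v \<in> carrier_vec n" "vec_norm2 v = 1" "(vec_norm2 (R *\<^sub>v v))\<^sup>2 < \<mu> + \<eta>" by auto
    let ?w = "?B *\<^sub>v v"
    have w: "?w \<in> carrier_vec n" using B v by simp
    have "B' *\<^sub>v ?w = v"
      using assoc_mult_mat_vec[OF B'(1) B v(1)] B' v by simp
    then have "1 \<le> K * vec_norm2 ?w" using K[OF w] v by simp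
    then have "1 \<le> (K * vec_norm2 ?w)\<^sup>2" by (simp add: one_le_power)
    have "q ?w \<le> (L * vec_norm2 ?w)\<^sup>2"
    proof -
      have "(vec_norm2 (R *\<^sub>v ?w))\<^sup>2 \<le> (L * vec_norm2 ?w)\<^sup>2" using L[OF w] by (intro power_mono) auto
      then show ?thesis using \<open>0 \<le> \<mu>\<close> mult_nonneg_nonneg[OF \<open>0 \<le> \<mu>\<close> zero_le_power2[of "vec_norm2 ?w"]] unfolding q_def by linarith
    qed
    then have "(1 / L\<^sup>2)\<^sup>2 * q ?w \<le> (1 / L\<^sup>2)\<^sup>2 * (L * vec_norm2 ?w)\<^sup>2" by (intro mult_left_mono) auto
    also have "\<dots> = (1 / L\<^sup>2) * (vec_norm2 ?w)\<^sup>2"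
      using \<open>L > 0\<close> by (simp add: power2_eq_square field_simps)
    finally have "(1 / L\<^sup>2) * (vec_norm2 ?w)\<^sup>2 \<le> q v"
      using step[OF v(1), of "1 / L\<^sup>2"] by simp
    also have "q v < \<eta>" using v by (simp add: q_def)
    finally have "(1 / L\<^sup>2) * (vec_norm2 ?w)\<^sup>2 < 1 / (L * K)\<^sup>2" by (simp add: \<eta>_def)
    then have "(K * vec_norm2 ?w)\<^sup>2 < 1" using \<open>L > 0\<close> \<open>K > 0\<close> by (simp add: power_mult_distrib field_simps)
    then show False using \<open>1 \<le> (K * vec_norm2 ?w)\<^sup>2\<close> by simp
  qed
  from that[OF \<open>0 \<le> \<mu>\<close> this low] show thesis .
qed

text \<open>\<open>Min\<close> wants a finite nonempty set: finiteness comes from the roots of the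
  characteristic polynomial, and a member from \<open>rayleigh_infimum_eigenvalue\<close>, whose
  square lies below all Rayleigh quotients. Invertibility excludes the singular value 0.\<close>

lemma min_singular_value_bound:
  fixes R :: "'b::real_or_complex mat"
  assumes R: "R \<in> carrier_mat n n" "invertible_mat R" and "0 < n"
  shows "0 < min_singular_value R" "v \<in> carrier_vec n \<Longrightarrow> min_singular_value R * vec_norm2 v \<le> vec_norm2 (R *\<^sub>v v)"
proof -
  let ?A = "mat_adjoint R * R"
  have A: "?A \<in> carrier_mat n n" using mat_adjoint_carrier[OF R(1)] R by auto
  obtain \<mu> where "0 \<le> \<mu>" and ev: "eigenvalue ?A (of_real \<mu>)"
    and low: "\<And>v. v \<in> carrier_vec n \<Longrightarrow> \<mu> * (vec_norm2 v)\<^sup>2 \<le> (vec_norm2 (R *\<^sub>v v))\<^sup>2"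
    using rayleigh_infimum_eigenvalue[OF R(1) \<open>0 < n\<close>] by blast
  have mem: "sqrt \<mu> \<in> singular_values R"
    using \<open>0 \<le> \<mu>\<close> ev by (simp add: singular_values_def del: of_real_power)
  have fin: "finite (singular_values R)"
  proof (rule finite_imageD)
    show "inj_on (\<lambda>\<sigma>. of_real (\<sigma>\<^sup>2) :: 'b) (singular_values R)"
      by (auto simp: inj_on_def singular_values_def of_real_eq_iff simp del: of_real_power)
    have "char_poly ?A \<noteq> 0" using degree_monic_char_poly[OF A] by auto
    then have "finite {x. poly (char_poly ?A) x = 0}" by (rule poly_roots_finite)
    then show "finite ((\<lambda>\<sigma>. of_real (\<sigma>\<^sup>2) :: 'b) ` singular_values R)"
      by (rule rev_finite_subset) (auto simp: singular_values_def eigenvalue_root_char_poly[OF A])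
  qed
  obtain R' where R': "R' * R = 1\<^sub>m n" "R' \<in> carrier_mat n n"
  proof -
    from R obtain R' where "inverts_mat R R'" "inverts_mat R' R" unfolding invertible_mat_def by blast
    then have "R * R' = 1\<^sub>m n" "R' * R = 1\<^sub>m (dim_row R')" using R unfolding inverts_mat_def by auto
    moreover from this have "dim_col R' = n" "dim_row R' = n"
      using R by (metis index_mult_mat(3) index_one_mat(3), metis carrier_matD(2) index_mult_mat(3) index_one_mat(3))
    ultimately show thesis using that[of R'] by auto
  qed
  have "Min (singular_values R) \<in> singular_values R" using fin mem by (intro Min_in) auto
  moreover have "0 \<notin> singular_values R"
  proof
    assume "0 \<in> singular_values R"
    then obtain v where "eigenvector ?A v 0" by (auto simp: singular_values_def eigenvalue_def)
    then have v: "v \<in> carrier_vec n" "v \<noteq> 0\<^sub>v n" "?A *\<^sub>v v = 0 \<cdot>\<^sub>v v"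
      using A by (auto simp: eigenvector_def)
    have "(R *\<^sub>v v) \<bullet>c (R *\<^sub>v v) = 0"
      using mat_adjoint_mult_cscalar_prod[OF R(1) v(1) v(1)] v by (simp add: v(3))
    then have "vec_norm2 (R *\<^sub>v v) = 0" by (simp add: cscalar_prod_self)
    then have "R *\<^sub>v v = 0\<^sub>v n" using vec_norm2_eq_0_iff[of "R *\<^sub>v v" n] R v by auto
    moreover have "R' *\<^sub>v 0\<^sub>v n = 0\<^sub>v n" using R'(2) by (intro eq_vecI) auto
    ultimately have "R' *\<^sub>v (R *\<^sub>v v) = 0\<^sub>v n" by simp
    then show False using assoc_mult_mat_vec[OF R'(2) R(1) v(1)] R' v by simp
  qed
  ultimately show "0 < min_singular_value R"
    unfolding min_singular_value_def by (metis (mono_tags, lifting) singular_values_def mem_Collect_eq less_eq_real_def)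
  assume v: "v \<in> carrier_vec n"
  have "min_singular_value R \<le> sqrt \<mu>" unfolding min_singular_value_def using fin mem by (rule Min_le)
  then have "min_singular_value R * vec_norm2 v \<le> sqrt \<mu> * vec_norm2 v" by (intro mult_right_mono) auto
  also have "\<dots> \<le> vec_norm2 (R *\<^sub>v v)"
  proof (rule power2_le_imp_le)
    have "(sqrt \<mu> * vec_norm2 v)\<^sup>2 = \<mu> * (vec_norm2 v)\<^sup>2" using \<open>0 \<le> \<mu>\<close> by (simp add: power_mult_distrib)
    then show "(sqrt \<mu> * vec_norm2 v)\<^sup>2 \<le> (vec_norm2 (R *\<^sub>v v))\<^sup>2" using low[OF v] by simp
  qed simp
  finally show "min_singular_value R * vec_norm2 v \<le> vec_norm2 (R *\<^sub>v v)" .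
qed

text \<open>Orthonormal columns give A a and R a the same norm; the factor 2 is |A a| \<le> |A a -
  b| + |b| together with the comparison with the zero vector.\<close>

lemma least_squares_QR_bound:
  fixes A :: "'b::real_or_complex mat"
  assumes QR: "is_QR A Q R" and ls: "is_least_squares A b a" and b: "b \<in> carrier_vec (dim_row A)" and "0 < dim_col A"
  shows "vec_norm2 (A *\<^sub>v a - b) \<le> vec_norm2 b" "0 < min_singular_value R" "vec_norm2 a \<le> 2 * inverse (min_singular_value R) * vec_norm2 b"
proof -
  let ?r = "dim_row A" and ?n = "dim_col A"
  have A: "A \<in> carrier_mat ?r ?n" by auto
  have Q: "Q \<in> carrier_mat ?r ?n" "mat_adjoint Q * Q = 1\<^sub>m ?n" and R: "R \<in> carrier_mat ?n ?n" "invertible_mat R" and AQR: "A = Q * R"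
    using QR unfolding is_QR_def by blast+
  have a: "a \<in> carrier_vec ?n" using ls by (simp add: is_least_squares_def)
  have Aa: "A *\<^sub>v a \<in> carrier_vec ?r" by (intro carrier_vecI) simp
  have "vec_norm2 (A *\<^sub>v a - b) \<le> vec_norm2 (A *\<^sub>v 0\<^sub>v ?n - b)"
    using ls by (simp add: is_least_squares_def)
  also have "A *\<^sub>v 0\<^sub>v ?n - b = (- 1) \<cdot>\<^sub>v b" using A b by (intro eq_vecI) auto
  also have "vec_norm2 ((- 1) \<cdot>\<^sub>v b) = vec_norm2 b" by (simp add: vec_norm2_smult)
  finally show 1: "vec_norm2 (A *\<^sub>v a - b) \<le> vec_norm2 b" .
  show 2: "0 < min_singular_value R" by (rule min_singular_value_bound(1)[OF R \<open>0 < ?n\<close>])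
  have Ra: "R *\<^sub>v a \<in> carrier_vec ?n" using R a by simp
  have "A *\<^sub>v a = Q *\<^sub>v (R *\<^sub>v a)" using assoc_mult_mat_vec[OF Q(1) R(1) a] AQR by simp
  then have "(A *\<^sub>v a) \<bullet>c (A *\<^sub>v a) = (R *\<^sub>v a) \<bullet>c (R *\<^sub>v a)"
    using mat_adjoint_mult_cscalar_prod[OF Q(1) Ra Ra] Q(2) Ra by simp
  then have "(vec_norm2 (A *\<^sub>v a))\<^sup>2 = (vec_norm2 (R *\<^sub>v a))\<^sup>2"
    unfolding cscalar_prod_self by (simp only: of_real_eq_iff)
  then have "vec_norm2 (A *\<^sub>v a) = vec_norm2 (R *\<^sub>v a)" by (simp add: power2_eq_iff_nonneg)
  then have "min_singular_value R * vec_norm2 a \<le> vec_norm2 (A *\<^sub>v a)"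
    using min_singular_value_bound(2)[OF R \<open>0 < ?n\<close> a] by simp
  also have "\<dots> \<le> 2 * vec_norm2 b" using vec_norm2_triangle[OF Aa b] 1 by simp
  finally show "vec_norm2 a \<le> 2 * inverse (min_singular_value R) * vec_norm2 b"
    using 2 by (simp add: field_simps)
qed

section \<open>Coefficients of a sparse residual tree\<close>

lemma vec_norm2_eval_vec_sq: "(vec_norm2 (eval_vec f xs))\<^sup>2 = (\<Sum>x\<leftarrow>xs. (norm (f x))\<^sup>2)"
  by (simp add: vec_norm2_sq eval_vec_def vec_of_list_index sum_list_sum_nth atLeast0LessThan)

lemma vec_norm2_eval_vec_filter_le: "vec_norm2 (eval_vec f (filter P xs)) \<le> vec_norm2 (eval_vec f xs)"
proof (rule power2_le_imp_le)
  show "(vec_norm2 (eval_vec f (filter P xs)))\<^sup>2 \<le> (vec_norm2 (eval_vec f xs))\<^sup>2"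
    unfolding vec_norm2_eval_vec_sq by (induction xs) (auto intro: add_increasing)
qed simp

lemma srt_path_Suc_subset:
  "srt_path \<Omega> xs L D \<Longrightarrow> Suc i < L \<Longrightarrow> D (Suc i) \<subseteq> D i"
  unfolding srt_path_def hyperplane_cut_def by blast

lemma srt_path_domain:
  assumes path: "srt_path \<Omega> xs L D" and "convex \<Omega>" and "i < L"
  shows "convex (D i)" "D i \<subseteq> \<Omega>"
proof -
  have "convex (D i) \<and> D i \<subseteq> \<Omega>"
    using \<open>i < L\<close>
  proof (induction i)
    case 0
    then show ?case using path \<open>convex \<Omega>\<close> by (simp add: srt_path_def)
  next
    case (Suc i)
    then have IH: "convex (D i)" "D i \<subseteq> \<Omega>" by auto
    have "hyperplane_cut (D i) (D (Suc i))" using path Suc.prems by (simp add: srt_path_def)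
    then obtain a b where "D (Suc i) = D i \<inter> {x. inner a x < b} \<or> D (Suc i) = D i \<inter> {x. inner a x \<le> b}"
      unfolding hyperplane_cut_def by blast
    then have "convex (D (Suc i))" using IH(1) by (auto intro!: convex_Int convex_halfspace_lt convex_halfspace_le)
    then show ?case using IH(2) srt_path_Suc_subset[OF path Suc.prems] by blast
  qed
  then show "convex (D i)" "D i \<subseteq> \<Omega>" by auto
qed

text \<open>The next level first discards data points, which cannot increase the norm, and its
  residual on the old points is the error of a least squares fit. So the bound by the full data
  vector survives all levels.\<close>

lemma srt_residual_bound:
  fixes f :: "real^'n::finite \<Rightarrow> 'b::real_or_complex"
  assumes path: "srt_path \<Omega> xs L D" and fit: "srt_fit xs L D N \<phi> f \<alpha> Q R" and N: "\<forall>i<L. 1 \<le> N i" and "i < L"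
  shows "vec_norm2 (eval_vec (srt_residual f N \<phi> \<alpha> i) (level_points D xs i)) \<le> vec_norm2 (eval_vec f xs)"
    "0 < min_singular_value (R i)"
    "vec_norm2 (\<alpha> i) \<le> 2 * inverse (min_singular_value (R i)) * vec_norm2 (eval_vec f xs)"
    "dim_vec (\<alpha> i) = N i"
proof -
  let ?xi = "level_points D xs" and ?r = "srt_residual f N \<phi> \<alpha>"
  let ?\<Phi> = "\<lambda>i. basis_mat (N i) (\<phi> i) (?xi i)"
  have fit_i: "is_QR (?\<Phi> i) (Q i) (R i)" "is_least_squares (?\<Phi> i) (eval_vec (?r i) (?xi i)) (\<alpha> i)" if "i < L" for i
    using fit that by (auto simp: srt_fit_def Let_def)
  have dims: "dim_row (?\<Phi> i) = length (?xi i)" "dim_col (?\<Phi> i) = N i" for i by (auto simp: basis_mat_def)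
  have b: "eval_vec (?r i) (?xi i) \<in> carrier_vec (dim_row (?\<Phi> i))" for i
    unfolding dims by (intro carrier_vecI) (simp add: eval_vec_def)
  have pos: "0 < dim_col (?\<Phi> i)" if "i < L" for i
    using N[rule_format, OF that] unfolding dims by simp
  note ls = least_squares_QR_bound[OF fit_i b pos]
  have dim\<alpha>: "dim_vec (\<alpha> i) = N i" if "i < L" for i
    using fit_i(2)[OF that] unfolding is_least_squares_def dims by simp
  have res: "vec_norm2 (eval_vec (?r i) (?xi i)) \<le> vec_norm2 (eval_vec f xs)" if "i < L" for i
    using that
  proof (induction i)
    case 0
    show ?case unfolding level_points_def srt_residual.simps by (rule vec_norm2_eval_vec_filter_le)
  next
    case (Suc i)
    then have "i < L" by simp
    \<comment> \<open>As the cells decrease, filtering the points of level i gives the same list as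
      filtering all data points.\<close>
    have "?xi (Suc i) = filter (\<lambda>x. x \<in> D (Suc i)) (?xi i)"
      using srt_path_Suc_subset[OF path Suc.prems] unfolding level_points_def filter_filter
      by (intro filter_cong) auto
    then have "vec_norm2 (eval_vec (?r (Suc i)) (?xi (Suc i))) \<le> vec_norm2 (eval_vec (?r (Suc i)) (?xi i))"
      using vec_norm2_eval_vec_filter_le by metis
    also have "eval_vec (?r (Suc i)) (?xi i) = (- 1) \<cdot>\<^sub>v (?\<Phi> i *\<^sub>v \<alpha> i - eval_vec (?r i) (?xi i))"
    proof (rule eq_vecI)
      show "dim_vec (eval_vec (?r (Suc i)) (?xi i)) = dim_vec ((- 1) \<cdot>\<^sub>v (?\<Phi> i *\<^sub>v \<alpha> i - eval_vec (?r i) (?xi i)))"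
        by (simp add: eval_vec_def)
      fix l assume "l < dim_vec ((- 1) \<cdot>\<^sub>v (?\<Phi> i *\<^sub>v \<alpha> i - eval_vec (?r i) (?xi i)))"
      then have l: "l < length (?xi i)" by (simp add: eval_vec_def)
      have "(?\<Phi> i *\<^sub>v \<alpha> i) $ l = srt_approx N \<phi> \<alpha> i (?xi i ! l)"
        using l dim\<alpha>[OF \<open>i < L\<close>]
        by (auto simp: basis_mat_def srt_approx_def scalar_prod_def atLeast0LessThan mult.commute intro!: sum.cong)
      then show "eval_vec (?r (Suc i)) (?xi i) $ l = ((- 1) \<cdot>\<^sub>v (?\<Phi> i *\<^sub>v \<alpha> i - eval_vec (?r i) (?xi i))) $ l"
        using l by (simp add: eval_vec_def vec_of_list_index basis_mat_def)
    qed
    also have "vec_norm2 ((- 1) \<cdot>\<^sub>v (?\<Phi> i *\<^sub>v \<alpha> i - eval_vec (?r i) (?xi i))) = vec_norm2 (?\<Phi> i *\<^sub>v \<alpha> i - eval_vec (?r i) (?xi i))"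
      by (simp add: vec_norm2_smult)
    also have "\<dots> \<le> vec_norm2 (eval_vec (?r i) (?xi i))" by (rule ls(1)[OF \<open>i < L\<close> \<open>i < L\<close> \<open>i < L\<close>])
    also have "\<dots> \<le> vec_norm2 (eval_vec f xs)" by (rule Suc.IH[OF \<open>i < L\<close>])
    finally show ?case .
  qed
  show "vec_norm2 (eval_vec (?r i) (?xi i)) \<le> vec_norm2 (eval_vec f xs)" by (rule res[OF \<open>i < L\<close>])
  show p: "0 < min_singular_value (R i)" by (rule ls(2)[OF \<open>i < L\<close> \<open>i < L\<close> \<open>i < L\<close>])
  show "dim_vec (\<alpha> i) = N i" by (rule dim\<alpha>[OF \<open>i < L\<close>])
  have "vec_norm2 (\<alpha> i) \<le> 2 * inverse (min_singular_value (R i)) * vec_norm2 (eval_vec (?r i) (?xi i))"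
    by (rule ls(3)[OF \<open>i < L\<close> \<open>i < L\<close> \<open>i < L\<close>])
  also have "\<dots> \<le> 2 * inverse (min_singular_value (R i)) * vec_norm2 (eval_vec f xs)"
    using p by (intro mult_left_mono res[OF \<open>i < L\<close>]) auto
  finally show "vec_norm2 (\<alpha> i) \<le> 2 * inverse (min_singular_value (R i)) * vec_norm2 (eval_vec f xs)" .
qed

text \<open>The minimum over the levels merges the bounds of the single levels into one; a path has
  at least one level, so it is a minimum over a nonempty set.\<close>

lemma srt_coefficient_bound:
  fixes f :: "real^'n::finite \<Rightarrow> 'b::real_or_complex"
  assumes path: "srt_path \<Omega> xs L D" and fit: "srt_fit xs L D N \<phi> f \<alpha> Q R" and N: "\<forall>i<L. 1 \<le> N i"
  shows "0 < srt_tau L R"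
    "i < L \<Longrightarrow> j < N i \<Longrightarrow> norm (\<alpha> i $ j) \<le> 2 * inverse (srt_tau L R) * vec_norm2 (eval_vec f xs)"
proof -
  note bound = srt_residual_bound[OF path fit N]
  have "1 \<le> L" using path by (simp add: srt_path_def)
  then have "srt_tau L R \<in> (\<lambda>i. min_singular_value (R i)) ` {..<L}"
    unfolding srt_tau_def by (intro Min_in) (auto simp: lessThan_empty_iff)
  then show \<tau>: "0 < srt_tau L R" using bound(2) by auto
  assume i: "i < L" "j < N i"
  have "srt_tau L R \<le> min_singular_value (R i)"
    unfolding srt_tau_def using i by (intro Min_le) auto
  then have "inverse (min_singular_value (R i)) \<le> inverse (srt_tau L R)" using \<tau> by (intro le_imp_inverse_le)
  have "norm (\<alpha> i $ j) \<le> vec_norm2 (\<alpha> i)" using bound(4)[OF i(1)] i by (intro norm_index_le_vec_norm2) simp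
  also have "\<dots> \<le> 2 * inverse (min_singular_value (R i)) * vec_norm2 (eval_vec f xs)" by (rule bound(3)[OF i(1)])
  also have "\<dots> \<le> 2 * inverse (srt_tau L R) * vec_norm2 (eval_vec f xs)"
    using \<open>inverse (min_singular_value (R i)) \<le> inverse (srt_tau L R)\<close> by (intro mult_right_mono mult_left_mono) auto
  finally show "norm (\<alpha> i $ j) \<le> 2 * inverse (srt_tau L R) * vec_norm2 (eval_vec f xs)" .
qed

section \<open>Sobolev norms of the prediction\<close>

lemma sobolev_zero:
  assumes "convex T" "1 \<le> p"
  shows "(\<lambda>x. 0 :: 'b::euclidean_space) \<in> sobolev_space k p (T :: (real^'n::finite) set)" "sobolev_integral k p T (\<lambda>x. 0 :: 'b) = 0"
proof -
  have *: "has_weak_deriv T \<gamma> (\<lambda>x. 0 :: 'b) (\<lambda>x. 0)" "powr_integral p T (\<lambda>x. 0 :: 'b) < \<infinity>"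
    "(\<lambda>x. 0 :: 'b) \<in> borel_measurable (lebesgue_on T)" for \<gamma>
    using assms by (auto simp: has_weak_deriv_def locally_integrable_def powr_integral_def)
  show "(\<lambda>x. 0 :: 'b) \<in> sobolev_space k p T" by (rule sobolev_spaceI(1)[OF assms *])
  have "sobolev_integral k p T (\<lambda>x. 0 :: 'b) = (\<Sum>\<gamma> :: 'n \<Rightarrow> nat | mi_order \<gamma> = k. powr_integral p T (\<lambda>x. 0 :: 'b))"
    by (rule sobolev_spaceI(2)[OF assms *])
  then show "sobolev_integral k p T (\<lambda>x. 0 :: 'b) = 0" using assms by (simp add: powr_integral_def)
qed

text \<open>\<open>K\<close> is fixed before the subdomain and the coefficients: derivatives on T
  are restrictions of those on \<Omega>, so only integrals of the basis functions over \<Omega>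
  enter. This is why \<open>C\<^sub>W\<close> depends neither on the data points nor on the
  cells.\<close>

lemma sobolev_linear_combination:
  fixes \<phi> :: "'a \<Rightarrow> real^'n::finite \<Rightarrow> 'b::real_or_complex"
  assumes "finite A" and \<Omega>: "convex \<Omega>" and p: "1 \<le> p" and \<phi>: "\<And>a. a \<in> A \<Longrightarrow> \<phi> a \<in> sobolev_space k p \<Omega>"
  shows "\<exists>K<\<infinity>. \<forall>T c B. convex T \<longrightarrow> T \<subseteq> \<Omega> \<longrightarrow> (\<forall>a\<in>A. norm (c a) \<le> B) \<longrightarrow>
    (\<lambda>x. \<Sum>a\<in>A. c a * \<phi> a x) \<in> sobolev_space k p T \<and> sobolev_integral k p T (\<lambda>x. \<Sum>a\<in>A. c a * \<phi> a x) \<le> ennreal (B powr p) * K"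
  using assms(1) \<phi>
proof (induction A)
  case empty
  then show ?case using p by (intro exI[of _ 0]) (auto simp: sobolev_zero)
next
  case (insert a A)
  then obtain K where K: "K < \<infinity>" "\<And>T c B. convex T \<Longrightarrow> T \<subseteq> \<Omega> \<Longrightarrow> (\<forall>a\<in>A. norm (c a) \<le> B) \<Longrightarrow>
    (\<lambda>x. \<Sum>a\<in>A. c a * \<phi> a x) \<in> sobolev_space k p T \<and> sobolev_integral k p T (\<lambda>x. \<Sum>a\<in>A. c a * \<phi> a x) \<le> ennreal (B powr p) * K"
    by blast
  let ?K = "ennreal (2 powr p) * (sobolev_integral k p \<Omega> (\<phi> a) + K)"
  have \<phi>a: "\<phi> a \<in> sobolev_space k p \<Omega>" using insert.prems by simp
  have "?K < \<infinity>" using K(1) sobolev_seminorm_eq(1)[OF \<phi>a \<Omega> p] by (simp add: ennreal_mult_less_top)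
  moreover have "(\<lambda>x. \<Sum>a\<in>insert a A. c a * \<phi> a x) \<in> sobolev_space k p T \<and>
      sobolev_integral k p T (\<lambda>x. \<Sum>a\<in>insert a A. c a * \<phi> a x) \<le> ennreal (B powr p) * ?K"
    if T: "convex T" "T \<subseteq> \<Omega>" and c: "\<forall>a\<in>insert a A. norm (c a) \<le> B" for T c B
  proof -
    let ?s = "\<lambda>x. \<Sum>a\<in>A. c a * \<phi> a x"
    have s: "?s \<in> sobolev_space k p T" "sobolev_integral k p T ?s \<le> ennreal (B powr p) * K"
      using K(2)[OF T, of c B] c by auto
    note \<phi>T = sobolev_subset[OF \<phi>a \<Omega> T p]
    have "norm (c a * v) \<le> B * norm v" for v using c by (simp add: norm_mult mult_right_mono)
    note g = sobolev_bounded_linear[OF \<phi>T(1) T(1) p bounded_linear_mult_right this]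
    have eq: "(\<lambda>x. \<Sum>a\<in>insert a A. c a * \<phi> a x) = (\<lambda>x. c a * \<phi> a x + ?s x)"
      using insert.hyps by simp
    have "sobolev_integral k p T (\<lambda>x. c a * \<phi> a x + ?s x) \<le>
        ennreal (2 powr p) * (sobolev_integral k p T (\<lambda>x. c a * \<phi> a x) + sobolev_integral k p T ?s)"
      by (rule sobolev_add(2)[OF g(1) s(1) T(1) p])
    also have "\<dots> \<le> ennreal (2 powr p) * (ennreal (B powr p) * sobolev_integral k p \<Omega> (\<phi> a) + ennreal (B powr p) * K)"
      by (intro mult_left_mono add_mono s(2) order_trans[OF g(2)] \<phi>T(2)) auto
    also have "\<dots> = ennreal (B powr p) * ?K" by (simp add: distrib_left ac_simps)
    finally show ?thesis
      unfolding eq using sobolev_add(1)[OF g(1) s(1) T(1) p] by blast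
  qed
  ultimately show ?case by blast
qed

lemma srt_prediction_eq:
  "srt_prediction L N \<phi> \<alpha> = (\<lambda>x. \<Sum>(i, j)\<in>Sigma {..<L} (\<lambda>i. {..<N i}). \<alpha> i $ j * \<phi> i j x)"
  by (simp add: srt_prediction_def srt_approx_def sum.Sigma)

text \<open>All levels are merged into one finite family indexed by pairs of a level and a basis
  function.\<close>

lemma srt_prediction_sobolev:
  fixes \<Omega> :: "(real^'n::finite) set" and \<phi> :: "nat \<Rightarrow> nat \<Rightarrow> real^'n \<Rightarrow> 'b::real_or_complex"
  assumes \<Omega>: "convex \<Omega>" and p: "1 \<le> p" and basis: "srt_basis k p \<Omega> L N \<phi>"
  obtains C where "0 \<le> C"
    "\<And>T \<alpha> B. convex T \<Longrightarrow> T \<subseteq> \<Omega> \<Longrightarrow> 0 \<le> B \<Longrightarrow> (\<forall>i<L. \<forall>j<N i. norm (\<alpha> i $ j) \<le> B) \<Longrightarrow>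
      srt_prediction L N \<phi> \<alpha> \<in> sobolev_space k p T \<and> sobolev_seminorm k p T (srt_prediction L N \<phi> \<alpha>) \<le> C * B"
proof -
  let ?A = "Sigma {..<L} (\<lambda>i. {..<N i})" and ?\<phi> = "\<lambda>a. \<phi> (fst a) (snd a)"
  have "finite ?A" by auto
  moreover have "?\<phi> a \<in> sobolev_space k p \<Omega>" if "a \<in> ?A" for a
    using basis that by (auto simp: srt_basis_def cont_sobolev_space_def)
  ultimately obtain K where K: "K < \<infinity>" "\<And>T c B. convex T \<Longrightarrow> T \<subseteq> \<Omega> \<Longrightarrow> (\<forall>a\<in>?A. norm (c a) \<le> B) \<Longrightarrow>
    (\<lambda>x. \<Sum>a\<in>?A. c a * ?\<phi> a x) \<in> sobolev_space k p T \<and> sobolev_integral k p T (\<lambda>x. \<Sum>a\<in>?A. c a * ?\<phi> a x) \<le> ennreal (B powr p) * K"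
    using sobolev_linear_combination[OF _ \<Omega> p, of ?A ?\<phi>] by blast
  show thesis
  proof (rule that[of "enn2real K powr (1 / p)"])
    fix T \<alpha> and B :: real assume T: "convex T" "T \<subseteq> \<Omega>" and "0 \<le> B" and \<alpha>: "\<forall>i<L. \<forall>j<N i. norm (\<alpha> i $ j :: 'b) \<le> B"
    let ?s = "srt_prediction L N \<phi> \<alpha>"
    have "?s = (\<lambda>x. \<Sum>a\<in>?A. \<alpha> (fst a) $ snd a * ?\<phi> a x)"
      by (simp add: srt_prediction_eq case_prod_beta)
    then have s: "?s \<in> sobolev_space k p T" "sobolev_integral k p T ?s \<le> ennreal (B powr p) * K"
      using K(2)[OF T, of "\<lambda>a. \<alpha> (fst a) $ snd a" B] \<alpha> by auto
    have "enn2real (sobolev_integral k p T ?s) \<le> enn2real (ennreal (B powr p) * K)"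
      using s(2) K(1) by (intro enn2real_mono) (auto simp: ennreal_mult_less_top)
    then have "enn2real (sobolev_integral k p T ?s) powr (1 / p) \<le> (B powr p * enn2real K) powr (1 / p)"
      using p by (intro powr_mono2) (auto simp: enn2real_mult)
    also have "\<dots> = enn2real K powr (1 / p) * B"
      using p \<open>0 \<le> B\<close> by (simp add: powr_mult powr_powr)
    finally show "?s \<in> sobolev_space k p T \<and> sobolev_seminorm k p T ?s \<le> enn2real K powr (1 / p) * B"
      using s(1) sobolev_seminorm_eq(2)[OF s(1) T(1) p] by simp
  qed simp
qed

lemma srt_prediction_in_sobolev_space:
  assumes "convex \<Omega>" "1 \<le> p" "srt_basis k p \<Omega> L N \<phi>" "convex T" "T \<subseteq> \<Omega>"
  shows "srt_prediction L N \<phi> \<alpha> \<in> sobolev_space k p T"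
proof (rule srt_prediction_sobolev[OF assms(1-3)])
  fix C :: real
  assume C: "\<And>T \<alpha> B. convex T \<Longrightarrow> T \<subseteq> \<Omega> \<Longrightarrow> 0 \<le> B \<Longrightarrow> (\<forall>i<L. \<forall>j<N i. norm (\<alpha> i $ j) \<le> B) \<Longrightarrow>
    srt_prediction L N \<phi> \<alpha> \<in> sobolev_space k p T \<and> sobolev_seminorm k p T (srt_prediction L N \<phi> \<alpha>) \<le> C * B"
  \<comment> \<open>Membership holds for any coefficients: there are finitely many of them, and the
    sum of their norms is a common bound.\<close>
  let ?B = "\<Sum>i<L. \<Sum>j<N i. norm (\<alpha> i $ j)"
  have "norm (\<alpha> i $ j) \<le> ?B" if "i < L" "j < N i" for i j
  proof -
    have "norm (\<alpha> i $ j) \<le> (\<Sum>j<N i. norm (\<alpha> i $ j))" using that by (intro member_le_sum) auto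
    also have "\<dots> \<le> ?B" using that by (intro member_le_sum[of i _ "\<lambda>i. \<Sum>j<N i. norm (\<alpha> i $ j)"]) (auto intro: sum_nonneg)
    finally show ?thesis .
  qed
  then show ?thesis using C[OF assms(4,5), of ?B \<alpha>] by (simp add: sum_nonneg)
qed

lemma sobolev_seminorm_subset:
  assumes "f \<in> sobolev_space k p S" "convex S" "convex T" "T \<subseteq> S" "1 \<le> p"
  shows "sobolev_seminorm k p T f \<le> sobolev_seminorm k p S f"
  using sobolev_subset[OF assms] sobolev_seminorm_eq[OF assms(1,2,5)] sobolev_seminorm_eq(2)[OF sobolev_subset(1)[OF assms] assms(3,5)] assms(5)
  by (auto intro!: powr_mono2 enn2real_mono)

text \<open>The factor 4 is 2 from \<open>sobolev_add\<close>, after taking the p-th root, times 2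
  from splitting the p-th root of a sum.\<close>

lemma sobolev_diff:
  fixes f g :: "real^'n::finite \<Rightarrow> 'b::euclidean_space"
  assumes f: "f \<in> sobolev_space k p S" and g: "g \<in> sobolev_space k p S" and S: "convex S" and p: "1 \<le> p"
  shows "(\<lambda>x. f x - g x) \<in> sobolev_space k p S"
    "sobolev_seminorm k p S (\<lambda>x. f x - g x) \<le> 4 * (sobolev_seminorm k p S f + sobolev_seminorm k p S g)"
proof -
  have "norm (- v) \<le> 1 * norm v" for v :: 'b by simp
  note g' = sobolev_bounded_linear[OF g S p bounded_linear_minus[OF bounded_linear_ident] this]
  note d = sobolev_add[OF f g'(1) S p]
  show W: "(\<lambda>x. f x - g x) \<in> sobolev_space k p S" using d(1) by simp
  note fin = sobolev_seminorm_eq(1)[OF f S p] sobolev_seminorm_eq(1)[OF g S p]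
  let ?a = "enn2real (sobolev_integral k p S f)" and ?b = "enn2real (sobolev_integral k p S g)"
  have "sobolev_integral k p S (\<lambda>x. f x - g x) \<le> ennreal (2 powr p) * (sobolev_integral k p S f + sobolev_integral k p S (\<lambda>x. - g x))"
    using d(2) by simp
  also have "\<dots> \<le> ennreal (2 powr p) * (sobolev_integral k p S f + sobolev_integral k p S g)"
    using g'(2) by (intro mult_left_mono add_left_mono) auto
  finally have "enn2real (sobolev_integral k p S (\<lambda>x. f x - g x)) \<le> enn2real (ennreal (2 powr p) * (sobolev_integral k p S f + sobolev_integral k p S g))"
    using fin by (intro enn2real_mono) (auto simp: ennreal_mult_less_top)
  also have "\<dots> = 2 powr p * (?a + ?b)" using fin by (simp add: enn2real_mult enn2real_plus)
  finally have "enn2real (sobolev_integral k p S (\<lambda>x. f x - g x)) powr (1 / p) \<le> (2 powr p * (?a + ?b)) powr (1 / p)"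
    using p by (intro powr_mono2) auto
  also have "\<dots> = 2 * (?a + ?b) powr (1 / p)" using p by (simp add: powr_mult powr_powr)
  also have "\<dots> \<le> 2 * (2 powr (1 / p) * (?a powr (1 / p) + ?b powr (1 / p)))"
    using p by (intro mult_left_mono powr_add_le) auto
  also have "\<dots> \<le> 2 * (2 * (?a powr (1 / p) + ?b powr (1 / p)))"
    using p powr_mono[of "1 / p" 1 2] by (intro mult_left_mono mult_right_mono) auto
  finally show "sobolev_seminorm k p S (\<lambda>x. f x - g x) \<le> 4 * (sobolev_seminorm k p S f + sobolev_seminorm k p S g)"
    by (simp add: sobolev_seminorm_eq(2)[OF W S p] sobolev_seminorm_eq(2)[OF f S p] sobolev_seminorm_eq(2)[OF g S p])
qed

section \<open>The fill distance\<close>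

text \<open>A finite fill distance carries information: the infimum over an empty X would be
  infinite, finitely many balls of radius h cover \<Omega>, and a nonempty open set is infinite, so
  it has a point off the data and h is positive.\<close>

lemma fill_distance_finite:
  fixes \<Omega> :: "(real^'n::finite) set"
  assumes \<Omega>: "open \<Omega>" "\<Omega> \<noteq> {}" and X: "finite X" and fd: "fill_distance X \<Omega> = ereal h"
  shows "0 < h" "bounded \<Omega>" "\<And>x. x \<in> \<Omega> \<Longrightarrow> \<exists>y\<in>X. dist x y \<le> h"
proof -
  have le: "(INF y\<in>X. ereal (dist x y)) \<le> ereal h" if "x \<in> \<Omega>" for x
    using SUP_upper[OF that, of "\<lambda>x. INF y\<in>X. ereal (dist x y)"] fd by (simp add: fill_distance_def)
  have "X \<noteq> {}"
    using \<Omega>(2) le by (auto simp: top_ereal_def)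
  show near: "\<exists>y\<in>X. dist x y \<le> h" if "x \<in> \<Omega>" for x
  proof -
    have "(INF y\<in>X. ereal (dist x y)) \<in> (\<lambda>y. ereal (dist x y)) ` X"
      using X \<open>X \<noteq> {}\<close> Min_in[of "(\<lambda>y. ereal (dist x y)) ` X"] by (simp add: Min_Inf)
    then show ?thesis using le[OF that] by auto
  qed
  have "\<Omega> \<subseteq> (\<Union>y\<in>X. cball y h)" using near by (fastforce simp: dist_commute)
  then show "bounded \<Omega>" by (rule bounded_subset[rotated]) (use X in auto)
  have "infinite \<Omega>" using \<Omega> by (metis finite_imp_not_open)
  then obtain x where x: "x \<in> \<Omega>" "x \<notin> X" using X by (meson finite_subset subsetI)
  then obtain y where "y \<in> X" "dist x y \<le> h" using near by blast
  then show "0 < h" using x by (metis zero_less_dist_iff less_le_trans)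
qed

text \<open>The first conjunct produces an admissible \<open>C\<^sub>W\<close> from the basis; the
  second accepts every admissible one, so that \<open>C\<close> can be chosen before it. Of the
  whole tree only the leaf is fixed before \<open>C\<close> and \<open>h\<^sub>0\<close>.\<close>

theorem corollary5p1:
  fixes \<Omega> :: "(real^'n) set" and k :: nat and p :: real and q :: ennreal and \<gamma> :: "'n \<Rightarrow> nat"
  assumes "convex \<Omega>" and "open \<Omega>" and "\<Omega> \<noteq> {}"
    and "1 \<le> p" and "1 \<le> q"
    and "p > 1 \<longrightarrow> real k > real (mi_order \<gamma>) + real CARD('n) / p"
    and "p = 1 \<longrightarrow> k \<ge> mi_order \<gamma> + CARD('n)"
  shows
    "(\<forall>L N (\<phi> :: nat \<Rightarrow> nat \<Rightarrow> real^'n \<Rightarrow> 'b::real_or_complex). srt_basis k p \<Omega> L N \<phi> \<longrightarrow>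
        (\<exists>C\<^sub>W\<ge>0. \<forall>xs D f \<alpha> Q R.
           srt_path \<Omega> xs L D \<and> f \<in> cont_sobolev_space k p \<Omega> \<and> srt_fit xs L D N \<phi> f \<alpha> Q R \<longrightarrow>
           sobolev_seminorm k p (D (L - 1)) (srt_prediction L N \<phi> \<alpha>)
             \<le> C\<^sub>W * inverse (srt_tau L R) * vec_norm2 (eval_vec f xs)))
     \<and>
     (\<forall>leaf. \<exists>C>0. \<exists>h\<^sub>0>0.
        \<forall>xs L D N (\<phi> :: nat \<Rightarrow> nat \<Rightarrow> real^'n \<Rightarrow> 'b) f \<alpha> Q R h C\<^sub>W.
          srt_path \<Omega> xs L D \<and> D (L - 1) = leaf \<and>
          fill_distance (set xs) \<Omega> = ereal h \<and> h \<le> h\<^sub>0 \<and>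
          srt_basis k p \<Omega> L N \<phi> \<and> f \<in> cont_sobolev_space k p \<Omega> \<and> srt_fit xs L D N \<phi> f \<alpha> Q R \<and>
          sobolev_seminorm k p leaf (srt_prediction L N \<phi> \<alpha>)
            \<le> C\<^sub>W * inverse (srt_tau L R) * vec_norm2 (eval_vec f xs) \<longrightarrow>
          (let r = (\<lambda>x. f x - srt_prediction L N \<phi> \<alpha> x); d = real CARD('n); m = real (mi_order \<gamma>) in
           eLp_norm q leaf (weak_deriv leaf \<gamma> r)
             \<le> ennreal (C *
                 (h powr (real k - m - max 0 (d / p - enn2real (ennreal d / q))) *
                    (sobolev_seminorm k p \<Omega> f + C\<^sub>W * inverse (srt_tau L R) * vec_norm2 (eval_vec f xs))
                  + h powr (- m) * Max ((\<lambda>x. norm (r x)) ` (set xs \<inter> leaf))))))"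
proof (intro conjI allI impI)
  fix L N and \<phi> :: "nat \<Rightarrow> nat \<Rightarrow> real^'n \<Rightarrow> 'b" assume basis: "srt_basis k p \<Omega> L N \<phi>"
  obtain C where C: "0 \<le> C" "\<And>T \<alpha> B. convex T \<Longrightarrow> T \<subseteq> \<Omega> \<Longrightarrow> 0 \<le> B \<Longrightarrow> (\<forall>i<L. \<forall>j<N i. norm (\<alpha> i $ j) \<le> B) \<Longrightarrow>
      srt_prediction L N \<phi> \<alpha> \<in> sobolev_space k p T \<and> sobolev_seminorm k p T (srt_prediction L N \<phi> \<alpha>) \<le> C * B"
    using srt_prediction_sobolev[OF \<open>convex \<Omega>\<close> \<open>1 \<le> p\<close> basis] by blast
  show "\<exists>C\<^sub>W\<ge>0. \<forall>xs D f \<alpha> Q R.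
           srt_path \<Omega> xs L D \<and> f \<in> cont_sobolev_space k p \<Omega> \<and> srt_fit xs L D N \<phi> f \<alpha> Q R \<longrightarrow>
           sobolev_seminorm k p (D (L - 1)) (srt_prediction L N \<phi> \<alpha>)
             \<le> C\<^sub>W * inverse (srt_tau L R) * vec_norm2 (eval_vec f xs)"
  proof (intro exI[of _ "2 * C"] conjI allI impI; (elim conjE)?)
    show "0 \<le> 2 * C" using C by simp
    fix xs D \<alpha> Q R and f :: "real^'n \<Rightarrow> 'b"
    assume path: "srt_path \<Omega> xs L D" and fit: "srt_fit xs L D N \<phi> f \<alpha> Q R"
    have N: "\<forall>i<L. 1 \<le> N i" using basis by (simp add: srt_basis_def)
    note bound = srt_coefficient_bound[OF path fit N]
    have "L - 1 < L" using path by (simp add: srt_path_def)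
    note dom = srt_path_domain[OF path \<open>convex \<Omega>\<close> this]
    have "0 \<le> 2 * inverse (srt_tau L R) * vec_norm2 (eval_vec f xs)" using bound(1) by simp
    from C(2)[OF dom this] bound(2)
    have "sobolev_seminorm k p (D (L - 1)) (srt_prediction L N \<phi> \<alpha>) \<le> C * (2 * inverse (srt_tau L R) * vec_norm2 (eval_vec f xs))"
      by blast
    then show "sobolev_seminorm k p (D (L - 1)) (srt_prediction L N \<phi> \<alpha>) \<le> 2 * C * inverse (srt_tau L R) * vec_norm2 (eval_vec f xs)"
      by (simp add: ac_simps)
  qed
next
  fix leaf :: "(real^'n) set"
  let ?d = "real CARD('n)" and ?m = "real (mi_order \<gamma>)"
  let ?e = "real k - ?m - max 0 (?d / p - enn2real (ennreal ?d / q))"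
  show "\<exists>C>0. \<exists>h\<^sub>0>0.
        \<forall>xs L D N (\<phi> :: nat \<Rightarrow> nat \<Rightarrow> real^'n \<Rightarrow> 'b) f \<alpha> Q R h C\<^sub>W.
          srt_path \<Omega> xs L D \<and> D (L - 1) = leaf \<and>
          fill_distance (set xs) \<Omega> = ereal h \<and> h \<le> h\<^sub>0 \<and>
          srt_basis k p \<Omega> L N \<phi> \<and> f \<in> cont_sobolev_space k p \<Omega> \<and> srt_fit xs L D N \<phi> f \<alpha> Q R \<and>
          sobolev_seminorm k p leaf (srt_prediction L N \<phi> \<alpha>)
            \<le> C\<^sub>W * inverse (srt_tau L R) * vec_norm2 (eval_vec f xs) \<longrightarrow>
          (let r = (\<lambda>x. f x - srt_prediction L N \<phi> \<alpha> x); d = real CARD('n); m = real (mi_order \<gamma>) in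
           eLp_norm q leaf (weak_deriv leaf \<gamma> r)
             \<le> ennreal (C *
                 (h powr (real k - m - max 0 (d / p - enn2real (ennreal d / q))) *
                    (sobolev_seminorm k p \<Omega> f + C\<^sub>W * inverse (srt_tau L R) * vec_norm2 (eval_vec f xs))
                  + h powr (- m) * Max ((\<lambda>x. norm (r x)) ` (set xs \<inter> leaf)))))"
  proof (cases "convex leaf \<and> bounded leaf \<and> interior leaf \<noteq> {}")
    \<comment> \<open>Such a set is never a leaf when the fill distance is finite, so the claim is
      vacuous and any positive constants serve.\<close>
    case False
    have "False" if path: "srt_path \<Omega> xs L D" and "D (L - 1) = leaf" and fd: "fill_distance (set xs) \<Omega> = ereal h" for xs L D h
    proof -
      have "L - 1 < L" using path by (simp add: srt_path_def)
      then have "convex leaf" "leaf \<subseteq> \<Omega>" "interior leaf \<noteq> {}"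
        using srt_path_domain[OF path \<open>convex \<Omega>\<close>] path \<open>D (L - 1) = leaf\<close> by (auto simp: srt_path_def)
      moreover have "bounded \<Omega>" using fill_distance_finite(2)[OF \<open>open \<Omega>\<close> \<open>\<Omega> \<noteq> {}\<close> _ fd] by simp
      ultimately show False using False bounded_subset by blast
    qed
    then show ?thesis by (intro exI[of _ 1] conjI) auto
  next
    case True
    then have T: "convex leaf" "bounded leaf" "interior leaf \<noteq> {}" by auto
    obtain C h\<^sub>0 where "0 < C" "0 < h\<^sub>0" and sampling: "\<And>X h (u :: real^'n \<Rightarrow> 'b).
      finite X \<Longrightarrow> 0 < h \<Longrightarrow> h \<le> h\<^sub>0 \<Longrightarrow> (\<forall>y\<in>leaf. \<exists>z\<in>X. dist y z \<le> h) \<Longrightarrow> u \<in> sobolev_space k p leaf \<Longrightarrow> continuous_on leaf u \<Longrightarrow>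
      X \<inter> leaf \<noteq> {} \<and> eLp_norm q leaf (weak_deriv leaf \<gamma> u) \<le> ennreal (C * (h powr ?e * sobolev_seminorm k p leaf u
        + h powr (- ?m) * Max ((\<lambda>x. norm (u x)) ` (X \<inter> leaf))))"
      using sampling_inequality[OF \<open>1 \<le> p\<close> \<open>1 \<le> q\<close> _ _ T, of \<gamma> k] assms(6,7) by blast
    have main: "eLp_norm q leaf (weak_deriv leaf \<gamma> r) \<le> ennreal (4 * C *
                 (h powr ?e * (sobolev_seminorm k p \<Omega> f + C\<^sub>W * inverse (srt_tau L R) * vec_norm2 (eval_vec f xs))
                  + h powr (- ?m) * Max ((\<lambda>x. norm (r x)) ` (set xs \<inter> leaf))))"
      if path: "srt_path \<Omega> xs L D" and leaf: "D (L - 1) = leaf" and fd: "fill_distance (set xs) \<Omega> = ereal h" and "h \<le> h\<^sub>0"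
        and basis: "srt_basis k p \<Omega> L N \<phi>" and f: "f \<in> cont_sobolev_space k p \<Omega>"
        and CW: "sobolev_seminorm k p leaf (srt_prediction L N \<phi> \<alpha>) \<le> C\<^sub>W * inverse (srt_tau L R) * vec_norm2 (eval_vec f xs)"
        and r: "r = (\<lambda>x. f x - srt_prediction L N \<phi> \<alpha> x)"
      for xs L D N and \<phi> :: "nat \<Rightarrow> nat \<Rightarrow> real^'n \<Rightarrow> 'b" and f \<alpha> and R :: "nat \<Rightarrow> 'b mat" and h C\<^sub>W r
    proof -
      let ?s = "srt_prediction L N \<phi> \<alpha>" and ?Y = "C\<^sub>W * inverse (srt_tau L R) * vec_norm2 (eval_vec f xs)"
      note fill = fill_distance_finite[OF \<open>open \<Omega>\<close> \<open>\<Omega> \<noteq> {}\<close> _ fd, simplified]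
      have "L - 1 < L" using path by (simp add: srt_path_def)
      then have "leaf \<subseteq> \<Omega>" using srt_path_domain[OF path \<open>convex \<Omega>\<close>] leaf by blast
      have fW: "f \<in> sobolev_space k p \<Omega>" "continuous_on \<Omega> f" using f by (auto simp: cont_sobolev_space_def)
      have sW: "?s \<in> sobolev_space k p leaf"
        by (rule srt_prediction_in_sobolev_space[OF \<open>convex \<Omega>\<close> \<open>1 \<le> p\<close> basis T(1) \<open>leaf \<subseteq> \<Omega>\<close>])
      have contr: "continuous_on leaf r"
      proof -
        have "continuous_on \<Omega> ?s"
          unfolding srt_prediction_def srt_approx_def using basis
          by (intro continuous_intros) (auto simp: srt_basis_def cont_sobolev_space_def)
        then have "continuous_on \<Omega> r" unfolding r using fW by (intro continuous_intros)
        then show ?thesis using \<open>leaf \<subseteq> \<Omega>\<close> continuous_on_subset by blast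
      qed
      have fT: "f \<in> sobolev_space k p leaf" by (rule sobolev_subset(1)[OF fW(1) \<open>convex \<Omega>\<close> T(1) \<open>leaf \<subseteq> \<Omega>\<close> \<open>1 \<le> p\<close>])
      note diff = sobolev_diff[OF fT sW T(1) \<open>1 \<le> p\<close>, folded r]
      have sem: "sobolev_seminorm k p leaf r \<le> 4 * (sobolev_seminorm k p \<Omega> f + ?Y)"
        by (rule order_trans[OF diff(2)], intro mult_left_mono add_mono CW
            sobolev_seminorm_subset[OF fW(1) \<open>convex \<Omega>\<close> T(1) \<open>leaf \<subseteq> \<Omega>\<close> \<open>1 \<le> p\<close>]) simp
      have dense: "\<forall>y\<in>leaf. \<exists>z\<in>set xs. dist y z \<le> h" using fill(3) \<open>leaf \<subseteq> \<Omega>\<close> by blast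
      define M where "M = Max ((\<lambda>x. norm (r x)) ` (set xs \<inter> leaf))"
      from sampling[OF finite_set fill(1) \<open>h \<le> h\<^sub>0\<close> dense diff(1) contr]
      have ne: "set xs \<inter> leaf \<noteq> {}" and est: "eLp_norm q leaf (weak_deriv leaf \<gamma> r) \<le>
          ennreal (C * (h powr ?e * sobolev_seminorm k p leaf r + h powr (- ?m) * M))"
        unfolding M_def by blast+
      have "M \<in> (\<lambda>x. norm (r x)) ` (set xs \<inter> leaf)" unfolding M_def using ne by (intro Max_in) auto
      then have "0 \<le> M" by auto
      have "h powr ?e * sobolev_seminorm k p leaf r + h powr (- ?m) * M \<le> h powr ?e * (4 * (sobolev_seminorm k p \<Omega> f + ?Y)) + 4 * (h powr (- ?m) * M)"
        using sem \<open>0 \<le> M\<close> mult_nonneg_nonneg[of "h powr (- ?m)" M] by (intro add_mono mult_left_mono) auto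
      then have "C * (h powr ?e * sobolev_seminorm k p leaf r + h powr (- ?m) * M) \<le>
          C * (h powr ?e * (4 * (sobolev_seminorm k p \<Omega> f + ?Y)) + 4 * (h powr (- ?m) * M))"
        using \<open>0 < C\<close> by (intro mult_left_mono) auto
      also have "\<dots> = 4 * C * (h powr ?e * (sobolev_seminorm k p \<Omega> f + ?Y) + h powr (- ?m) * M)"
        by (simp add: algebra_simps)
      finally show ?thesis using est order_trans ennreal_leI unfolding M_def by blast
    qed
    show ?thesis
    \<comment> \<open>The 4 is the constant of \<open>sobolev_diff\<close>, which splits the
      seminorm of the residual into those of f and of the prediction.\<close>
    proof (rule exI[of _ "4 * C"], rule conjI[rotated], rule exI[of _ h\<^sub>0], intro conjI allI impI; (elim conjE)?)
      fix xs L D N and \<phi> :: "nat \<Rightarrow> nat \<Rightarrow> real^'n \<Rightarrow> 'b" and f \<alpha> Q R h C\<^sub>W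
      assume "srt_path \<Omega> xs L D" "D (L - 1) = leaf" "fill_distance (set xs) \<Omega> = ereal h" "h \<le> h\<^sub>0"
        "srt_basis k p \<Omega> L N \<phi>" "f \<in> cont_sobolev_space k p \<Omega>" "srt_fit xs L D N \<phi> f \<alpha> Q R"
        "sobolev_seminorm k p leaf (srt_prediction L N \<phi> \<alpha>) \<le> C\<^sub>W * inverse (srt_tau L R) * vec_norm2 (eval_vec f xs)"
      from main[OF this(1-6,8) refl]
      show "let r = (\<lambda>x. f x - srt_prediction L N \<phi> \<alpha> x); d = real CARD('n); m = real (mi_order \<gamma>) in
           eLp_norm q leaf (weak_deriv leaf \<gamma> r)
             \<le> ennreal (4 * C *
                 (h powr (real k - m - max 0 (d / p - enn2real (ennreal d / q))) *
                    (sobolev_seminorm k p \<Omega> f + C\<^sub>W * inverse (srt_tau L R) * vec_norm2 (eval_vec f xs))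
                  + h powr (- m) * Max ((\<lambda>x. norm (r x)) ` (set xs \<inter> leaf))))"
        unfolding Let_def .
    qed (use \<open>0 < C\<close> \<open>0 < h\<^sub>0\<close> in auto)
  qed
qed

end
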